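(* Let $p\ge 1$, $m\ge 1$ and $N$ be integers such that $N-\lceil \frac{m}{2}\rceil>p+2$. Then there exists a complete maximal map of genus $p$ with $2N$ complete ends and $2m$ simple ends, and with at least $2N$ singular components. That is, there exist a compact connected Riemann surface $\overline{M}$ of genus $p$, disjoint finite sets $E,F\subset\overline{M}$ with $|E|=2N$ and $|F|=2m$, and Weierstrass data $(M,G,\Omega)$ for a maximal map on $M=\overline{M}\setminus(E\cup F)$ such that the resulting maximal map $X:M\to\mathbb{E}^3_1$ is complete, every point of $E$ is a complete end of $X$, every point of $F$ is a simple end of $X$, and the set $\{q\in M:|G(q)|=1\}$ has at least $2N$ connected components.
   Context: $\mathbb{E}^3_1$ is $\mathbb{R}^3$ with the Lorentzian metric $dx^2+dy^2-dz^2$. Weierstrass data for a maximal map: a triple $(M,g,\omega)$ where $M$ is a connected Riemann surface, $g$ is a meromorphic function on $M$, and $\omega$ is a holomorphic $1$-form on $M$ such that $g\omega$ and $g^{-1}\omega$ are also holomorphic $1$-forms on $M$, satisfying: (1) $|g|\not\equiv 1$ on $M$; (2) (period conditions) for every closed loop $\gamma$ in $M$, $\int_\gamma g\omega+\overline{\int_\gamma g^{-1}\omega}=0$ and $\operatorname{Re}\int_\gamma\omega=0$. The associated maximal map is $X:M\to\mathbb{E}^3_1$, $X(z)=\operatorname{Re}\int_{z_0}^z\big(\tfrac12(g^{-1}+g),\tfrac{i}{2}(g^{-1}-g),1\big)\omega$ for a base point $z_0\in M$. Branch singularities (zeros of $\omega$) are allowed. The function $g$ is called the Gauss map of $X$.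 The induced (possibly degenerate) metric is $ds^2=\frac14(|g|^{-1}-|g|)^2|\omega|^2$. The maximal map $X$ is complete if there exist a compact subset $C\subset M$ and a symmetric $2$-tensor $T$ on $M$ such that $T\equiv0$ on $M\setminus C$ and $ds^2+T$ is a complete Riemannian metric on $M$. If $M=\overline{M}\setminus\{p_1,\dots,p_k\}$ with $\overline{M}$ a compact Riemann surface and the $p_i$ distinct, the genus of $X$ is the genus of $\overline{M}$, and the punctures $p_i$ are the ends of $X$. An end $p_i$ is a complete end if the induced metric $ds^2$ is complete at $p_i$ (paths in $M$ diverging to $p_i$ have infinite $ds^2$-length). An end $p_i$ is simple if (1) the Weierstrass data $(g,\omega)$ extend meromorphically across $p_i$, and (2) the poles of $g^{-1}\omega$, $g\omega$ and $\omega$ at $p_i$ are of order at most $2$. The singular components of $X$ are the connected components of the set $\{q\in M:|g(q)|=1\}$. *)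

theory Defs
  imports "HOL-Complex_Analysis.Complex_Analysis" "HOL-Homology.Homology"
begin

section \<open>Riemann surfaces\<close>

type_synonym 'a chart = "'a set \<times> ('a \<Rightarrow> complex)"

record 'a surface =
  surf_top :: "'a topology"
  charts :: "'a chart set"

(* A compact connected surface has the cardinality of the continuum, so every one of them has a
   copy whose underlying set consists of elements of this type; its topology is any
   'a topology and is unrelated to the product topology of the type. *)
type_synonym surface_point = "complex \<times> complex"

abbreviation points :: "'a surface \<Rightarrow> 'a set" where
  "points S \<equiv> topspace (surf_top S)"

definition chart_inv :: "'a chart \<Rightarrow> complex \<Rightarrow> 'a" where
  "chart_inv c = inv_into (fst c) (snd c)"

definition transition :: "'a chart \<Rightarrow> 'a chart \<Rightarrow> complex \<Rightarrow> complex" where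
  "transition c d = snd d \<circ> chart_inv c"

definition chart_on :: "'a topology \<Rightarrow> 'a chart \<Rightarrow> bool" where
  "chart_on X c \<longleftrightarrow> openin X (fst c) \<and> open (snd c ` fst c) \<and>
     homeomorphic_map (subtopology X (fst c)) (top_of_set (snd c ` fst c)) (snd c)"

definition riemann_surface :: "'a surface \<Rightarrow> bool" where
  "riemann_surface S \<longleftrightarrow>
     points S \<noteq> {} \<and> connected_space (surf_top S) \<and> Hausdorff_space (surf_top S) \<and>
     second_countable (surf_top S) \<and>
     (\<forall>c\<in>charts S. chart_on (surf_top S) c) \<and> (\<Union>c\<in>charts S. fst c) = points S \<and>
     (\<forall>c\<in>charts S. \<forall>d\<in>charts S. transition c d holomorphic_on snd c ` (fst c \<inter> fst d))"

definition chart_minus :: "'a set \<Rightarrow> 'a chart \<Rightarrow> 'a chart" where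
  "chart_minus P c = (fst c - P, snd c)"

definition puncture :: "'a surface \<Rightarrow> 'a set \<Rightarrow> 'a surface" where
  "puncture S P = \<lparr>surf_top = subtopology (surf_top S) (points S - P),
                   charts = chart_minus P ` charts S\<rparr>"

(* Genus as half the rank of the first integral homology group. *)
definition has_genus :: "'a surface \<Rightarrow> nat \<Rightarrow> bool" where
  "has_genus S p \<longleftrightarrow> homology_group 1 (surf_top S) \<cong> free_Abelian_group {..<2 * p}"

definition chart_at :: "'a surface \<Rightarrow> 'a \<Rightarrow> 'a chart" where
  "chart_at S x = (SOME c. c \<in> charts S \<and> x \<in> fst c)"


section \<open>Meromorphic functions and one-forms\<close>

(* A pole is encoded by the value 0, so norm (g q) = 1 holds exactly where the
   extended-complex-valued function has modulus 1, and inverse (g q) is the value of 1/g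
   under the same convention. *)
definition meromorphic_fun :: "'a surface \<Rightarrow> ('a \<Rightarrow> complex) \<Rightarrow> bool" where
  "meromorphic_fun S g \<longleftrightarrow>
     (\<forall>c\<in>charts S. (g \<circ> chart_inv c) nicely_meromorphic_on snd c ` fst c)"

(* A one-form is given by its coefficient f_c in each chart c; it reads f_c(z) dz there. *)
type_synonym 'a one_form = "'a chart \<Rightarrow> complex \<Rightarrow> complex"

definition holomorphic_form :: "'a surface \<Rightarrow> 'a one_form \<Rightarrow> bool" where
  "holomorphic_form S \<omega> \<longleftrightarrow>
     (\<forall>c\<in>charts S. \<omega> c holomorphic_on snd c ` fst c) \<and>
     (\<forall>c\<in>charts S. \<forall>d\<in>charts S. \<forall>z\<in>snd c ` (fst c \<inter> fst d).
        \<omega> c z = \<omega> d (transition c d z) * deriv (transition c d) z)"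

(* A pole of g may be cancelled by a zero of the form, hence remove_sings. *)
definition fun_times_form :: "('a \<Rightarrow> complex) \<Rightarrow> 'a one_form \<Rightarrow> 'a one_form" where
  "fun_times_form g \<omega> c = remove_sings (\<lambda>z. g (chart_inv c z) * \<omega> c z)"

definition pw_C1_path :: "'a surface \<Rightarrow> real \<Rightarrow> real \<Rightarrow> (real \<Rightarrow> 'a) \<Rightarrow> bool" where
  "pw_C1_path S a b \<gamma> \<longleftrightarrow>
     continuous_map (top_of_set {a..b}) (surf_top S) \<gamma> \<and>
     (\<exists>K. finite K \<and>
        (\<forall>c\<in>charts S. (snd c \<circ> \<gamma>) C1_differentiable_on ({t\<in>{a..b}. \<gamma> t \<in> fst c} - K)))"

definition path_from_to :: "'a surface \<Rightarrow> 'a \<Rightarrow> 'a \<Rightarrow> (real \<Rightarrow> 'a) \<Rightarrow> bool" where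
  "path_from_to S x y \<gamma> \<longleftrightarrow> pw_C1_path S 0 1 \<gamma> \<and> \<gamma> 0 = x \<and> \<gamma> 1 = y"

(* By the transformation laws, this and path_length below do not depend on the choice
   made by chart_at. *)
definition form_integral :: "'a surface \<Rightarrow> 'a one_form \<Rightarrow> (real \<Rightarrow> 'a) \<Rightarrow> complex" where
  "form_integral S \<omega> \<gamma> = integral {0..1} (\<lambda>t.
     let c = chart_at S (\<gamma> t)
     in \<omega> c (snd c (\<gamma> t)) * vector_derivative (snd c \<circ> \<gamma>) (at t))"


section \<open>Riemannian metrics\<close>

primrec C_k_on :: "nat \<Rightarrow> (complex \<Rightarrow> real) \<Rightarrow> complex set \<Rightarrow> bool" where
  "C_k_on 0 f A \<longleftrightarrow> continuous_on A f"
| "C_k_on (Suc k) f A \<longleftrightarrow>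
     (\<exists>fx fy. (\<forall>z\<in>A. (f has_derivative (\<lambda>h. Re h * fx z + Im h * fy z)) (at z)) \<and>
        C_k_on k fx A \<and> C_k_on k fy A)"

definition smooth_on :: "(complex \<Rightarrow> real) \<Rightarrow> complex set \<Rightarrow> bool" where
  "smooth_on f A \<longleftrightarrow> (\<forall>k. C_k_on k f A)"

(* h c z u v: the tensor at the point with coordinate z in the chart c, applied to the tangent
   vectors with coordinates u, v. *)
type_synonym 'a tensor2 = "'a chart \<Rightarrow> complex \<Rightarrow> complex \<Rightarrow> complex \<Rightarrow> real"

definition sym_tensor :: "'a surface \<Rightarrow> 'a tensor2 \<Rightarrow> bool" where
  "sym_tensor S h \<longleftrightarrow>
     (\<forall>c\<in>charts S. \<forall>z\<in>snd c ` fst c. bilinear (h c z) \<and> (\<forall>u v. h c z u v = h c z v u)) \<and>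
     (\<forall>c\<in>charts S. \<forall>u v. smooth_on (\<lambda>z. h c z u v) (snd c ` fst c)) \<and>
     (\<forall>c\<in>charts S. \<forall>d\<in>charts S. \<forall>z\<in>snd c ` (fst c \<inter> fst d). \<forall>u v.
        h c z u v = h d (transition c d z)
          (deriv (transition c d) z * u) (deriv (transition c d) z * v))"

definition riemannian_metric :: "'a surface \<Rightarrow> 'a tensor2 \<Rightarrow> bool" where
  "riemannian_metric S h \<longleftrightarrow> sym_tensor S h \<and>
     (\<forall>c\<in>charts S. \<forall>z\<in>snd c ` fst c. \<forall>u. u \<noteq> 0 \<longrightarrow> h c z u u > 0)"

definition path_length :: "'a surface \<Rightarrow> 'a tensor2 \<Rightarrow> real set \<Rightarrow> (real \<Rightarrow> 'a) \<Rightarrow> ennreal" where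
  "path_length S h I \<gamma> = (\<integral>\<^sup>+ t \<in> I.
     (let c = chart_at S (\<gamma> t); v = vector_derivative (snd c \<circ> \<gamma>) (at t)
      in ennreal (sqrt (h c (snd c (\<gamma> t)) v v))) \<partial>lborel)"

definition riemannian_dist :: "'a surface \<Rightarrow> 'a tensor2 \<Rightarrow> 'a \<Rightarrow> 'a \<Rightarrow> real" where
  "riemannian_dist S h x y =
     enn2real (INF \<gamma> \<in> {\<gamma>. path_from_to S x y \<gamma>}. path_length S h {0..1} \<gamma>)"

definition complete_riemannian_metric :: "'a surface \<Rightarrow> 'a tensor2 \<Rightarrow> bool" where
  "complete_riemannian_metric S h \<longleftrightarrow>
     riemannian_metric S h \<and> Metric_space.mcomplete (points S) (riemannian_dist S h)"


section \<open>Maximal maps\<close>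

definition weierstrass_data :: "'a surface \<Rightarrow> ('a \<Rightarrow> complex) \<Rightarrow> 'a one_form \<Rightarrow> bool" where
  "weierstrass_data S g \<omega> \<longleftrightarrow>
     riemann_surface S \<and>
     meromorphic_fun S g \<and> (\<exists>q\<in>points S. g q \<noteq> 0) \<and>  \<comment> \<open>so that \<open>1/g\<close> makes sense\<close>
     holomorphic_form S \<omega> \<and>
     holomorphic_form S (fun_times_form g \<omega>) \<and>
     holomorphic_form S (fun_times_form (\<lambda>q. inverse (g q)) \<omega>) \<and>
     (\<exists>q\<in>points S. norm (g q) \<noteq> 1) \<and>
     (\<forall>x \<gamma>. path_from_to S x x \<gamma> \<longrightarrow>
        form_integral S (fun_times_form g \<omega>) \<gamma>
          + cnj (form_integral S (fun_times_form (\<lambda>q. inverse (g q)) \<omega>) \<gamma>) = 0 \<and>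
        Re (form_integral S \<omega> \<gamma>) = 0)"

(* X is the map with this data and base point z0. The period conditions make the right-hand side
   independent of the path. *)
definition maximal_map ::
  "'a surface \<Rightarrow> ('a \<Rightarrow> complex) \<Rightarrow> 'a one_form \<Rightarrow> 'a \<Rightarrow> ('a \<Rightarrow> real ^ 3) \<Rightarrow> bool" where
  "maximal_map S g \<omega> z0 X \<longleftrightarrow>
     weierstrass_data S g \<omega> \<and> z0 \<in> points S \<and>
     (let g\<omega> = fun_times_form g \<omega>; g'\<omega> = fun_times_form (\<lambda>q. inverse (g q)) \<omega> in
      \<forall>z\<in>points S. \<forall>\<gamma>. path_from_to S z0 z \<gamma> \<longrightarrow>
        X z = vector [Re (form_integral S (\<lambda>c w. (g'\<omega> c w + g\<omega> c w) / 2) \<gamma>),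
                      Re (form_integral S (\<lambda>c w. \<i> / 2 * (g'\<omega> c w - g\<omega> c w)) \<gamma>),
                      Re (form_integral S \<omega> \<gamma>)])"

(* The pullback of dx^2 + dy^2 - dz^2 under the maximal map:
   ds^2 = 1/4 (1/|g| - |g|)^2 |omega|^2, written as 1/4 (|omega/g| - |g omega|)^2 so that it is
   also correct at the zeros and poles of g. *)
definition induced_metric :: "('a \<Rightarrow> complex) \<Rightarrow> 'a one_form \<Rightarrow> 'a tensor2" where
  "induced_metric g \<omega> c z u v =
     (norm (fun_times_form (\<lambda>q. inverse (g q)) \<omega> c z) - norm (fun_times_form g \<omega> c z))\<^sup>2 / 4
       * (u \<bullet> v)"

definition complete_maximal :: "'a surface \<Rightarrow> ('a \<Rightarrow> complex) \<Rightarrow> 'a one_form \<Rightarrow> bool" where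
  "complete_maximal S g \<omega> \<longleftrightarrow>
     (\<exists>C T. compactin (surf_top S) C \<and> sym_tensor S T \<and>
        (\<forall>c\<in>charts S. \<forall>z\<in>snd c ` (fst c - C). \<forall>u v. T c z u v = 0) \<and>
        complete_riemannian_metric S (\<lambda>c z u v. induced_metric g \<omega> c z u v + T c z u v))"

(* In the next two definitions g and \<omega> live on puncture S P and x \<in> P. *)

definition complete_end ::
  "'a surface \<Rightarrow> 'a set \<Rightarrow> ('a \<Rightarrow> complex) \<Rightarrow> 'a one_form \<Rightarrow> 'a \<Rightarrow> bool" where
  "complete_end S P g \<omega> x \<longleftrightarrow>
     (\<forall>\<gamma>. (\<forall>b\<in>{0..<1}. pw_C1_path (puncture S P) 0 b \<gamma>) \<and>
          limitin (surf_top S) \<gamma> x (at_left 1) \<longrightarrow>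
        path_length (puncture S P) (induced_metric g \<omega>) {0..<1} \<gamma> = \<infinity>)"

definition simple_end ::
  "'a surface \<Rightarrow> 'a set \<Rightarrow> ('a \<Rightarrow> complex) \<Rightarrow> 'a one_form \<Rightarrow> 'a \<Rightarrow> bool" where
  "simple_end S P g \<omega> x \<longleftrightarrow>
     (\<forall>c\<in>charts S. x \<in> fst c \<longrightarrow>
        (let c' = chart_minus P c; z = snd c x in
         (g \<circ> chart_inv c') meromorphic_on {z} \<and> \<omega> c' meromorphic_on {z} \<and>
         (\<forall>\<eta>\<in>{fun_times_form (\<lambda>q. inverse (g q)) \<omega>, fun_times_form g \<omega>, \<omega>}.
            is_pole (\<eta> c') z \<longrightarrow> zorder (\<eta> c') z \<ge> -2)))"

definition singular_components :: "'a surface \<Rightarrow> ('a \<Rightarrow> complex) \<Rightarrow> 'a set set" where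
  "singular_components S g =
     connected_components_of (subtopology (surf_top S) {q \<in> points S. norm (g q) = 1})"

end

theory Submission imports Defs
begin

text \<open>
The Lorentzian catenoid is the maximal surface with data \<open>g = z\<close>, \<open>\<omega> = dz/z\<close> on the sphere minus
\<open>0\<close> and \<open>\<infinity>\<close>. For a nonconstant meromorphic function \<open>f\<close> on a compact Riemann surface \<open>S\<close>, pull these data
back: \<open>g = f\<close> and \<open>\<omega> = df/f\<close> on \<open>M = S - f\<inverse>{0, \<infinity>}\<close>. Then \<open>g\<omega> = df\<close> and \<open>\<omega>/g = -d(1/f)\<close> are exact and
\<open>Re (df/f) = d ln |f|\<close> is exact, so all period conditions hold for every choice of \<open>f\<close>. The induced
metric is \<open>ds = |1 - |f|\<^sup>-\<^sup>2| |df| / 2\<close>, and this dominates \<open>|dh|\<close> for \<open>h = (|f| + 1/|f|)/2\<close>. As \<open>h\<close> tends to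
infinity at each zero and each pole of \<open>f\<close>, each puncture is a complete end. The metric degenerates
where \<open>|f| = 1\<close> or \<open>df = 0\<close>; these points lie in a compact sublevel set of \<open>h\<close>. Adding a nonnegative
conformal tensor of compact support that is positive there gives a Riemannian metric for which \<open>h\<close>
is still 1-Lipschitz, and a metric that admits a proper 1-Lipschitz function is complete. At a simple
zero of \<open>f\<close> the forms \<open>\<omega>/g\<close>, \<open>\<omega>\<close>, \<open>g\<omega>\<close> have order \<open>-2\<close>, \<open>-1\<close>, \<open>0\<close>, so that puncture is a simple end. This
is the content of the locale \<open>catenoid_pullback\<close>.

It remains to choose \<open>S\<close> and \<open>f\<close>. For \<open>S\<close> take the curve \<open>x\<^sup>n = y\<^sup>2 + 1\<close> with \<open>n = 2p + 1\<close>, completed by one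
point at infinity. Let \<open>v = 1/x\<close>, \<open>d = N + m - 1\<close> and \<open>f = 2 (v\<^sup>d - 2\<^sup>d)\<close>. The poles of \<open>f\<close> are the two points
with \<open>x = 0\<close>. The zeros are the \<open>2d\<close> points with \<open>x\<^sup>d = 2\<^sup>-\<^sup>d\<close>, and they are simple because the critical points of
\<open>x\<close> have \<open>|x| = 1\<close> or \<open>x = \<infinity>\<close>. So there are \<open>2d + 2 = 2N + 2m\<close> punctures, of which any \<open>2m\<close> zeros serve as
\<open>F\<close> and the others as \<open>E\<close>. On \<open>|f| = 1\<close> the power \<open>v\<^sup>d\<close> stays near \<open>2\<^sup>d\<close>, off the negative axis, and
\<open>|x| < 1\<close>; so the branch of the \<open>d\<close>th root that gives \<open>v\<close> from \<open>v\<^sup>d\<close>, and the branch of the square root that gives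
\<open>y\<close> from \<open>x\<^sup>n - 1\<close>, are locally constant. They take \<open>2d\<close> values, whence at least \<open>2d \<ge> 2N\<close> singular
components.

The genus is defined by singular homology. The halves \<open>Im y > -1\<close> and \<open>Im y < 1\<close> of the affine curve
are discs, since each contains just one branch point of the \<open>n\<close>-sheeted projection \<open>y\<close>; their intersection is the union of
\<open>n\<close> sheets over a strip. Hence the affine curve has first homology \<open>\<int>\<^bsup>n-1\<^esup>\<close>, the kernel of the
augmentation of \<open>\<int>\<^sup>n\<close>. Filling in the point at infinity kills only the class of a loop around it, and
this class is zero: the automorphism \<open>x \<mapsto> \<eta>x\<close>, with \<open>\<eta>\<close> a primitive \<open>n\<close>th root of unity, is a
rotation near infinity and so fixes the class, but it permutes the sheets cyclically, and an element of the
augmentation kernel that is fixed by a cyclic permutation vanishes.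
\<close>

section \<open>Zeroth and first homology from a sheet function\<close>

lemma iso_preimage:
  assumes "h \<in> iso G H" "y \<in> carrier H"
  shows "\<exists>x\<in>carrier G. h x = y"
proof -
  have "y \<in> h ` carrier G" using assms by (simp add: iso_def bij_betw_def)
  then show ?thesis by blast
qed

lemma iso_eq_oneD:
  assumes "h \<in> iso G H" "group G" "group H" "x \<in> carrier G" "h x = \<one>\<^bsub>H\<^esub>"
  shows "x = \<one>\<^bsub>G\<^esub>"
proof -
  interpret group_hom G H h
    using assms by (simp add: group_hom_def group_hom_axioms_def iso_imp_homomorphism)
  show ?thesis using assms iso_iff by simp
qed

text \<open>The point carried by a singular \<open>0\<close>-simplex is its value at the only vertex of the standard
\<open>0\<close>-simplex, the function that is \<open>1\<close> at \<open>0\<close> and \<open>0\<close> elsewhere. So a \<open>0\<close>-chain is a formal sum of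
points, and its image under \<open>s\<close> is a formal sum of labels of sheets.\<close>
definition sheet_count :: "('a \<Rightarrow> 'k) \<Rightarrow> 'a chain \<Rightarrow> 'k \<Rightarrow>\<^sub>0 int" where
  "sheet_count s = frag_extend (\<lambda>\<sigma>. frag_of (s (\<sigma> (\<lambda>j. if j = 0 then 1 else 0))))"

lemma sheet_count_diff: "sheet_count s (a - b) = sheet_count s a - sheet_count s b"
  by (simp add: sheet_count_def frag_extend_diff)

lemma sheet_count_add: "sheet_count s (a + b) = sheet_count s a + sheet_count s b"
  by (simp add: sheet_count_def frag_extend_add)

lemma singular_simplex_0_of_point:
  "x \<in> topspace X \<Longrightarrow> singular_simplex 0 X (restrict (\<lambda>_. x) (standard_simplex 0))"
  by (simp add: singular_simplex_def)

text \<open>An edge is a path, so its two ends carry the same label.\<close>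
lemma sheet_count_boundary:
  assumes inv: "\<And>g. pathin X g \<Longrightarrow> s (g 0) = s (g 1)" and "singular_chain (Suc 0) X d"
  shows "sheet_count s (chain_boundary (Suc 0) d) = 0"
  using assms(2) unfolding singular_chain_def
proof (induction d rule: frag_induction)
  case (one f)
  let ?e = "\<lambda>i j. if j = (i::nat) then 1 else (0::real)"
  have f: "continuous_map (subtopology (powertop_real UNIV) (standard_simplex 1)) X f"
    using one by (simp add: singular_simplex_def)
  define g where "g = f \<circ> (\<lambda>t j. if j = 0 then 1 - t else if j = Suc 0 then t else 0)"
  have "continuous_map (top_of_set {0..1}) (subtopology (powertop_real UNIV) (standard_simplex 1))
     (\<lambda>t j. if j = 0 then 1 - t else if j = Suc 0 then t else (0::real))"
  proof -
    have "continuous_on {0..1} (\<lambda>t. if k = Suc 0 then t else (0::real))" for k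
      by (cases "k = Suc 0") auto
    then show ?thesis
      by (auto simp: continuous_map_in_subtopology continuous_map_componentwise_UNIV
          standard_simplex_def intro!: continuous_intros)
  qed
  then have "pathin X g"
    unfolding pathin_def g_def using f by (rule continuous_map_compose)
  then have "s (g 0) = s (g 1)" by (rule inv)
  moreover have "g 0 = f (?e 0)" "g 1 = f (?e 1)"
    unfolding g_def o_def by (auto intro!: arg_cong[of _ _ f])
  moreover have "singular_face (Suc 0) 0 f (?e 0) = f (?e 1)"
     "singular_face (Suc 0) (Suc 0) f (?e 0) = f (?e 0)"
    by (auto simp: singular_face_def simplical_face_def standard_simplex_0 intro!: arg_cong[of _ _ f])
  ultimately show ?case
    by (simp add: sheet_count_def chain_boundary_of frag_extend_diff)
next
  case (diff a b)
  then show ?case by (simp add: chain_boundary_diff sheet_count_diff)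
qed (simp add: sheet_count_def)

lemma homologous_points:
  assumes path: "path_connectedin X C" and C: "f (\<lambda>j. if j = 0 then 1 else 0) \<in> C" "g (\<lambda>j. if j = 0 then 1 else 0) \<in> C"
    and f: "singular_simplex 0 X f" and g: "singular_simplex 0 X g"
  shows "homologous_rel 0 X {} (frag_of f) (frag_of g)"
proof -
  have "singular_simplex 0 (subtopology X C) h" if "singular_simplex 0 X h" "h (\<lambda>j. if j = 0 then 1 else 0) \<in> C" for h
    using that by (auto simp: singular_simplex_subtopology standard_simplex_0)
  then have "homologous_rel 0 (subtopology X C) {} (frag_of f) (frag_of g)"
    using assms by (auto intro!: iso_integer_zeroth_homology_group_aux simp: path_connectedin_def)
  then show ?thesis
    by (auto simp: homologous_rel_def singular_boundary singular_chain_subtopology)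
qed

text \<open>A point is homologous to a fixed representative of its sheet, so a chain is determined up to
boundaries by its labels.\<close>
lemma sheet_count_kernel:
  assumes conn: "\<And>k. path_connectedin X {x \<in> topspace X. s x = k}"
    and c: "singular_chain 0 X c" and 0: "sheet_count s c = 0"
  shows "singular_relboundary 0 X {} c"
proof -
  define r where "r k = restrict (\<lambda>_. SOME x. x \<in> topspace X \<and> s x = k) (standard_simplex 0)" for k
  have "homologous_rel 0 X {} c (frag_extend (\<lambda>k. frag_of (r k)) (sheet_count s c))"
    using c unfolding singular_chain_def
  proof (induction c rule: frag_induction)
    case (one f)
    let ?x = "f (\<lambda>j. if j = 0 then 1 else 0)"
    have x: "?x \<in> topspace X"
      using one by (auto simp: singular_simplex_def continuous_map_def standard_simplex_0)
    define z where "z = (SOME z. z \<in> topspace X \<and> s z = s ?x)"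
    have z: "z \<in> topspace X \<and> s z = s ?x"
      unfolding z_def by (rule someI[of _ ?x]) (use x in simp)
    have "homologous_rel 0 X {} (frag_of f) (frag_of (r (s ?x)))"
      using z x one by (intro homologous_points[OF conn[of "s ?x"]])
        (auto simp: r_def z_def[symmetric] standard_simplex_0 intro: singular_simplex_0_of_point[simplified standard_simplex_0])
    then show ?case by (simp add: sheet_count_def)
  next
    case (diff a b)
    then show ?case by (simp add: sheet_count_diff frag_extend_diff homologous_rel_diff)
  qed (simp add: sheet_count_def)
  then show ?thesis
    by (simp add: 0 homologous_rel_def)
qed

text \<open>A function \<open>s\<close> that is constant on paths and has path-connected fibres labels the path components
of \<open>X\<close>. Having \<open>\<delta>\<close> given on chains by an explicit formula, rather than only an abstract isomorphism, is what later
lets the action of a continuous map be read off from its action on labels.\<close>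
lemma zeroth_homology_sheets:
  assumes inv: "\<And>g. pathin X g \<Longrightarrow> s (g 0) = s (g 1)"
    and conn: "\<And>k. path_connectedin X {x \<in> topspace X. s x = k}"
  obtains \<delta> where "\<delta> \<in> iso (homology_group 0 X) (free_Abelian_group (s ` topspace X))"
    "\<And>c. singular_chain 0 X c \<Longrightarrow> \<delta> (homologous_rel_set 0 X {} c) = sheet_count s c"
proof -
  let ?G = "relcycle_group 0 X {}" and ?F = "free_Abelian_group (s ` topspace X)"
  have cyc: "singular_relcycle 0 X {} c \<longleftrightarrow> singular_chain 0 X c" for c
    by (auto simp: singular_cycle chain_boundary_def)
  have pt: "f (\<lambda>j. if j = 0 then 1 else 0) \<in> topspace X" if "singular_simplex 0 X f" for f
    using that by (auto simp: singular_simplex_def continuous_map_def standard_simplex_0)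
  have keys: "Poly_Mapping.keys (sheet_count s c) \<subseteq> s ` topspace X" if "singular_chain 0 X c" for c
    using that keys_frag_extend[of "\<lambda>\<sigma>. frag_of (s (\<sigma> (\<lambda>j. if j = 0 then 1 else 0)))" c] pt
    unfolding sheet_count_def singular_chain_def by fastforce
  interpret h: group_hom ?G ?F "sheet_count s"
    using keys by (auto simp: group_hom_def group_hom_axioms_def hom_def cyc sheet_count_add)
  have "carrier ?F \<subseteq> sheet_count s ` carrier ?G"
  proof
    fix y assume "y \<in> carrier ?F"
    then have "Poly_Mapping.keys y \<subseteq> s ` topspace X" by simp
    then show "y \<in> sheet_count s ` carrier ?G"
    proof (induction y rule: frag_induction)
      case zero
      have "sheet_count s 0 = 0" by (simp add: sheet_count_def)
      moreover have "0 \<in> carrier ?G" by (simp add: cyc)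
      ultimately show ?case by (metis imageI)
    next
      case (one k)
      then obtain x where x: "x \<in> topspace X" "k = s x" by auto
      show ?case
        by (rule image_eqI[of _ _ "frag_of (restrict (\<lambda>_. x) (standard_simplex 0))"])
           (use x singular_simplex_0_of_point[of x X] in \<open>auto simp: sheet_count_def cyc singular_chain_of standard_simplex_0\<close>)
    next
      case (diff a b)
      then show ?case by (auto simp: cyc image_iff simp flip: sheet_count_diff) (metis sheet_count_diff singular_chain_diff)
    qed
  qed
  then have surj: "sheet_count s ` carrier ?G = carrier ?F" using h.hom_closed by blast
  have ker: "kernel ?G ?F (sheet_count s) = singular_relboundary_set 0 X {}"
  proof (intro equalityI subsetI)
    fix c assume "c \<in> kernel ?G ?F (sheet_count s)"
    then have "singular_chain 0 X c" "sheet_count s c = 0" by (auto simp: kernel_def cyc)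
    then show "c \<in> singular_relboundary_set 0 X {}"
      using sheet_count_kernel[where s = s and X = X, OF conn] by simp
  next
    fix c assume "c \<in> singular_relboundary_set 0 X {}"
    then obtain d where "singular_chain (Suc 0) X d" "c = chain_boundary (Suc 0) d"
      by (auto simp: singular_boundary)
    then show "c \<in> kernel ?G ?F (sheet_count s)"
      using sheet_count_boundary[where s = s and X = X, OF inv] singular_chain_boundary[of "Suc 0" X d]
      by (simp add: kernel_def cyc)
  qed
  let ?d = "\<lambda>Y. the_elem (sheet_count s ` Y)"
  have iso: "?d \<in> iso (homology_group 0 X) ?F"
    using h.FactGroup_iso_set[OF surj] unfolding ker relative_homology_group_def by simp
  have val: "?d (homologous_rel_set 0 X {} c) = sheet_count s c" if "singular_chain 0 X c" for c
  proof -
    have A: "sheet_count s b = sheet_count s c" if "homologous_rel 0 X {} c b" for b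
    proof -
      have "c - b \<in> kernel ?G ?F (sheet_count s)" using that unfolding ker by (simp add: homologous_rel_def)
      then show ?thesis by (simp add: kernel_def sheet_count_diff)
    qed
    have "sheet_count s ` (homologous_rel_set 0 X {} c) = {sheet_count s c}"
    proof (intro equalityI subsetI)
      show "y \<in> {sheet_count s c}" if "y \<in> sheet_count s ` (homologous_rel_set 0 X {} c)" for y
        using that A by blast
      show "y \<in> sheet_count s ` (homologous_rel_set 0 X {} c)" if "y \<in> {sheet_count s c}" for y
        using that by (intro image_eqI[of _ _ c]) auto
    qed
    then show ?thesis by simp
  qed
  show ?thesis using that[OF iso val] .
qed


lemma sheet_count_chain_map:
  assumes "singular_chain 0 X c"
  shows "sheet_count t (chain_map 0 f c) = sheet_count (t \<circ> f) c"
  using assms unfolding singular_chain_def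
proof (induction c rule: frag_induction)
  case (one x)
  then show ?case
    by (simp add: sheet_count_def chain_map_of simplex_map_def standard_simplex_0)
qed (auto simp: sheet_count_diff chain_map_diff, simp add: sheet_count_def)

lemma frag_extend_sheet_count:
  "frag_extend (\<lambda>k. frag_of (h k)) (sheet_count s c) = sheet_count (h \<circ> s) c"
  unfolding sheet_count_def using frag_extend_compose[of "\<lambda>k. frag_of (h k)"]
  by (simp add: o_def)

text \<open>Reduced homology is the kernel of the map to the homology of a point, and a point has a
single sheet; in terms of labels this map is therefore the augmentation.\<close>
lemma reduced_zeroth_homology_class:
  assumes "singular_chain 0 X c"
  shows "homologous_rel_set 0 X {} c \<in> carrier (reduced_homology_group 0 X)
     \<longleftrightarrow> frag_extend (\<lambda>_. frag_of ()) (sheet_count s c) = 0"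
proof -
  let ?P = "discrete_topology {()}"
  have pc: "path_connected_space ?P"
    unfolding path_connected_space_def pathin_def
    by (auto intro!: exI[of _ "\<lambda>_. ()"])
  obtain \<delta> where d: "\<delta> \<in> iso (homology_group 0 ?P) (free_Abelian_group ((\<lambda>_. ()) ` topspace ?P))"
    and dv: "\<And>c. singular_chain 0 ?P c \<Longrightarrow> \<delta> (homologous_rel_set 0 ?P {} c) = sheet_count (\<lambda>_. ()) c"
    by (rule zeroth_homology_sheets[of ?P "\<lambda>_. ()"])
      (use pc in \<open>auto simp: path_connectedin_def\<close>)
  interpret d: group_hom "homology_group 0 ?P" "free_Abelian_group ((\<lambda>_. ()) ` topspace ?P)" \<delta>
    using d by (simp add: group_hom_def group_hom_axioms_def iso_imp_homomorphism)
  have cyc: "singular_relcycle 0 X {} c" using assms by (simp add: singular_cycle chain_boundary_def)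
  have cm: "singular_chain 0 ?P (chain_map 0 (\<lambda>_. ()) c)"
    using assms by (rule singular_chain_chain_map) auto
  have "hom_induced 0 X {} ?P {} (\<lambda>_. ()) (homologous_rel_set 0 X {} c)
      = homologous_rel_set 0 ?P {} (chain_map 0 (\<lambda>_. ()) c)"
    using hom_induced_chain_map_gen[of X ?P "\<lambda>_. ()" "{}" "{}" 0 c] cyc by simp
  moreover have "homologous_rel_set 0 ?P {} (chain_map 0 (\<lambda>_. ()) c) \<in> carrier (homology_group 0 ?P)"
    using cm by (auto simp: carrier_relative_homology_group_0 singular_cycle chain_boundary_def)
  moreover have "homologous_rel_set 0 X {} c \<in> carrier (homology_group 0 X)"
    using cyc by (auto simp: carrier_relative_homology_group_0)
  moreover have "\<delta> (homologous_rel_set 0 ?P {} (chain_map 0 (\<lambda>_. ()) c)) 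
      = frag_extend (\<lambda>_. frag_of ()) (sheet_count s c)"
    using dv[OF cm] sheet_count_chain_map[OF assms, of "\<lambda>_. ()" "\<lambda>_. ()"]
      frag_extend_sheet_count[of "\<lambda>_. ()" s c] by (simp add: o_def)
  ultimately show ?thesis
    using d d.iso_iff d.hom_one by (auto simp: carrier_reduced_homology_group kernel_def)
qed

lemma zeroth_homology_class_exists:
  assumes "z \<in> carrier (homology_group 0 X)"
  obtains c where "singular_chain 0 X c" "z = homologous_rel_set 0 X {} c"
  using assms by (auto simp: carrier_relative_homology_group_0 singular_cycle)

text \<open>The kernel of the augmentation projects isomorphically onto the span of all labels but one:
the missing coefficient is minus the sum of the others.\<close>
lemma reduced_zeroth_homology_sheets:
  assumes inv: "\<And>g. pathin X g \<Longrightarrow> s (g 0) = s (g 1)"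
    and conn: "\<And>k. path_connectedin X {x \<in> topspace X. s x = k}"
    and t: "t \<in> s ` topspace X"
  shows "reduced_homology_group 0 X \<cong> free_Abelian_group (s ` topspace X - {t})"
proof -
  let ?R = "reduced_homology_group 0 X" and ?T = "s ` topspace X"
  obtain \<delta> where d: "\<delta> \<in> iso (homology_group 0 X) (free_Abelian_group ?T)"
    and dv: "\<And>c. singular_chain 0 X c \<Longrightarrow> \<delta> (homologous_rel_set 0 X {} c) = sheet_count s c"
    by (rule zeroth_homology_sheets[of X s]) (use inv conn in auto)
  define drop where "drop = frag_extend (\<lambda>k. if k = t then 0 else frag_of k)"
  define aug where "aug x = frag_extend (\<lambda>_. frag_of ()) x" for x :: "'b \<Rightarrow>\<^sub>0 int"
  interpret d: group_hom "homology_group 0 X" "free_Abelian_group ?T" \<delta>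
    using d by (simp add: group_hom_def group_hom_axioms_def iso_imp_homomorphism)
  have drop_hom: "drop \<in> hom (free_Abelian_group ?T) (free_Abelian_group (?T - {t}))"
  proof (rule homI)
    fix x assume "x \<in> carrier (free_Abelian_group ?T)"
    then show "drop x \<in> carrier (free_Abelian_group (?T - {t}))"
      using keys_frag_extend[of "\<lambda>k. if k = t then 0 else frag_of k" x]
      by (fastforce simp: drop_def split: if_splits)
  qed (simp add: drop_def frag_extend_add)
  have red: "z \<in> carrier ?R \<longleftrightarrow> z \<in> carrier (homology_group 0 X) \<and> aug (\<delta> z) = 0" for z
  proof (cases "z \<in> carrier (homology_group 0 X)")
    case True
    then obtain c where "singular_chain 0 X c" "z = homologous_rel_set 0 X {} c" by (rule zeroth_homology_class_exists)
    then show ?thesis using True reduced_zeroth_homology_class[of X c s] dv[of c] by (simp add: aug_def)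
  next
    case False
    then show ?thesis using carrier_reduced_homology_group_subset by blast
  qed
  have split: "x = drop x + frag_cmul (Poly_Mapping.lookup x t) (frag_of t)" for x
    unfolding drop_def using subset_UNIV
  proof (induction x rule: frag_induction)
    case (one k)
    then show ?case by (simp add: lookup_frag_of)
  next
    case (diff a b)
    let ?d = "\<lambda>x. frag_extend (\<lambda>k. if k = t then 0 else frag_of k) x"
      and ?k = "\<lambda>x. frag_cmul (Poly_Mapping.lookup x t) (frag_of t)"
    have "?d (a - b) + ?k (a - b) = (?d a + ?k a) - (?d b + ?k b)"
      by (simp add: frag_extend_diff lookup_minus frag_cmul_diff_distrib)
    also have "\<dots> = a - b" by (simp only: diff.IH[symmetric])
    finally show ?case by simp
  qed simp
  have aug_of: "\<exists>m. x = frag_cmul m (frag_of ())" for x :: "unit \<Rightarrow>\<^sub>0 int"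
    using subset_UNIV
  proof (induction x rule: frag_induction)
    case zero then show ?case by (metis frag_cmul_zero)
  next
    case (one x) have "x = ()" by simp then show ?case by (metis frag_cmul_one)
  next
    case (diff a b) then show ?case by (metis frag_cmul_diff_distrib)
  qed
  have hom: "drop \<circ> \<delta> \<in> hom ?R (free_Abelian_group (?T - {t}))"
    unfolding reduced_homology_group_def
    using hom_compose[OF d.homh drop_hom] by (intro group.hom_from_subgroup_generated) auto
  interpret h: group_hom ?R "free_Abelian_group (?T - {t})" "drop \<circ> \<delta>"
    using hom by (simp add: group_hom_def group_hom_axioms_def)
  have "drop \<circ> \<delta> \<in> iso ?R (free_Abelian_group (?T - {t}))"
    unfolding h.iso_iff
  proof (intro conjI ballI impI subsetI)
    fix y assume "y \<in> carrier (free_Abelian_group (?T - {t}))"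
    then have y: "Poly_Mapping.keys y \<subseteq> ?T - {t}" by simp
    obtain m where m: "aug y = frag_cmul m (frag_of ())" using aug_of by blast
    \<comment> \<open>the coefficient at the omitted label is chosen to make the augmentation vanish\<close>
    define x where "x = y - frag_cmul m (frag_of t)"
    have "Poly_Mapping.keys x \<subseteq> ?T"
      unfolding x_def using y t keys_diff[of y "frag_cmul m (frag_of t)"] keys_cmul[of m "frag_of t"] by auto
    then obtain z where z: "z \<in> carrier (homology_group 0 X)" "\<delta> z = x"
      using d d.iso_iff by (auto simp: subset_iff)
    have "aug x = 0" unfolding x_def using m by (simp add: aug_def frag_extend_diff frag_extend_cmul)
    then have zR: "z \<in> carrier ?R" using z red by simp
    have "frag_extend (\<lambda>k. if k = t then 0 else frag_of k) y = frag_extend frag_of y"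
      by (rule frag_extend_eq) (use y in auto)
    then have "drop x = y" unfolding x_def drop_def
      by (simp add: frag_extend_diff frag_extend_cmul flip: frag_expansion)
    then show "y \<in> (drop \<circ> \<delta>) ` carrier ?R" using z zR by (auto simp: image_iff)
  next
    fix z assume z: "z \<in> carrier ?R" and 0: "(drop \<circ> \<delta>) z = \<one>\<^bsub>free_Abelian_group (?T - {t})\<^esub>"
    define a where "a = Poly_Mapping.lookup (\<delta> z) t"
    have dz: "\<delta> z = frag_cmul a (frag_of t)" using split[of "\<delta> z"] 0 by (simp add: a_def)
    then have "frag_cmul a (frag_of ()) = 0" using z red[of z] by (simp add: aug_def frag_extend_cmul)
    then have "a = 0" by (metis frag_cmul_eq_0_iff frag_of_nonzero)
    then have "\<delta> z = 0" using dz by simp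
    then show "z = \<one>\<^bsub>?R\<^esub>" using z red[of z] d d.iso_iff by (auto simp: one_reduced_homology_group)
  qed
  then show ?thesis by (rule is_isoI)
qed

lemma lookup_frag_extend_inj:
  assumes "inj \<pi>"
  shows "Poly_Mapping.lookup (frag_extend (\<lambda>k. frag_of (\<pi> k)) x) (\<pi> k) = Poly_Mapping.lookup x k"
  using subset_UNIV
proof (induction x rule: frag_induction)
  case (one x) then show ?case using assms by (simp add: lookup_frag_of inj_eq)
qed (simp_all add: frag_extend_diff lookup_minus)

lemma lookup_augmentation:
  assumes "finite T" "Poly_Mapping.keys x \<subseteq> T"
  shows "Poly_Mapping.lookup (frag_extend (\<lambda>_. frag_of ()) x) () = (\<Sum>k\<in>T. Poly_Mapping.lookup x k)"
  using assms(2)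
proof (induction x rule: frag_induction)
  case (one x) then show ?case using assms(1) by (simp add: lookup_frag_of)
qed (simp_all add: frag_extend_diff lookup_minus sum_subtractf)

text \<open>A class fixed by a map that permutes the sheets transitively has equal coefficients on all
sheets; as they add up to zero, they all vanish. Transitivity is stated as the absence of a proper nonempty
set of labels that \<open>\<pi>\<close> maps into itself.\<close>
lemma reduced_zeroth_homology_transitive_fixed:
  assumes inv: "\<And>g. pathin X g \<Longrightarrow> s (g 0) = s (g 1)"
    and conn: "\<And>k. path_connectedin X {x \<in> topspace X. s x = k}"
    and fin: "finite (s ` topspace X)"
    and f: "continuous_map X X f" and "inj \<pi>" and \<pi>: "\<And>x. x \<in> topspace X \<Longrightarrow> s (f x) = \<pi> (s x)"
    and trans: "\<And>A. A \<subseteq> s ` topspace X \<Longrightarrow> A \<noteq> {} \<Longrightarrow> \<pi> ` A \<subseteq> A \<Longrightarrow> A = s ` topspace X"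
    and z: "z \<in> carrier (reduced_homology_group 0 X)" and fixed: "hom_induced 0 X {} X {} f z = z"
  shows "z = \<one>\<^bsub>homology_group 0 X\<^esub>"
proof -
  let ?T = "s ` topspace X"
  obtain \<delta> where d: "\<delta> \<in> iso (homology_group 0 X) (free_Abelian_group ?T)"
    and dv: "\<And>c. singular_chain 0 X c \<Longrightarrow> \<delta> (homologous_rel_set 0 X {} c) = sheet_count s c"
    by (rule zeroth_homology_sheets[of X s]) (use inv conn in auto)
  interpret d: group_hom "homology_group 0 X" "free_Abelian_group ?T" \<delta>
    using d by (simp add: group_hom_def group_hom_axioms_def iso_imp_homomorphism)
  have zc: "z \<in> carrier (homology_group 0 X)" using z carrier_reduced_homology_group_subset by blast
  then obtain c where c: "singular_chain 0 X c" and zcl: "z = homologous_rel_set 0 X {} c"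
    by (rule zeroth_homology_class_exists)
  define x where "x = \<delta> z"
  have x: "x = sheet_count s c" using dv[OF c] zcl by (simp add: x_def)
  have keys: "Poly_Mapping.keys x \<subseteq> ?T" using d.hom_closed[OF zc] by (simp add: x_def)
  have cm: "singular_chain 0 X (chain_map 0 f c)" using c f by (rule singular_chain_chain_map)
  have "hom_induced 0 X {} X {} f z = homologous_rel_set 0 X {} (chain_map 0 f c)"
    using hom_induced_chain_map_gen[of X X f "{}" "{}" 0 c] f c zcl
    by (simp add: singular_cycle chain_boundary_def)
  then have "x = sheet_count s (chain_map 0 f c)" using dv[OF cm] fixed by (simp add: x_def)
  also have "\<dots> = sheet_count (s \<circ> f) c" by (rule sheet_count_chain_map[OF c])
  also have "\<dots> = sheet_count (\<pi> \<circ> s) c"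
    unfolding sheet_count_def
  proof (rule frag_extend_eq)
    fix \<sigma> assume "\<sigma> \<in> Poly_Mapping.keys c"
    then have "\<sigma> (\<lambda>j. if j = 0 then 1 else 0) \<in> topspace X"
      using c by (auto simp: singular_chain_def singular_simplex_def continuous_map_def standard_simplex_0)
    then show "frag_of ((s \<circ> f) (\<sigma> (\<lambda>j. if j = 0 then 1 else 0))) = frag_of ((\<pi> \<circ> s) (\<sigma> (\<lambda>j. if j = 0 then 1 else 0)))"
      using \<pi> by simp
  qed
  also have "\<dots> = frag_extend (\<lambda>k. frag_of (\<pi> k)) x" by (simp add: x frag_extend_sheet_count)
  finally have "Poly_Mapping.lookup x (\<pi> k) = Poly_Mapping.lookup x k" for k
    by (metis lookup_frag_extend_inj[OF \<open>inj \<pi>\<close>])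
  note step = this
  have const: "Poly_Mapping.lookup x k = Poly_Mapping.lookup x j" if "k \<in> ?T" "j \<in> ?T" for k j
  proof -
    let ?A = "{i \<in> ?T. Poly_Mapping.lookup x i = Poly_Mapping.lookup x j}"
    have "\<pi> ` ?T \<subseteq> ?T" using \<pi> f by (force simp: continuous_map_def)
    then have "?A = ?T" by (intro trans) (use that step in auto)
    then show ?thesis using that by blast
  qed
  have "frag_extend (\<lambda>_. frag_of ()) x = 0"
    using reduced_zeroth_homology_class[OF c, of s] z zcl x by simp
  then have sum0: "(\<Sum>k\<in>?T. Poly_Mapping.lookup x k) = 0"
    using lookup_augmentation[OF fin keys] by simp
  have "Poly_Mapping.lookup x k = 0" for k
  proof (cases "k \<in> ?T")
    case True
    have "(\<Sum>j\<in>?T. Poly_Mapping.lookup x j) = (\<Sum>j\<in>?T. Poly_Mapping.lookup x k)"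
      by (intro sum.cong refl const) (use True in auto)
    then have "of_nat (card ?T) * Poly_Mapping.lookup x k = 0" using sum0 by simp
    moreover have "card ?T \<noteq> 0" using True fin by auto
    ultimately show ?thesis by simp
  next
    case False
    then show ?thesis using keys by (metis in_keys_iff subsetD)
  qed
  then have "x = 0" by (intro poly_mapping_eqI) simp
  then show ?thesis using d d.iso_iff zc by (auto simp: x_def)
qed

text \<open>The Mayer-Vietoris argument for two contractible open sets: \<open>H\<^sub>1 X\<close> agrees with \<open>H\<^sub>1 (X, U)\<close> as \<open>U\<close>
is contractible, with \<open>H\<^sub>1 (W, U \<inter> W)\<close> by excision, and with the reduced \<open>H\<^sub>0 (U \<inter> W)\<close> as \<open>W\<close> is
contractible. All three maps are natural, so a self-map of the cover without nonzero fixed classes in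
the last group has none in the first.\<close>
lemma homology_one_two_contractibles:
  assumes U: "openin X U" and W: "openin X W" and cover: "U \<union> W = topspace X"
    and cU: "contractible_space (subtopology X U)" and cW: "contractible_space (subtopology X W)"
    and ne: "U \<inter> W \<noteq> {}"
  shows "homology_group 1 X \<cong> reduced_homology_group 0 (subtopology X (U \<inter> W))"
    and "\<And>f c. \<lbrakk>continuous_map X X f; f \<in> U \<rightarrow> U; f \<in> W \<rightarrow> W;
      \<And>z. \<lbrakk>z \<in> carrier (reduced_homology_group 0 (subtopology X (U \<inter> W)));
        hom_induced 0 (subtopology X (U \<inter> W)) {} (subtopology X (U \<inter> W)) {} f z = z\<rbrakk>
        \<Longrightarrow> z = \<one>\<^bsub>homology_group 0 (subtopology X (U \<inter> W))\<^esub>;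
      c \<in> carrier (homology_group 1 X); hom_induced 1 X {} X {} f c = c\<rbrakk>
      \<Longrightarrow> c = \<one>\<^bsub>homology_group 1 X\<^esub>"
proof -
  let ?V = "U \<inter> W" and ?XW = "subtopology X W"
  let ?XV = "subtopology X ?V"
  have UX: "U \<subseteq> topspace X" and WX: "W \<subseteq> topspace X"
    using U W openin_subset by auto
  have subV: "subtopology ?XW ?V = ?XV" by (simp add: subtopology_subtopology inf.absorb2 Int_commute Int_left_commute)
  let ?j = "hom_induced 1 X {} X U id" and ?e = "hom_induced 1 ?XW ?V X U id" and ?b = "hom_boundary 1 ?XW ?V"
  have j: "?j \<in> iso (homology_group 1 X) (relative_homology_group 1 X U)"
  proof -
    have "topspace X \<inter> U \<noteq> {}" using ne UX by blast
    from iso_reduced_homology_by_contractible[OF cU this, of 1] show ?thesis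
      by (simp add: un_reduced_homology_group)
  qed
  have ex: "?e \<in> iso (relative_homology_group 1 ?XW ?V) (relative_homology_group 1 X U)"
  proof -
    have "closedin X (topspace X - W)" using W by blast
    then have "X closure_of (topspace X - W) \<subseteq> X interior_of U"
      using cover U by (auto simp: closure_of_closedin interior_of_openin)
    from homology_excision_axiom[OF this UX, of 1]
    have "hom_induced 1 (subtopology X (topspace X - (topspace X - W))) (U - (topspace X - W)) (subtopology X (topspace X)) U id
      \<in> iso (relative_homology_group 1 (subtopology X (topspace X - (topspace X - W))) (U - (topspace X - W)))
          (relative_homology_group 1 (subtopology X (topspace X)) U)" .
    moreover have "topspace X - (topspace X - W) = W" "U - (topspace X - W) = ?V" using UX WX by auto
    ultimately show ?thesis by simp
  qed
  have b: "?b \<in> iso (relative_homology_group 1 ?XW ?V) (reduced_homology_group 0 ?XV)"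
  proof -
    have "topspace ?XW \<inter> ?V \<noteq> {}" using ne WX by auto
    from iso_relative_homology_of_contractible[OF cW this, of 1] show ?thesis by (simp add: subV)
  qed
  show "homology_group 1 X \<cong> reduced_homology_group 0 ?XV"
    using j ex b by (meson group.iso_sym group_relative_homology_group is_isoI iso_trans)
  fix f c
  assume f: "continuous_map X X f" and fU: "f \<in> U \<rightarrow> U" and fW: "f \<in> W \<rightarrow> W"
    and triv: "\<And>z. \<lbrakk>z \<in> carrier (reduced_homology_group 0 ?XV); hom_induced 0 ?XV {} ?XV {} f z = z\<rbrakk>
        \<Longrightarrow> z = \<one>\<^bsub>homology_group 0 ?XV\<^esub>"
    and c: "c \<in> carrier (homology_group 1 X)" and fc: "hom_induced 1 X {} X {} f c = c"
  have fV: "f \<in> ?V \<rightarrow> ?V" using fU fW by auto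
  have fXW: "continuous_map ?XW ?XW f"
    using f fW WX by (auto simp: continuous_map_in_subtopology continuous_map_from_subtopology)
  obtain z where z: "z \<in> carrier (relative_homology_group 1 ?XW ?V)" and ez: "?e z = ?j c"
    using iso_preimage[OF ex, of "?j c"] hom_induced_carrier by blast
  let ?fz = "hom_induced 1 ?XW ?V ?XW ?V f z"
  have inclW: "continuous_map ?XW X id" by (simp add: continuous_map_from_subtopology)
  have "?e ?fz = hom_induced 1 ?XW ?V X U (id \<circ> f) z"
    by (rule hom_induced_compose'[OF fXW fV inclW]) auto
  also have "\<dots> = hom_induced 1 ?XW ?V X U (f \<circ> id) z" by simp
  also have "\<dots> = hom_induced 1 X U X U f (?e z)"
    by (rule hom_induced_compose'[symmetric, OF inclW _ f fU]) auto
  also have "\<dots> = hom_induced 1 X U X U f (?j c)" by (simp add: ez)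
  also have "\<dots> = hom_induced 1 X {} X U (f \<circ> id) c"
    by (rule hom_induced_compose'[OF _ _ f fU]) auto
  also have "\<dots> = hom_induced 1 X {} X U (id \<circ> f) c" by simp
  also have "\<dots> = ?j (hom_induced 1 X {} X {} f c)"
    by (rule hom_induced_compose'[symmetric, OF f]) auto
  also have "\<dots> = ?e z" by (simp add: fc ez)
  \<comment> \<open>excision is injective, so the class that corresponds to \<open>c\<close> is fixed as well\<close>
  finally have fz: "?fz = z"
    using ex z hom_induced_carrier[of 1 ?XW ?V ?XW ?V f z] by (auto simp: iso_def bij_betw_def inj_on_def)
  have "hom_induced 0 ?XV {} ?XV {} f (?b z) = ?b z"
    using fun_cong[OF naturality_hom_induced[OF fXW fV, of 1], of z] fz by (simp add: subV)
  moreover have bz: "?b z \<in> carrier (reduced_homology_group 0 ?XV)"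
    using b z by (auto simp: iso_def hom_def)
  ultimately have "?b z = \<one>\<^bsub>reduced_homology_group 0 ?XV\<^esub>"
    using triv by (simp add: one_reduced_homology_group)
  then have "z = \<one>\<^bsub>relative_homology_group 1 ?XW ?V\<^esub>"
    using iso_eq_oneD[OF b _ _ z] by simp
  then have "?j c = \<one>\<^bsub>relative_homology_group 1 X U\<^esub>"
    using ez hom_one[OF iso_imp_homomorphism[OF ex]] by simp
  then show "c = \<one>\<^bsub>homology_group 1 X\<^esub>"
    using iso_eq_oneD[OF j _ _ c] by simp
qed

text \<open>Here \<open>X\<close> arises from \<open>A\<close> by filling in a disc \<open>I\<close> along a connected collar \<open>I \<inter> A\<close>. The
inclusion is onto on \<open>H\<^sub>1\<close> since \<open>H\<^sub>1 (X, A)\<close> is \<open>H\<^sub>1 (I, I \<inter> A)\<close>, the reduced \<open>H\<^sub>0\<close> of the collar. Its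
kernel consists of images of classes of the collar. These are fixed by \<open>f\<close>, which is homotopic to the
identity on the collar, so they vanish in \<open>A\<close> if \<open>f\<close> has no nonzero fixed class there.\<close>
lemma homology_one_close_up:
  assumes A: "openin X A" and I: "openin X I" and cover: "A \<union> I = topspace X"
    and cI: "contractible_space (subtopology X I)"
    and pc: "path_connectedin X (I \<inter> A)" and ne: "I \<inter> A \<noteq> {}"
    and f: "continuous_map X X f" and fA: "f \<in> A \<rightarrow> A" and fI: "f \<in> I \<rightarrow> I"
    and hom: "homotopic_with (\<lambda>_. True) (subtopology X (I \<inter> A)) (subtopology X (I \<inter> A)) f id"
    and triv: "\<And>c. \<lbrakk>c \<in> carrier (homology_group 1 (subtopology X A)); 
       hom_induced 1 (subtopology X A) {} (subtopology X A) {} f c = c\<rbrakk> \<Longrightarrow> c = \<one>\<^bsub>homology_group 1 (subtopology X A)\<^esub>"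
  shows "homology_group 1 X \<cong> homology_group 1 (subtopology X A)"
proof -
  let ?V = "I \<inter> A" and ?XI = "subtopology X I" and ?XA = "subtopology X A"
  let ?XV = "subtopology X ?V"
  let ?i = "hom_induced 1 ?XA {} X {} id"
  have AX: "A \<subseteq> topspace X" and IX: "I \<subseteq> topspace X" using A I openin_subset by auto
  have subV: "subtopology ?XI ?V = ?XV" by (simp add: subtopology_subtopology inf.absorb2 Int_commute Int_left_commute)
  have ex: "hom_induced p ?XI ?V X A id \<in> iso (relative_homology_group p ?XI ?V) (relative_homology_group p X A)" for p
  proof -
    have "closedin X (topspace X - I)" using I by blast
    then have "X closure_of (topspace X - I) \<subseteq> X interior_of A"
      using cover A by (auto simp: closure_of_closedin interior_of_openin)
    from homology_excision_axiom[OF this AX, of p]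
    have "hom_induced p (subtopology X (topspace X - (topspace X - I))) (A - (topspace X - I)) (subtopology X (topspace X)) A id
      \<in> iso (relative_homology_group p (subtopology X (topspace X - (topspace X - I))) (A - (topspace X - I)))
          (relative_homology_group p (subtopology X (topspace X)) A)" .
    moreover have "topspace X - (topspace X - I) = I" "A - (topspace X - I) = ?V" using AX IX by auto
    ultimately show ?thesis by simp
  qed
  have "reduced_homology_group 0 ?XV \<cong> free_Abelian_group ((\<lambda>_. ()) ` topspace ?XV - {()})"
  proof (rule reduced_zeroth_homology_sheets)
    have "{x \<in> topspace ?XV. () = k} = topspace ?XV" for k by auto
    then show "path_connectedin ?XV {x \<in> topspace ?XV. () = k}" for k
      using pc path_connectedin_topspace[of ?XV] by (simp only: path_connectedin_def[of X])
  qed (use ne IX in auto)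
  then have E: "reduced_homology_group 0 ?XV \<cong> free_Abelian_group ({} :: unit set)"
    by (simp add: Diff_eq_empty_iff[THEN iffD2, OF subsetI])
  have "trivial_group (free_Abelian_group ({} :: unit set))"
    using group_free_Abelian_group[of "{} :: unit set"] unfolding trivial_group_def
    by (auto simp: free_Abelian_group_def)
  then have triv0: "trivial_group (reduced_homology_group 0 ?XV)"
    using isomorphic_group_triviality[OF E] by simp
  have "relative_homology_group 1 ?XI ?V \<cong> reduced_homology_group 0 ?XV"
  proof -
    have "topspace ?XI \<inter> ?V \<noteq> {}" using ne IX by auto
    from isomorphic_group_relative_homology_of_contractible[OF cI this, of 1] show ?thesis by (simp add: subV)
  qed
  from isomorphic_group_triviality[OF this] triv0
  have "trivial_group (relative_homology_group 1 ?XI ?V)" by simp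
  then have "trivial_group (relative_homology_group 1 X A)"
    using isomorphic_group_triviality[OF is_isoI[OF ex[of 1]]] by simp
  then have surj: "?i ` carrier (homology_group 1 ?XA) = carrier (homology_group 1 X)"
  proof -
    have "?i ` carrier (homology_group 1 ?XA) = kernel (homology_group 1 X) (relative_homology_group 1 X A) (hom_induced 1 X {} X A id)"
      using homology_exactness_axiom_3[of 1 X A] by simp
    moreover have "hom_induced 1 X {} X A id c = \<one>\<^bsub>relative_homology_group 1 X A\<^esub>" for c
      using hom_induced_carrier[of 1 X "{}" X A id c] \<open>trivial_group (relative_homology_group 1 X A)\<close>
      by (simp add: trivial_group_def)
    ultimately show ?thesis by (simp add: kernel_def)
  qed
  interpret i: group_hom "homology_group 1 ?XA" "homology_group 1 X" ?i
    by (simp add: group_hom_def group_hom_axioms_def hom_induced_empty_hom)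
  have inclV: "continuous_map ?XV ?XA id"
    by (auto simp: continuous_map_in_subtopology continuous_map_from_subtopology)
  have fXV: "continuous_map ?XV ?XV f"
    using homotopic_with_imp_continuous_maps[OF hom] by simp
  have fXA: "continuous_map ?XA ?XA f"
    using f fA AX by (auto simp: continuous_map_in_subtopology continuous_map_from_subtopology)
  have "?i c = \<one>\<^bsub>homology_group 1 X\<^esub> \<longrightarrow> c = \<one>\<^bsub>homology_group 1 ?XA\<^esub>" if c: "c \<in> carrier (homology_group 1 ?XA)" for c
  proof
    assume "?i c = \<one>\<^bsub>homology_group 1 X\<^esub>"
    then have "c \<in> kernel (homology_group 1 ?XA) (homology_group 1 X) ?i" using c by (simp add: kernel_def)
    moreover have "hom_boundary 2 X A ` carrier (relative_homology_group 2 X A)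
        = kernel (homology_group 1 ?XA) (homology_group 1 X) ?i"
      using homology_exactness_axiom_2[of 2 X A] by simp
    ultimately obtain e where e: "e \<in> carrier (relative_homology_group 2 X A)" "c = hom_boundary 2 X A e"
      by (metis imageE)
    obtain z where z: "z \<in> carrier (relative_homology_group 2 ?XI ?V)" "e = hom_induced 2 ?XI ?V X A id z"
      using iso_preimage[OF ex[of 2] e(1)] by auto
    have inclI: "continuous_map ?XI X id" by (simp add: continuous_map_from_subtopology)
    have cz: "c = hom_induced 1 ?XV {} ?XA {} id (hom_boundary 2 ?XI ?V z)"
      using e z fun_cong[OF naturality_hom_induced[OF inclI, of ?V A 2], of z] by (auto simp: subV)
    define w where "w = hom_boundary 2 ?XI ?V z"
    have w: "w \<in> carrier (homology_group 1 ?XV)"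
      unfolding w_def using hom_boundary_carrier[of 2 ?XI ?V z] by (simp add: subV)
    have "hom_induced 1 ?XV {} ?XV {} f w = hom_induced 1 ?XV {} ?XV {} id w"
      using homology_homotopy_empty[OF hom] by simp
    then have fw: "hom_induced 1 ?XV {} ?XV {} f w = w" using w by (simp add: hom_induced_id)
    have "hom_induced 1 ?XA {} ?XA {} f c = hom_induced 1 ?XV {} ?XA {} (f \<circ> id) w"
      unfolding cz w_def[symmetric] by (rule hom_induced_compose'[OF inclV _ fXA]) auto
    also have "\<dots> = hom_induced 1 ?XV {} ?XA {} (id \<circ> f) w" by simp
    also have "\<dots> = hom_induced 1 ?XV {} ?XA {} id (hom_induced 1 ?XV {} ?XV {} f w)"
      by (rule hom_induced_compose'[symmetric, OF fXV _ inclV]) auto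
    also have "\<dots> = c" unfolding fw by (simp add: cz w_def)
    finally show "c = \<one>\<^bsub>homology_group 1 ?XA\<^esub>" using triv c by blast
  qed
  then have "?i \<in> iso (homology_group 1 ?XA) (homology_group 1 X)"
    using surj by (simp add: i.iso_iff)
  from is_isoI[OF this] show ?thesis
    by (rule group.iso_sym[OF group_relative_homology_group])
qed

section \<open>Charts and paths on a Riemann surface\<close>

locale riemann =
  fixes S :: "'a surface"
  assumes rs: "riemann_surface S"
begin

lemma chart_onD: "c \<in> charts S \<Longrightarrow> chart_on (surf_top S) c"
  using rs by (simp add: riemann_surface_def)

lemma chart_open: "c \<in> charts S \<Longrightarrow> openin (surf_top S) (fst c)"
  using chart_onD by (simp add: chart_on_def)

lemma chart_sub: "c \<in> charts S \<Longrightarrow> fst c \<subseteq> points S"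
  using chart_open openin_subset by blast

lemma coord_open: "c \<in> charts S \<Longrightarrow> open (snd c ` fst c)"
  using chart_onD by (simp add: chart_on_def)

lemma coord_homeo:
  "c \<in> charts S \<Longrightarrow> homeomorphic_map (subtopology (surf_top S) (fst c)) (top_of_set (snd c ` fst c)) (snd c)"
  using chart_onD by (simp add: chart_on_def)

lemma coord_inj: "c \<in> charts S \<Longrightarrow> inj_on (snd c) (fst c)"
  using homeomorphic_imp_injective_map[OF coord_homeo] chart_sub by (simp add: Int_absorb1)

lemma inv_coord [simp]: "c \<in> charts S \<Longrightarrow> q \<in> fst c \<Longrightarrow> chart_inv c (snd c q) = q"
  using coord_inj by (simp add: chart_inv_def)

lemma coord_inv [simp]: "z \<in> snd c ` fst c \<Longrightarrow> snd c (chart_inv c z) = z"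
  by (simp add: chart_inv_def f_inv_into_f)

lemma inv_in [simp]: "z \<in> snd c ` fst c \<Longrightarrow> chart_inv c z \<in> fst c"
  by (simp add: chart_inv_def inv_into_into)

lemma cont_coord:
  "c \<in> charts S \<Longrightarrow> continuous_map (subtopology (surf_top S) (fst c)) euclidean (snd c)"
  using homeomorphic_imp_continuous_map[OF coord_homeo] by (simp add: continuous_map_in_subtopology)

lemma cont_inv:
  assumes c: "c \<in> charts S"
  shows "continuous_map (top_of_set (snd c ` fst c)) (surf_top S) (chart_inv c)"
proof -
  obtain g where g: "homeomorphic_maps (subtopology (surf_top S) (fst c)) (top_of_set (snd c ` fst c)) (snd c) g"
    using coord_homeo[OF c] by (auto simp: homeomorphic_map_maps)
  have "continuous_map (top_of_set (snd c ` fst c)) (surf_top S) g"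
    using g by (auto simp: homeomorphic_maps_def continuous_map_in_subtopology)
  moreover have "g z = chart_inv c z" if "z \<in> snd c ` fst c" for z
    using g that chart_sub[OF c] inv_coord[OF c] coord_inv[OF that]
    by (auto simp: homeomorphic_maps_def subset_iff)
  ultimately show ?thesis by (rule continuous_map_eq) simp
qed

lemma coord_image_open:
  assumes c: "c \<in> charts S" and U: "openin (surf_top S) U" "U \<subseteq> fst c"
  shows "open (snd c ` U)"
proof -
  have "openin (subtopology (surf_top S) (fst c)) U"
    using U chart_open[OF c] by (simp add: openin_open_subtopology)
  then have "openin (top_of_set (snd c ` fst c)) (snd c ` U)"
    using homeomorphic_imp_open_map[OF coord_homeo[OF c]] by (simp add: open_map_def)
  then show ?thesis using coord_open[OF c] openin_open_trans by blast
qed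

lemma inv_image_open:
  assumes c: "c \<in> charts S" and A: "open A" "A \<subseteq> snd c ` fst c"
  shows "openin (surf_top S) (chart_inv c ` A)"
proof -
  have eq: "chart_inv c ` A = {q \<in> topspace (subtopology (surf_top S) (fst c)). snd c q \<in> A}"
  proof (intro equalityI subsetI)
    fix q assume "q \<in> chart_inv c ` A"
    then show "q \<in> {q \<in> topspace (subtopology (surf_top S) (fst c)). snd c q \<in> A}"
      using A chart_sub[OF c] by (auto simp: subset_iff)
  next
    fix q assume "q \<in> {q \<in> topspace (subtopology (surf_top S) (fst c)). snd c q \<in> A}"
    then have "q \<in> fst c" "snd c q \<in> A" by auto
    then show "q \<in> chart_inv c ` A" using inv_coord[OF c] by (metis imageI)
  qed
  have "openin (subtopology (surf_top S) (fst c)) (chart_inv c ` A)"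
    unfolding eq using cont_coord[OF c] A(1) by (auto simp: continuous_map_def)
  then show ?thesis using chart_open[OF c] openin_trans_full by blast
qed

lemma chart_at:
  assumes "q \<in> points S"
  shows "chart_at S q \<in> charts S" "q \<in> fst (chart_at S q)"
proof -
  have "q \<in> (\<Union>c\<in>charts S. fst c)" using assms rs by (simp add: riemann_surface_def)
  then have "\<exists>c. c \<in> charts S \<and> q \<in> fst c" by blast
  then have "chart_at S q \<in> charts S \<and> q \<in> fst (chart_at S q)"
    unfolding chart_at_def by (rule someI_ex)
  then show "chart_at S q \<in> charts S" "q \<in> fst (chart_at S q)" by auto
qed

lemma overlap_open:
  "c \<in> charts S \<Longrightarrow> d \<in> charts S \<Longrightarrow> open (snd c ` (fst c \<inter> fst d))"
  using chart_open[of c] chart_open[of d] by (intro coord_image_open openin_Int) auto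

lemma transition_holo:
  "c \<in> charts S \<Longrightarrow> d \<in> charts S \<Longrightarrow> transition c d holomorphic_on snd c ` (fst c \<inter> fst d)"
  using rs by (simp add: riemann_surface_def)

lemma transition_coord:
  "c \<in> charts S \<Longrightarrow> q \<in> fst c \<Longrightarrow> transition c d (snd c q) = snd d q"
  by (simp add: transition_def)

lemma transition_deriv:
  assumes "c \<in> charts S" "d \<in> charts S" "q \<in> fst c" "q \<in> fst d"
  shows "((snd d \<circ> chart_inv c) has_field_derivative deriv (transition c d) (snd c q)) (at (snd c q))"
  using holomorphic_derivI[OF transition_holo[OF assms(1,2)] overlap_open[OF assms(1,2)], of "snd c q"] assms
  by (simp add: transition_def)

text \<open>The two transition maps are mutually inverse, so by the chain rule their derivatives multiply to
\<open>1\<close>.\<close>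
lemma transition_deriv_nz:
  assumes "c \<in> charts S" "d \<in> charts S" "q \<in> fst c" "q \<in> fst d"
  shows "deriv (transition c d) (snd c q) \<noteq> 0"
proof -
  let ?z = "snd c q"
  have "((snd d \<circ> chart_inv c) has_field_derivative deriv (transition c d) ?z) (at ?z)"
    by (rule transition_deriv[OF assms])
  moreover have "((snd c \<circ> chart_inv d) has_field_derivative deriv (transition d c) (snd d q)) (at ((snd d \<circ> chart_inv c) ?z))"
    using transition_deriv[OF assms(2,1,4,3)] assms by simp
  ultimately have "((snd c \<circ> chart_inv d) \<circ> (snd d \<circ> chart_inv c) has_field_derivative
      deriv (transition d c) (snd d q) * deriv (transition c d) ?z) (at ?z)"
    using DERIV_chain by blast
  moreover have "((\<lambda>z. z) has_field_derivative 1) (at ?z)" by simp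
  then have "((snd c \<circ> chart_inv d) \<circ> (snd d \<circ> chart_inv c) has_field_derivative 1) (at ?z)"
    by (rule has_field_derivative_transform_within_open[OF _ overlap_open[OF assms(1,2)]])
       (use assms in auto)
  ultimately have "deriv (transition d c) (snd d q) * deriv (transition c d) ?z = 1"
    by (rule DERIV_unique)
  then show ?thesis by auto
qed

lemma path_points:
  "pw_C1_path S a b \<gamma> \<Longrightarrow> t \<in> {a..b} \<Longrightarrow> \<gamma> t \<in> points S"
  by (auto simp: pw_C1_path_def continuous_map_def)

text \<open>The finite exceptional set is made to contain the ends of the interval: then the times outside it that lie in
a chart form an open set, on which one-sided and two-sided derivatives coincide.\<close>
definition regular_times :: "real \<Rightarrow> real \<Rightarrow> (real \<Rightarrow> 'a) \<Rightarrow> real set \<Rightarrow> bool" where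
  "regular_times a b \<gamma> K \<longleftrightarrow> finite K \<and> a \<in> K \<and> b \<in> K \<and> continuous_map (top_of_set {a..b}) (surf_top S) \<gamma> \<and>
     (\<forall>c\<in>charts S. (snd c \<circ> \<gamma>) C1_differentiable_on ({t\<in>{a..b}. \<gamma> t \<in> fst c} - K))"

lemma regular_timesE:
  assumes "pw_C1_path S a b \<gamma>"
  obtains K where "regular_times a b \<gamma> K"
proof -
  obtain K where K: "finite K" "\<forall>c\<in>charts S. (snd c \<circ> \<gamma>) C1_differentiable_on ({t\<in>{a..b}. \<gamma> t \<in> fst c} - K)"
    using assms by (auto simp: pw_C1_path_def)
  then have "regular_times a b \<gamma> (insert a (insert b K))"
    using assms by (auto simp: regular_times_def pw_C1_path_def elim!: C1_differentiable_on_subset)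
  then show ?thesis using that by blast
qed

lemma regular_times_pw: "regular_times a b \<gamma> K \<Longrightarrow> pw_C1_path S a b \<gamma>"
  by (auto simp: pw_C1_path_def regular_times_def)

context
  fixes a b \<gamma> K
  assumes reg: "regular_times a b \<gamma> K"
begin

lemma regular_open:
  assumes "c \<in> charts S"
  shows "open ({t\<in>{a..b}. \<gamma> t \<in> fst c} - K)"
proof -
  have "openin (top_of_set {a..b}) {t \<in> topspace (top_of_set {a..b}). \<gamma> t \<in> fst c}"
    using reg chart_open[OF assms] unfolding regular_times_def by (intro openin_continuous_map_preimage) auto
  then obtain T where T: "open T" "{t \<in> {a..b}. \<gamma> t \<in> fst c} = {a..b} \<inter> T"
    by (auto simp: openin_open)
  have "{t\<in>{a..b}. \<gamma> t \<in> fst c} - K = ({a<..<b} \<inter> T) - K"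
    using T reg by (auto simp: regular_times_def less_le)
  moreover have "closed K" using reg by (simp add: regular_times_def finite_imp_closed)
  ultimately show ?thesis using T by (simp add: open_Diff open_Int)
qed

lemma regular_vector_derivative:
  assumes "c \<in> charts S" "t \<in> {a..b} - K" "\<gamma> t \<in> fst c"
  shows "((snd c \<circ> \<gamma>) has_vector_derivative vector_derivative (snd c \<circ> \<gamma>) (at t)) (at t)"
  using reg assms unfolding regular_times_def C1_differentiable_on_eq
  by (auto simp: vector_derivative_works)

lemma regular_chain:
  assumes c: "c \<in> charts S" "t \<in> {a..b} - K" "\<gamma> t \<in> fst c"
    and F: "((F \<circ> chart_inv c) has_derivative L) (at (snd c (\<gamma> t)))"
  shows "((F \<circ> \<gamma>) has_vector_derivative L (vector_derivative (snd c \<circ> \<gamma>) (at t))) (at t)"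
proof -
  have "((F \<circ> chart_inv c) \<circ> (snd c \<circ> \<gamma>) has_vector_derivative L (vector_derivative (snd c \<circ> \<gamma>) (at t))) (at t)"
    by (rule vector_derivative_diff_chain_within[OF regular_vector_derivative[OF c]])
       (use has_derivative_at_withinI[OF F] in \<open>simp add: o_def\<close>)
  then show ?thesis
    by (rule has_vector_derivative_transform_within_open[OF _ regular_open[OF c(1)]]) (use c in auto)
qed

lemma regular_change_chart:
  assumes "c \<in> charts S" "d \<in> charts S" "t \<in> {a..b} - K" "\<gamma> t \<in> fst c" "\<gamma> t \<in> fst d"
  shows "vector_derivative (snd d \<circ> \<gamma>) (at t)
    = deriv (transition c d) (snd c (\<gamma> t)) * vector_derivative (snd c \<circ> \<gamma>) (at t)"
  using regular_chain[OF assms(1,3,4) transition_deriv[OF assms(1,2,4,5), unfolded has_field_derivative_def]]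
  by (rule vector_derivative_at)

end

text \<open>Integrate the derivative of \<open>F\<close> along the path. The tensor \<open>h\<close> may be degenerate, as the induced
metric of a maximal map is.\<close>
lemma Lipschitz_along_path:
  fixes F :: "'a \<Rightarrow> real"
  assumes path: "pw_C1_path S a b \<gamma>" and ab: "a \<le> b"
    and F: "continuous_map (surf_top S) euclidean F"
    and dF: "\<And>q. q \<in> points S \<Longrightarrow> \<exists>L. ((F \<circ> chart_inv (chart_at S q)) has_derivative L) (at (snd (chart_at S q) q))
       \<and> (\<forall>u. \<bar>L u\<bar> \<le> sqrt (h (chart_at S q) (snd (chart_at S q) q) u u))"
  shows "ennreal \<bar>F (\<gamma> b) - F (\<gamma> a)\<bar> \<le> path_length S h {a..b} \<gamma>"
proof -
  obtain K where K: "regular_times a b \<gamma> K" using regular_timesE[OF path] .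
  have finK: "finite K" using K by (simp add: regular_times_def)
  define v where "v t = vector_derivative (snd (chart_at S (\<gamma> t)) \<circ> \<gamma>) (at t)" for t
  have "\<exists>L. \<forall>q\<in>points S. ((F \<circ> chart_inv (chart_at S q)) has_derivative L q) (at (snd (chart_at S q) q))
       \<and> (\<forall>u. \<bar>L q u\<bar> \<le> sqrt (h (chart_at S q) (snd (chart_at S q) q) u u))"
    using dF by (intro bchoice) blast
  then obtain L where L: "\<And>q. q \<in> points S \<Longrightarrow> ((F \<circ> chart_inv (chart_at S q)) has_derivative L q) (at (snd (chart_at S q) q))"
     "\<And>q u. q \<in> points S \<Longrightarrow> \<bar>L q u\<bar> \<le> sqrt (h (chart_at S q) (snd (chart_at S q) q) u u)"
    by blast
  define D where "D t = L (\<gamma> t) (v t)" for t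
  have deriv: "((F \<circ> \<gamma>) has_vector_derivative D t) (at t)" if "t \<in> {a..b} - K" for t
  proof -
    have q: "\<gamma> t \<in> points S" using path_points[OF path] that by simp
    show ?thesis unfolding D_def v_def
      by (rule regular_chain[OF K chart_at(1)[OF q] that chart_at(2)[OF q] L(1)[OF q]])
  qed
  have "continuous_map (top_of_set {a..b}) euclidean (F \<circ> \<gamma>)"
    using path F continuous_map_compose unfolding pw_C1_path_def by blast
  then have cont: "continuous_on {a..b} (F \<circ> \<gamma>)" by simp
  have int: "(D has_integral (F (\<gamma> b) - F (\<gamma> a))) {a..b}"
    using fundamental_theorem_of_calculus_interior_strong[OF finK ab _ cont, of D] deriv by auto
  have "ennreal \<bar>F (\<gamma> b) - F (\<gamma> a)\<bar> \<le> (\<integral>\<^sup>+t\<in>{a..b}. ennreal \<bar>D t\<bar> \<partial>lborel)"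
  \<comment> \<open>the fundamental theorem gives a gauge integral; it is a Lebesgue integral as soon as \<open>|D|\<close> has finite integral, and otherwise the bound is trivial\<close>
  proof (cases "(\<integral>\<^sup>+t\<in>{a..b}. ennreal \<bar>D t\<bar> \<partial>lborel) < \<infinity>")
    case True
    have meas: "D \<in> borel_measurable (lebesgue_on {a..b})"
      using int by (intro integrable_imp_measurable) blast
    have eq: "(\<integral>\<^sup>+t\<in>{a..b}. ennreal \<bar>D t\<bar> \<partial>lborel) = (\<integral>\<^sup>+t. ennreal \<bar>D t\<bar> \<partial>lebesgue_on {a..b})"
      by (simp add: nn_integral_restrict_space nn_integral_completion)
    have i: "integrable (lebesgue_on {a..b}) D"
      using meas True eq by (intro integrableI_bounded) auto
    have "integral {a..b} D = (\<integral>t. D t \<partial>lebesgue_on {a..b})"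
      using i by (intro lebesgue_integral_eq_integral[symmetric]) auto
    then have "F (\<gamma> b) - F (\<gamma> a) = (\<integral>t. D t \<partial>lebesgue_on {a..b})" using int by (simp add: integral_unique)
    then have "ennreal \<bar>F (\<gamma> b) - F (\<gamma> a)\<bar> \<le> (\<integral>\<^sup>+t. ennreal \<bar>D t\<bar> \<partial>lebesgue_on {a..b})"
      using integral_norm_bound_ennreal[OF i] by simp
    then show ?thesis by (simp add: eq)
  next
    case False
    then have "(\<integral>\<^sup>+t\<in>{a..b}. ennreal \<bar>D t\<bar> \<partial>lborel) = \<infinity>"
      unfolding infinity_ennreal_def by (meson top.not_eq_extremum)
    then show ?thesis by simp
  qed
  also have "\<dots> \<le> path_length S h {a..b} \<gamma>"
    unfolding path_length_def
  proof (rule nn_integral_mono)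
    fix t
    show "ennreal \<bar>D t\<bar> * indicator {a..b} t \<le> (let c = chart_at S (\<gamma> t); v = vector_derivative (snd c \<circ> \<gamma>) (at t)
       in ennreal (sqrt (h c (snd c (\<gamma> t)) v v))) * indicator {a..b} t"
      using L(2) path_points[OF path, of t]
      by (auto simp: D_def v_def Let_def indicator_def ennreal_leI)
  qed
  finally show ?thesis .
qed

lemma form_integral_primitive:
  fixes F :: "'a \<Rightarrow> complex"
  assumes path: "pw_C1_path S 0 1 \<gamma>"
    and F: "continuous_map (surf_top S) euclidean F"
    and dF: "\<And>c q. c \<in> charts S \<Longrightarrow> q \<in> fst c \<Longrightarrow> ((F \<circ> chart_inv c) has_field_derivative \<omega> c (snd c q)) (at (snd c q))"
  shows "form_integral S \<omega> \<gamma> = F (\<gamma> 1) - F (\<gamma> 0)"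
proof -
  obtain K where K: "regular_times 0 1 \<gamma> K" using regular_timesE[OF path] .
  have "continuous_map (top_of_set {0..1}) euclidean (F \<circ> \<gamma>)"
    using path F continuous_map_compose unfolding pw_C1_path_def by blast
  then have cont: "continuous_on {0..1} (F \<circ> \<gamma>)" by simp
  let ?D = "\<lambda>t. let c = chart_at S (\<gamma> t) in \<omega> c (snd c (\<gamma> t)) * vector_derivative (snd c \<circ> \<gamma>) (at t)"
  have "(?D has_integral ((F \<circ> \<gamma>) 1 - (F \<circ> \<gamma>) 0)) {0..1}"
  proof (rule fundamental_theorem_of_calculus_interior_strong[OF _ _ _ cont])
    show "finite K" using K by (simp add: regular_times_def)
    fix t assume t: "t \<in> {0<..<1} - K"
    then have q: "\<gamma> t \<in> points S" using path_points[OF path] by simp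
    show "((F \<circ> \<gamma>) has_vector_derivative ?D t) (at t)"
      using regular_chain[OF K chart_at(1)[OF q] _ chart_at(2)[OF q]
          dF[OF chart_at[OF q], unfolded has_field_derivative_def]] t
      by (simp add: Let_def)
  qed simp
  then show ?thesis by (simp add: form_integral_def integral_unique)
qed

text \<open>A continuous logarithm of \<open>f\<close> exists along the path, and it is a primitive of the form there.\<close>
lemma form_integral_log_derivative:
  fixes f :: "'a \<Rightarrow> complex"
  assumes path: "pw_C1_path S 0 1 \<gamma>"
    and f: "continuous_map (surf_top S) euclidean f" and nz: "\<And>q. q \<in> points S \<Longrightarrow> f q \<noteq> 0"
    and df: "\<And>c q. c \<in> charts S \<Longrightarrow> q \<in> fst c \<Longrightarrow>
       ((f \<circ> chart_inv c) has_field_derivative f q * \<omega> c (snd c q)) (at (snd c q))"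
  shows "Re (form_integral S \<omega> \<gamma>) = ln (norm (f (\<gamma> 1))) - ln (norm (f (\<gamma> 0)))"
proof -
  obtain K where K: "regular_times 0 1 \<gamma> K" using regular_timesE[OF path] .
  have "continuous_map (top_of_set {0..1}) euclidean (f \<circ> \<gamma>)"
    using path f continuous_map_compose unfolding pw_C1_path_def by blast
  then have cont: "continuous_on {0..1} (f \<circ> \<gamma>)" by simp
  have nz': "(f \<circ> \<gamma>) t \<noteq> 0" if "t \<in> {0..1}" for t using nz path_points[OF path that] by simp
  obtain g where g: "continuous_on {0..1} g" "\<And>t. t \<in> {0..1} \<Longrightarrow> (f \<circ> \<gamma>) t = exp (g t)"
    by (rule continuous_logarithm_on_contractible[OF cont]) (use nz' in \<open>auto simp: convex_imp_contractible\<close>)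
  let ?D = "\<lambda>t. let c = chart_at S (\<gamma> t) in \<omega> c (snd c (\<gamma> t)) * vector_derivative (snd c \<circ> \<gamma>) (at t)"
  have "(?D has_integral (g 1 - g 0)) {0..1}"
  proof (rule fundamental_theorem_of_calculus_interior_strong[OF _ _ _ g(1)])
    show "finite K" using K by (simp add: regular_times_def)
    fix t assume t: "t \<in> {0<..<1} - K"
    then have q: "\<gamma> t \<in> points S" using path_points[OF path] by simp
    have d: "((f \<circ> \<gamma>) has_vector_derivative exp (g t) * ?D t) (at t)"
      using regular_chain[OF K chart_at(1)[OF q] _ chart_at(2)[OF q]
          df[OF chart_at[OF q], unfolded has_field_derivative_def]] t g(2)[of t]
      by (simp add: Let_def mult.assoc)
    \<comment> \<open>near \<open>t\<close> the continuous branch \<open>g\<close> is the principal branch, recentred at \<open>g t\<close>, hence differentiable\<close>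
    define A where "A = {0<..<1} \<inter> g -` ball (g t) 1"
    have "continuous_on {0<..<1} g" using g(1) by (rule continuous_on_subset) auto
    then have A: "open A" "t \<in> A" using t unfolding A_def by (auto intro: continuous_open_preimage)
    have "((\<lambda>s. g t + Ln ((f \<circ> \<gamma>) s / exp (g t))) has_vector_derivative ?D t) (at t)"
    proof -
      have "((\<lambda>w. g t + Ln (w / exp (g t))) has_field_derivative inverse (exp (g t))) (at ((f \<circ> \<gamma>) t))"
      proof -
        have eq: "(f \<circ> \<gamma>) t = exp (g t)" using g(2)[of t] t by simp
        show ?thesis unfolding eq by (auto intro!: derivative_eq_intros simp: inverse_eq_divide)
      qed
      from field_vector_diff_chain_at[OF d this]
      have "((\<lambda>s. g t + Ln ((f \<circ> \<gamma>) s / exp (g t))) has_vector_derivative exp (g t) * ?D t * inverse (exp (g t))) (at t)"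
        by (simp only: o_def)
      moreover have "exp (g t) * ?D t * inverse (exp (g t)) = ?D t" by simp
      ultimately show ?thesis by (simp only:)
    qed
    then show "(g has_vector_derivative ?D t) (at t)"
    proof (rule has_vector_derivative_transform_within_open)
      show "open A" "t \<in> A" by (fact A)+
      fix s assume s: "s \<in> A"
      then have "norm (g s - g t) < 1" by (simp add: A_def dist_norm norm_minus_commute)
      then have "\<bar>Im (g s - g t)\<bar> < 1" using abs_Im_le_cmod[of "g s - g t"] by linarith
      then have "Ln (exp (g s - g t)) = g s - g t" using pi_gt3 by (intro Ln_exp) auto
      then show "g t + Ln ((f \<circ> \<gamma>) s / exp (g t)) = g s" using g(2)[of s] s by (simp add: A_def exp_diff)
    qed
  qed simp
  then have "form_integral S \<omega> \<gamma> = g 1 - g 0" by (simp add: form_integral_def integral_unique)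
  moreover have "norm (f (\<gamma> 0)) = exp (Re (g 0))" "norm (f (\<gamma> 1)) = exp (Re (g 1))"
    using g(2)[of 0] g(2)[of 1] by auto
  ultimately show ?thesis by simp
qed

end

section \<open>Lengths in a Riemannian metric\<close>

locale riemann_metric = riemann S for S :: "'a surface" +
  fixes h :: "'a tensor2"
  assumes hm: "riemannian_metric S h"
begin

context
  fixes c assumes c: "c \<in> charts S"
begin

lemma h_bilinear: "z \<in> snd c ` fst c \<Longrightarrow> bilinear (h c z)"
  using hm[unfolded riemannian_metric_def sym_tensor_def, THEN conjunct1, THEN conjunct1, rule_format, OF c]
  by simp

lemma h_pos: "z \<in> snd c ` fst c \<Longrightarrow> u \<noteq> 0 \<Longrightarrow> h c z u u > 0"
  using hm[unfolded riemannian_metric_def, THEN conjunct2, rule_format, OF c] by simp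

lemma h_scale: "z \<in> snd c ` fst c \<Longrightarrow> h c z (r *\<^sub>R u) (r *\<^sub>R u) = r\<^sup>2 * h c z u u"
  using h_bilinear[of z] by (simp add: bilinear_lmul bilinear_rmul power2_eq_square)

lemma h_nonneg: "z \<in> snd c ` fst c \<Longrightarrow> h c z u u \<ge> 0"
  using h_pos[of z u] h_scale[of z 0 0] by (cases "u = 0") (auto simp: less_imp_le)

lemma h_coeff_continuous: "continuous_on (snd c ` fst c) (\<lambda>z. h c z u v)"
proof -
  have "smooth_on (\<lambda>z. h c z u v) (snd c ` fst c)"
    using hm c by (simp add: riemannian_metric_def sym_tensor_def)
  then have "C_k_on 0 (\<lambda>z. h c z u v) (snd c ` fst c)" unfolding smooth_on_def by blast
  then show ?thesis by simp
qed

lemma h_expand: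
  assumes "z \<in> snd c ` fst c"
  shows "h c z u u = (Re u)\<^sup>2 * h c z 1 1 + Re u * Im u * (h c z 1 \<i> + h c z \<i> 1) + (Im u)\<^sup>2 * h c z \<i> \<i>"
proof -
  have u: "u = Re u *\<^sub>R 1 + Im u *\<^sub>R \<i>" by (simp add: complex_eq_iff)
  note b = h_bilinear[OF assms]
  show ?thesis
    by (subst (1 2) u) (simp only: bilinear_ladd[OF b] bilinear_radd[OF b] bilinear_lmul[OF b]
       bilinear_rmul[OF b], simp add: algebra_simps power2_eq_square)
qed

lemma h_continuous:
  assumes "continuous_on A f" "continuous_on A g" "f ` A \<subseteq> snd c ` fst c"
  shows "continuous_on A (\<lambda>t. h c (f t) (g t) (g t))"
proof -
  have "continuous_on A (\<lambda>t. h c (f t) a b)" for a b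
    using continuous_on_compose2[OF h_coeff_continuous assms(1,3)] .
  then have "continuous_on A (\<lambda>t. (Re (g t))\<^sup>2 * h c (f t) 1 1 + Re (g t) * Im (g t) * (h c (f t) 1 \<i> + h c (f t) \<i> 1)
      + (Im (g t))\<^sup>2 * h c (f t) \<i> \<i>)"
    by (intro continuous_intros assms)
  then show ?thesis
    by (rule continuous_on_eq) (rule h_expand[symmetric], use assms(3) in blast)
qed

text \<open>The quadratic form attains its extrema over the compact set of pairs of a point of \<open>C\<close> and a
unit vector.\<close>
lemma h_two_sided_bound:
  assumes C: "compact C" "C \<subseteq> snd c ` fst c"
  obtains k B where "k > 0" "B > 0" "\<And>z u. z \<in> C \<Longrightarrow> k\<^sup>2 * (norm u)\<^sup>2 \<le> h c z u u"
    "\<And>z u. z \<in> C \<Longrightarrow> h c z u u \<le> B\<^sup>2 * (norm u)\<^sup>2"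
proof (cases "C = {}")
  case True then show ?thesis using that[of 1 1] by simp
next
  case False
  let ?P = "C \<times> sphere (0::complex) 1"
  have P: "compact ?P" "?P \<noteq> {}" using C False by (auto intro: compact_Times)
  have cont: "continuous_on ?P (\<lambda>p. h c (fst p) (snd p) (snd p))"
    by (rule h_continuous) (use C in \<open>auto intro!: continuous_intros\<close>)
  obtain p where p: "p \<in> ?P" "\<And>q. q \<in> ?P \<Longrightarrow> h c (fst p) (snd p) (snd p) \<le> h c (fst q) (snd q) (snd q)"
    using continuous_attains_inf[OF P cont] by blast
  obtain b where b: "b \<in> ?P" "\<And>q. q \<in> ?P \<Longrightarrow> h c (fst q) (snd q) (snd q) \<le> h c (fst b) (snd b) (snd b)"
    using continuous_attains_sup[OF P cont] by blast
  define m where "m = h c (fst p) (snd p) (snd p)"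
  define M where "M = h c (fst b) (snd b) (snd b)"
  have m: "m > 0" unfolding m_def using p C by (intro h_pos) auto
  have M: "M \<ge> m" unfolding M_def m_def using p(1) b(2) by blast
  have eq: "h c z u u = (norm u)\<^sup>2 * h c z (sgn u) (sgn u)" if "z \<in> C" for z u
  proof -
    have "norm u *\<^sub>R sgn u = u" by (cases "u = 0") (simp_all add: sgn_div_norm)
    then show ?thesis using h_scale[of z "norm u" "sgn u"] that C by auto
  qed
  have *: "m * (norm u)\<^sup>2 \<le> h c z u u \<and> h c z u u \<le> M * (norm u)\<^sup>2" if z: "z \<in> C" for z u
  proof (cases "u = 0")
    case True
    then show ?thesis using eq[OF z, of u] by simp
  next
    case False
    then have "(z, sgn u) \<in> ?P" using z by (simp add: norm_sgn)
    from p(2)[OF this] b(2)[OF this] show ?thesis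
      unfolding eq[OF z, of u] m_def M_def by (auto simp: mult.commute intro!: mult_left_mono)
  qed
  show ?thesis
    by (rule that[of "sqrt m" "sqrt M"]) (use m M * in auto)
qed

end

lemma h_transform:
  assumes "c \<in> charts S" "d \<in> charts S" "q \<in> fst c" "q \<in> fst d"
  shows "h c (snd c q) u v = h d (snd d q) (deriv (transition c d) (snd c q) * u) (deriv (transition c d) (snd c q) * v)"
proof -
  have "snd c q \<in> snd c ` (fst c \<inter> fst d)" by (intro imageI IntI assms)
  from hm[unfolded riemannian_metric_def sym_tensor_def, THEN conjunct1, THEN conjunct2, THEN conjunct2,
      rule_format, OF assms(1,2) this, of u v]
  show ?thesis by (simp add: transition_coord[OF assms(1,3)])
qed

definition speed :: "(real \<Rightarrow> 'a) \<Rightarrow> real \<Rightarrow> real" where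
  "speed \<gamma> t = (let c = chart_at S (\<gamma> t); v = vector_derivative (snd c \<circ> \<gamma>) (at t)
      in sqrt (h c (snd c (\<gamma> t)) v v))"

lemma path_length_speed: "path_length S h I \<gamma> = (\<integral>\<^sup>+t\<in>I. ennreal (speed \<gamma> t) \<partial>lborel)"
  by (simp add: path_length_def speed_def Let_def)

lemma speed_chart:
  assumes "regular_times a b \<gamma> K" "c \<in> charts S" "t \<in> {a..b} - K" "\<gamma> t \<in> fst c"
  shows "speed \<gamma> t = (let v = vector_derivative (snd c \<circ> \<gamma>) (at t) in sqrt (h c (snd c (\<gamma> t)) v v))"
proof -
  have q: "\<gamma> t \<in> points S" using chart_sub[OF assms(2)] assms(4) by (rule subsetD)
  show ?thesis unfolding speed_def Let_def
    using h_transform[OF assms(2) chart_at(1)[OF q] assms(4) chart_at(2)[OF q]]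
      regular_change_chart[OF assms(1,2) chart_at(1)[OF q] assms(3,4) chart_at(2)[OF q]] by simp
qed

text \<open>In each chart the speed is continuous off the exceptional times, and these open sets of times
cover the interval.\<close>
lemma speed_measurable:
  assumes reg: "regular_times a b \<gamma> K"
  shows "(\<lambda>t. ennreal (speed \<gamma> t) * indicator ({a..b} - K) t) \<in> borel_measurable borel"
proof -
  define O' where "O' (c :: 'a chart) = {t\<in>{a..b}. \<gamma> t \<in> fst c} - K" for c
  have "continuous_on (O' c) (speed \<gamma>)" if c: "c \<in> charts S" for c
  proof -
    have C1: "(snd c \<circ> \<gamma>) C1_differentiable_on O' c"
      using reg c by (simp add: regular_times_def O'_def)
    have "continuous_on (O' c) (snd c \<circ> \<gamma>)"
      using C1 by (rule C1_differentiable_imp_continuous_on)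
    moreover have "continuous_on (O' c) (\<lambda>t. vector_derivative (snd c \<circ> \<gamma>) (at t))"
      using C1 unfolding C1_differentiable_on_eq by blast
    ultimately have "continuous_on (O' c) (\<lambda>t. sqrt (h c ((snd c \<circ> \<gamma>) t) (vector_derivative (snd c \<circ> \<gamma>) (at t)) (vector_derivative (snd c \<circ> \<gamma>) (at t))))"
      by (intro continuous_on_real_sqrt h_continuous[OF c])
         (auto simp: O'_def)
    then show ?thesis
      by (rule continuous_on_eq) (use speed_chart[OF reg c] in \<open>auto simp: O'_def Let_def\<close>)
  qed
  then have "continuous_on (\<Union>c\<in>charts S. O' c) (speed \<gamma>)"
    using regular_open[OF reg] by (intro continuous_on_open_UN) (auto simp: O'_def)
  moreover have "(\<Union>c\<in>charts S. O' c) = {a..b} - K"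
    using path_points[OF regular_times_pw[OF reg]] chart_at by (fastforce simp: O'_def)
  ultimately have cont: "continuous_on ({a..b} - K) (speed \<gamma>)" by simp
  have "{a..b} - K \<in> sets borel"
  proof (rule sets.Diff)
    show "K \<in> sets borel" using reg by (simp add: regular_times_def borel_closed finite_imp_closed)
  qed simp
  from borel_measurable_continuous_on_indicator[OF this cont]
  have "(\<lambda>t. ennreal (indicator ({a..b} - K) t *\<^sub>R speed \<gamma> t)) \<in> borel_measurable borel" by measurable
  also have "(\<lambda>t. ennreal (indicator ({a..b} - K) t *\<^sub>R speed \<gamma> t)) = (\<lambda>t. ennreal (speed \<gamma> t) * indicator ({a..b} - K) t)"
    by (auto simp: indicator_def)
  finally show ?thesis .
qed

lemma AE_notin_finite: "finite K \<Longrightarrow> AE t in lborel. t \<notin> (K :: real set)"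
  by (rule AE_not_in) (simp add: finite_imp_null_set_lborel)

lemma path_length_regular:
  assumes reg: "regular_times a b \<gamma> K"
  shows "path_length S h {a..b} \<gamma> = (\<integral>\<^sup>+t. ennreal (speed \<gamma> t) * indicator ({a..b} - K) t \<partial>lborel)"
  unfolding path_length_speed
proof (rule nn_integral_cong_AE)
  have "finite K" using reg by (simp add: regular_times_def)
  then show "AE t in lborel. ennreal (speed \<gamma> t) * indicator {a..b} t = ennreal (speed \<gamma> t) * indicator ({a..b} - K) t"
    by (rule AE_mp[OF AE_notin_finite]) (auto simp: indicator_def)
qed

text \<open>Covers reversal as well as reparametrisation, since \<open>r\<close> may be negative.\<close>
lemma path_affine:
  assumes path: "pw_C1_path S a b \<gamma>" and r: "r \<noteq> 0" and im: "{a..b} = (\<lambda>s. r * s + e) ` {a'..b'}"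
  shows "pw_C1_path S a' b' (\<lambda>s. \<gamma> (r * s + e))"
    "path_length S h {a'..b'} (\<lambda>s. \<gamma> (r * s + e)) = path_length S h {a..b} \<gamma>"
proof -
  obtain K where K: "regular_times a b \<gamma> K" using regular_timesE[OF path] .
  let ?A = "\<lambda>s. r * s + e"
  define K' where "K' = insert a' (insert b' (?A -` K))"
  have "inj ?A" using r by (auto simp: inj_def)
  then have fin: "finite (?A -` K)" using K by (auto simp: regular_times_def intro: finite_vimageI)
  have ab: "?A s \<in> {a..b} \<longleftrightarrow> s \<in> {a'..b'}" for s
    unfolding im using inj_image_mem_iff[OF \<open>inj ?A\<close>] by simp
  have cont: "continuous_map (top_of_set {a'..b'}) (surf_top S) (\<gamma> \<circ> ?A)"
  proof (rule continuous_map_compose)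
    show "continuous_map (top_of_set {a..b}) (surf_top S) \<gamma>" using path by (simp add: pw_C1_path_def)
    have "continuous_on {a'..b'} ?A" by (intro continuous_intros)
    then show "continuous_map (top_of_set {a'..b'}) (top_of_set {a..b}) ?A"
      using im by auto
  qed
  have vd: "((snd c \<circ> (\<lambda>s. \<gamma> (?A s))) has_vector_derivative r *\<^sub>R vector_derivative (snd c \<circ> \<gamma>) (at (?A s))) (at s)"
    if c: "c \<in> charts S" and s: "?A s \<in> {a..b} - K" "\<gamma> (?A s) \<in> fst c" for c s
  proof -
    have "(?A has_vector_derivative r) (at s)" by (auto intro!: derivative_eq_intros simp: has_vector_derivative_def)
    from vector_diff_chain_at[OF this regular_vector_derivative[OF K c s]]
    show ?thesis by (simp add: o_def)
  qed
  have reg: "regular_times a' b' (\<lambda>s. \<gamma> (?A s)) K'"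
    unfolding regular_times_def
  proof (intro conjI ballI)
    fix c assume c: "c \<in> charts S"
    let ?O = "{t\<in>{a..b}. \<gamma> t \<in> fst c} - K" and ?O' = "{s \<in> {a'..b'}. \<gamma> (?A s) \<in> fst c} - K'"
    have C1: "(snd c \<circ> \<gamma>) C1_differentiable_on ?O" using K c by (simp add: regular_times_def)
    have sub: "?A ` ?O' \<subseteq> ?O" using ab by (auto simp: K'_def)
    show "(snd c \<circ> (\<lambda>s. \<gamma> (?A s))) C1_differentiable_on ?O'"
      unfolding C1_differentiable_on_def
    proof (intro exI conjI ballI)
      show "((snd c \<circ> (\<lambda>s. \<gamma> (?A s))) has_vector_derivative r *\<^sub>R vector_derivative (snd c \<circ> \<gamma>) (at (?A s))) (at s)"
        if "s \<in> ?O'" for s using vd[OF c, of s] that sub by auto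
      have "continuous_on ?O' (\<lambda>s. vector_derivative (snd c \<circ> \<gamma>) (at (?A s)))"
      proof (rule continuous_on_compose2[OF _ _ sub])
        show "continuous_on ?O (\<lambda>t. vector_derivative (snd c \<circ> \<gamma>) (at t))"
          using C1 unfolding C1_differentiable_on_eq by blast
      qed (intro continuous_intros)
      then show "continuous_on ?O' (\<lambda>s. r *\<^sub>R vector_derivative (snd c \<circ> \<gamma>) (at (?A s)))"
        by (intro continuous_intros)
    qed
  qed (use cont fin in \<open>auto simp: K'_def o_def\<close>)
  then show "pw_C1_path S a' b' (\<lambda>s. \<gamma> (?A s))" by (rule regular_times_pw)
  have sp: "speed (\<lambda>s. \<gamma> (?A s)) s = \<bar>r\<bar> * speed \<gamma> (?A s)" if s: "s \<in> {a'..b'} - K'" for s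
  proof -
    have s': "?A s \<in> {a..b} - K" using s ab by (auto simp: K'_def)
    then have q: "\<gamma> (?A s) \<in> points S" using path_points[OF path] by simp
    let ?c = "chart_at S (\<gamma> (?A s))"
    have "vector_derivative (snd ?c \<circ> (\<lambda>s. \<gamma> (?A s))) (at s) = r *\<^sub>R vector_derivative (snd ?c \<circ> \<gamma>) (at (?A s))"
      using vd[OF chart_at(1)[OF q] s' chart_at(2)[OF q]] by (rule vector_derivative_at)
    then show ?thesis
      using h_scale[OF chart_at(1)[OF q], of "snd ?c (\<gamma> (?A s))"] chart_at(2)[OF q]
      by (simp add: speed_def Let_def real_sqrt_mult)
  qed
  let ?f = "\<lambda>t. ennreal (speed \<gamma> t) * indicator ({a..b} - K) t"
  have nn: "speed \<gamma> t \<ge> 0" if "t \<in> {a..b}" for t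
    using path_points[OF path that] h_nonneg chart_at by (simp add: speed_def Let_def)
  have "path_length S h {a..b} \<gamma> = (\<integral>\<^sup>+t. ?f t \<partial>lborel)" by (rule path_length_regular[OF K])
  also have "\<dots> = ennreal \<bar>r\<bar> * (\<integral>\<^sup>+s. ?f (e + r * s) \<partial>lborel)"
    using nn_integral_real_affine[OF _ r, of ?f e] speed_measurable[OF K] by simp
  also have "\<dots> = (\<integral>\<^sup>+s. ennreal \<bar>r\<bar> * ?f (e + r * s) \<partial>lborel)"
    by (rule nn_integral_cmult[symmetric]) (use speed_measurable[OF K] in measurable)
  also have "\<dots> = path_length S h {a'..b'} (\<lambda>s. \<gamma> (?A s))"
    unfolding path_length_regular[OF reg]
  proof (rule nn_integral_cong_AE)
    have "finite K'" using fin by (simp add: K'_def)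
    then have "AE s in lborel. s \<notin> K'" by (rule AE_notin_finite)
    then show "AE s in lborel. ennreal \<bar>r\<bar> * ?f (e + r * s) = ennreal (speed (\<lambda>s. \<gamma> (?A s)) s) * indicator ({a'..b'} - K') s"
    proof (rule AE_mp, intro AE_I2 impI)
      fix s assume s: "s \<notin> K'"
      have "e + r * s \<in> {a..b} - K \<longleftrightarrow> s \<in> {a'..b'} - K'"
        using s ab[of s] by (auto simp: K'_def add.commute)
      then show "ennreal \<bar>r\<bar> * ?f (e + r * s) = ennreal (speed (\<lambda>s. \<gamma> (?A s)) s) * indicator ({a'..b'} - K') s"
        using sp[of s] nn by (auto simp: indicator_def ennreal_mult add.commute)
    qed
  qed
  finally show "path_length S h {a'..b'} (\<lambda>s. \<gamma> (?A s)) = path_length S h {a..b} \<gamma>" by simp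
qed

lemma path_join:
  assumes p1: "pw_C1_path S a b \<gamma>" and p2: "pw_C1_path S b e \<delta>" and le: "a \<le> b" "b \<le> e" and match: "\<gamma> b = \<delta> b"
  defines "\<eta> \<equiv> \<lambda>t. if t \<le> b then \<gamma> t else \<delta> t"
  shows "pw_C1_path S a e \<eta>"
    "path_length S h {a..e} \<eta> = path_length S h {a..b} \<gamma> + path_length S h {b..e} \<delta>"
proof -
  obtain K1 where K1: "regular_times a b \<gamma> K1" using regular_timesE[OF p1] .
  obtain K2 where K2: "regular_times b e \<delta> K2" using regular_timesE[OF p2] .
  define K where "K = K1 \<union> K2"
  have fin: "finite K" and bK: "a \<in> K" "b \<in> K" "e \<in> K" and bKi: "a \<in> K1" "b \<in> K1" "b \<in> K2" "e \<in> K2"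
    using K1 K2 by (auto simp: K_def regular_times_def)
  have cont: "continuous_map (top_of_set {a..e}) (surf_top S) \<eta>"
    unfolding \<eta>_def
  proof (rule continuous_map_cases_le)
    have "{a..e} \<inter> {t \<in> topspace (top_of_set {a..e}). t \<le> b} = {a..b}"
      "{a..e} \<inter> {t \<in> topspace (top_of_set {a..e}). b \<le> t} = {b..e}" using le by auto
    then show "continuous_map (subtopology (top_of_set {a..e}) {t \<in> topspace (top_of_set {a..e}). t \<le> b}) (surf_top S) \<gamma>"
      "continuous_map (subtopology (top_of_set {a..e}) {t \<in> topspace (top_of_set {a..e}). b \<le> t}) (surf_top S) \<delta>"
      using p1 p2 unfolding pw_C1_path_def subtopology_subtopology by simp_all
  qed (use match in \<open>auto intro!: continuous_intros\<close>)
  have near1: "\<forall>\<^sub>F s in nhds t. \<eta> s = \<gamma> s" if "t < b" for t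
    using eventually_nhds_in_open[of "{..<b}" t] that by (auto elim!: eventually_mono simp: \<eta>_def)
  have near2: "\<forall>\<^sub>F s in nhds t. \<eta> s = \<delta> s" if "t > b" for t
    using eventually_nhds_in_open[of "{b<..}" t] that by (auto elim!: eventually_mono simp: \<eta>_def)
  have vd1: "vector_derivative (snd c \<circ> \<eta>) (at t) = vector_derivative (snd c \<circ> \<gamma>) (at t)" if "t < b" for c :: "'a chart" and t
    using near1[OF that] by (intro vector_derivative_cong_eq refl) (auto elim: eventually_mono)
  have vd2: "vector_derivative (snd c \<circ> \<eta>) (at t) = vector_derivative (snd c \<circ> \<delta>) (at t)" if "t > b" for c :: "'a chart" and t
    using near2[OF that] by (intro vector_derivative_cong_eq refl) (auto elim: eventually_mono)
  have reg: "regular_times a e \<eta> K"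
    unfolding regular_times_def
  proof (intro conjI ballI)
    fix c assume c: "c \<in> charts S"
    let ?O1 = "{t\<in>{a..b}. \<gamma> t \<in> fst c} - K" and ?O2 = "{t\<in>{b..e}. \<delta> t \<in> fst c} - K"
    have e1: "?O1 = ({t\<in>{a..b}. \<gamma> t \<in> fst c} - K1) - K" and e2: "?O2 = ({t\<in>{b..e}. \<delta> t \<in> fst c} - K2) - K"
      by (auto simp: K_def)
    have op: "open ?O1" "open ?O2"
      unfolding e1 e2 by (rule open_Diff[OF regular_open[OF K1 c] finite_imp_closed[OF fin]]
        open_Diff[OF regular_open[OF K2 c] finite_imp_closed[OF fin]])+
    have "(snd c \<circ> \<gamma>) C1_differentiable_on ({t\<in>{a..b}. \<gamma> t \<in> fst c} - K1)"
      "(snd c \<circ> \<delta>) C1_differentiable_on ({t\<in>{b..e}. \<delta> t \<in> fst c} - K2)"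
      using K1 K2 c unfolding regular_times_def by blast+
    then have C1: "(snd c \<circ> \<gamma>) C1_differentiable_on ?O1" "(snd c \<circ> \<delta>) C1_differentiable_on ?O2"
      by (auto simp: K_def elim: C1_differentiable_on_subset)
    have lt: "t < b" if "t \<in> ?O1" for t using that bK by (auto simp: less_le)
    have gt: "t > b" if "t \<in> ?O2" for t using that bK by (auto simp: less_le)
    have U: "{t \<in> {a..e}. \<eta> t \<in> fst c} - K = ?O1 \<union> ?O2"
      using le bK by (auto simp: \<eta>_def)
    have d1: "((snd c \<circ> \<eta>) has_vector_derivative vector_derivative (snd c \<circ> \<gamma>) (at t)) (at t)" if t: "t \<in> ?O1" for t
    proof -
      have "((snd c \<circ> \<gamma>) has_vector_derivative vector_derivative (snd c \<circ> \<gamma>) (at t)) (at t)"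
        using C1(1) t by (auto simp: C1_differentiable_on_eq vector_derivative_works)
      then show ?thesis
        by (rule has_vector_derivative_transform_within_open[OF _ open_lessThan[of b]]) (use lt[OF t] in \<open>auto simp: \<eta>_def\<close>)
    qed
    have d2: "((snd c \<circ> \<eta>) has_vector_derivative vector_derivative (snd c \<circ> \<delta>) (at t)) (at t)" if t: "t \<in> ?O2" for t
    proof -
      have "((snd c \<circ> \<delta>) has_vector_derivative vector_derivative (snd c \<circ> \<delta>) (at t)) (at t)"
        using C1(2) t by (auto simp: C1_differentiable_on_eq vector_derivative_works)
      then show ?thesis
        by (rule has_vector_derivative_transform_within_open[OF _ open_greaterThan[of b]]) (use gt[OF t] in \<open>auto simp: \<eta>_def\<close>)
    qed
    have "continuous_on ?O1 (\<lambda>t. vector_derivative (snd c \<circ> \<eta>) (at t))"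
      by (rule continuous_on_eq[of _ "\<lambda>t. vector_derivative (snd c \<circ> \<gamma>) (at t)"])
        (use C1 vd1 lt in \<open>auto simp: C1_differentiable_on_eq\<close>)
    moreover have "continuous_on ?O2 (\<lambda>t. vector_derivative (snd c \<circ> \<eta>) (at t))"
      by (rule continuous_on_eq[of _ "\<lambda>t. vector_derivative (snd c \<circ> \<delta>) (at t)"])
        (use C1 vd2 gt in \<open>auto simp: C1_differentiable_on_eq\<close>)
    ultimately show "(snd c \<circ> \<eta>) C1_differentiable_on ({t \<in> {a..e}. \<eta> t \<in> fst c} - K)"
      unfolding U C1_differentiable_on_eq using op d1 d2
      by (auto intro: continuous_on_open_Un differentiableI_vector)
  qed (use fin bK cont in auto)
  then show "pw_C1_path S a e \<eta>" by (rule regular_times_pw)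
  have sp1: "speed \<eta> t = speed \<gamma> t" if "t < b" for t
    using that vd1[OF that] by (simp add: speed_def Let_def) (simp add: \<eta>_def)
  have sp2: "speed \<eta> t = speed \<delta> t" if "t > b" for t
    using that vd2[OF that] by (simp add: speed_def Let_def) (simp add: \<eta>_def)
  have "path_length S h {a..e} \<eta> = (\<integral>\<^sup>+t. ennreal (speed \<gamma> t) * indicator ({a..b} - K1) t
       + ennreal (speed \<delta> t) * indicator ({b..e} - K2) t \<partial>lborel)"
    unfolding path_length_regular[OF reg]
  proof (rule nn_integral_cong_AE)
    show "AE t in lborel. ennreal (speed \<eta> t) * indicator ({a..e} - K) t = ennreal (speed \<gamma> t) * indicator ({a..b} - K1) t
       + ennreal (speed \<delta> t) * indicator ({b..e} - K2) t"
    proof (rule AE_mp[OF AE_notin_finite[OF fin]], intro AE_I2 impI)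
      fix t assume "t \<notin> K"
      then have "t \<noteq> b" "t \<notin> K1" "t \<notin> K2" "t \<notin> K" using bK by (auto simp: K_def)
      then show "ennreal (speed \<eta> t) * indicator ({a..e} - K) t = ennreal (speed \<gamma> t) * indicator ({a..b} - K1) t
       + ennreal (speed \<delta> t) * indicator ({b..e} - K2) t"
        using le sp1[of t] sp2[of t] by (cases "t < b") (auto simp: indicator_def)
    qed
  qed
  also have "\<dots> = path_length S h {a..b} \<gamma> + path_length S h {b..e} \<delta>"
    unfolding path_length_regular[OF K1] path_length_regular[OF K2]
    by (rule nn_integral_add) (use speed_measurable[OF K1] speed_measurable[OF K2] in simp_all)
  finally show "path_length S h {a..e} \<eta> = path_length S h {a..b} \<gamma> + path_length S h {b..e} \<delta>" .
qed

end

section \<open>The distance of a Riemannian metric\<close>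

lemma INF_add_const_ennreal:
  fixes f :: "'i \<Rightarrow> ennreal"
  assumes "I \<noteq> {}"
  shows "(INF i\<in>I. f i + c) = (INF i\<in>I. f i) + c"
  using continuous_at_Inf_mono[of "\<lambda>x. x + c" "f ` I"]
    continuous_add[of "at_right (Inf (f ` I))" "\<lambda>x. x" "\<lambda>x. c"] assms
  by (auto simp: mono_def image_comp)

context riemann_metric
begin

text \<open>With values in the extended nonnegative reals the infimum needs no proof that a path exists;
finiteness is shown afterwards, and \<open>riemannian_dist\<close> is the real version.\<close>
definition edist :: "'a \<Rightarrow> 'a \<Rightarrow> ennreal" where
  "edist x y = (INF \<gamma> \<in> {\<gamma>. path_from_to S x y \<gamma>}. path_length S h {0..1} \<gamma>)"

lemma edist_le: "path_from_to S x y \<gamma> \<Longrightarrow> edist x y \<le> path_length S h {0..1} \<gamma>"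
  unfolding edist_def by (rule INF_lower) simp

text \<open>A coordinate segment is an admissible path, of speed at most \<open>B |w - z|\<close>.\<close>
lemma straight_path:
  assumes c: "c \<in> charts S" and A: "open A" "A \<subseteq> snd c ` fst c" "closed_segment z w \<subseteq> A"
    and B: "B \<ge> 0" "\<And>z u. z \<in> A \<Longrightarrow> h c z u u \<le> B\<^sup>2 * (norm u)\<^sup>2"
  shows "edist (chart_inv c z) (chart_inv c w) \<le> ennreal (B * norm (w - z))"
proof -
  let ?l = "linepath z w"
  define \<gamma> where "\<gamma> = chart_inv c \<circ> ?l"
  have l: "?l t \<in> A" if "t \<in> {0..1}" for t
    using A(3) that linepath_in_path by blast
  have dl: "(?l has_vector_derivative (w - z)) (at t)" for t
    by (rule has_vector_derivative_linepath_within)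
  have reg: "regular_times 0 1 \<gamma> {0, 1}"
    unfolding regular_times_def
  proof (intro conjI ballI)
    have "continuous_map (top_of_set {0..1}) (top_of_set (snd c ` fst c)) ?l"
      using l A(2) by (auto intro!: continuous_on_linepath)
    then show "continuous_map (top_of_set {0..1}) (surf_top S) \<gamma>"
      unfolding \<gamma>_def by (rule continuous_map_compose[OF _ cont_inv[OF c]])
    fix d assume d: "d \<in> charts S"
    let ?O = "{t \<in> {0..1}. \<gamma> t \<in> fst d} - {0, 1}" and ?T = "transition c d"
    have O: "?l t \<in> snd c ` (fst c \<inter> fst d)" if "t \<in> ?O" for t
    proof -
      have "?l t \<in> snd c ` fst c" using l[of t] A(2) that by auto
      then have "?l t = snd c (\<gamma> t)" "\<gamma> t \<in> fst c" by (simp_all add: \<gamma>_def)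
      then show ?thesis using that by auto
    qed
    show "snd d \<circ> \<gamma> C1_differentiable_on ?O"
      unfolding C1_differentiable_on_def
    proof (intro exI conjI ballI)
      fix t assume "t \<in> ?O"
      then have "(?T has_field_derivative deriv ?T (?l t)) (at (?l t))"
        using holomorphic_derivI[OF transition_holo[OF c d] overlap_open[OF c d] O] by blast
      from field_vector_diff_chain_at[OF dl this]
      show "(snd d \<circ> \<gamma> has_vector_derivative (w - z) * deriv ?T (?l t)) (at t)"
        by (simp only: \<gamma>_def transition_def o_assoc)
    next
      have "continuous_on (snd c ` (fst c \<inter> fst d)) (deriv ?T)"
        using holomorphic_deriv[OF transition_holo[OF c d] overlap_open[OF c d]]
        by (rule holomorphic_on_imp_continuous_on)
      then have "continuous_on ?O (\<lambda>t. deriv ?T (?l t))"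
        by (rule continuous_on_compose2) (use O in \<open>auto intro!: continuous_on_linepath\<close>)
      then show "continuous_on ?O (\<lambda>t. (w - z) * deriv ?T (?l t))"
        by (intro continuous_intros)
    qed
  qed auto
  have "path_from_to S (chart_inv c z) (chart_inv c w) \<gamma>"
    using regular_times_pw[OF reg] by (simp add: path_from_to_def \<gamma>_def linepath_0' linepath_1')
  then have "edist (chart_inv c z) (chart_inv c w) \<le> path_length S h {0..1} \<gamma>" by (rule edist_le)
  also have "\<dots> \<le> (\<integral>\<^sup>+t. ennreal (B * norm (w - z)) * indicator {0..1::real} t \<partial>lborel)"
    unfolding path_length_regular[OF reg]
  proof (rule nn_integral_mono)
    fix t :: real
    show "ennreal (speed \<gamma> t) * indicator ({0..1} - {0, 1}) t \<le> ennreal (B * norm (w - z)) * indicator {0..1} t"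
    proof (cases "t \<in> {0..1} - {0, 1}")
      case t: True
      then have lt: "?l t \<in> A" using l by simp
      then have ltD: "?l t \<in> snd c ` fst c" using A(2) by blast
      have g: "\<gamma> t \<in> fst c" "snd c (\<gamma> t) = ?l t" using ltD by (simp_all add: \<gamma>_def)
      have "((snd c \<circ> \<gamma>) has_vector_derivative (w - z)) (at t)"
      proof (rule has_vector_derivative_transform_within_open[OF dl])
        have "continuous_on UNIV ?l" by (rule continuous_on_linepath)
        then show "open (?l -` A)" using A(1) open_vimage by blast
        show "t \<in> ?l -` A" using lt by simp
        show "?l s = (snd c \<circ> \<gamma>) s" if "s \<in> ?l -` A" for s
          using coord_inv[of "?l s" c] that A(2) by (auto simp: \<gamma>_def)
      qed
      then have v: "vector_derivative (snd c \<circ> \<gamma>) (at t) = w - z" by (rule vector_derivative_at)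
      have "speed \<gamma> t = sqrt (h c (?l t) (w - z) (w - z))"
        using speed_chart[OF reg c t g(1)] unfolding v g(2) Let_def .
      also have "\<dots> \<le> sqrt (B\<^sup>2 * (norm (w - z))\<^sup>2)" using B(2)[OF lt] by simp
      also have "\<dots> = B * norm (w - z)" using B(1) by (simp add: real_sqrt_mult)
      finally have "speed \<gamma> t \<le> B * norm (w - z)" .
      then show ?thesis using t by (auto simp: indicator_def intro!: ennreal_leI)
    qed (auto simp: indicator_def)
  qed
  also have "\<dots> = ennreal (B * norm (w - z))"
    by (simp add: nn_integral_cmult_indicator)
  finally show ?thesis .
qed

lemma path_ball:
  assumes c: "c \<in> charts S" and q: "q \<in> fst c"
  obtains r B where "r > 0" "B > 0" "ball (snd c q) r \<subseteq> snd c ` fst c"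
    "\<And>z w. z \<in> ball (snd c q) r \<Longrightarrow> w \<in> ball (snd c q) r \<Longrightarrow>
       edist (chart_inv c z) (chart_inv c w) \<le> ennreal (B * norm (w - z))"
proof -
  obtain r where r: "r > 0" "cball (snd c q) r \<subseteq> snd c ` fst c"
    using coord_open[OF c] q by (metis image_eqI open_contains_cball)
  obtain k B where B: "B > 0" "\<And>z u. z \<in> cball (snd c q) r \<Longrightarrow> h c z u u \<le> B\<^sup>2 * (norm u)\<^sup>2"
    using h_two_sided_bound[OF c compact_cball r(2)] by metis
  have bs: "ball (snd c q) r \<subseteq> snd c ` fst c" using r(2) ball_subset_cball by blast
  show ?thesis
  proof (rule that[OF r(1) B(1) bs])
    fix z w assume "z \<in> ball (snd c q) r" "w \<in> ball (snd c q) r"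
    then have "closed_segment z w \<subseteq> ball (snd c q) r" by (simp add: closed_segment_subset)
    then show "edist (chart_inv c z) (chart_inv c w) \<le> ennreal (B * norm (w - z))"
      by (intro straight_path[OF c open_ball bs]) (use B in auto)
  qed
qed

lemma edist_refl: 
  assumes "x \<in> points S" shows "edist x x = 0"
proof -
  let ?c = "chart_at S x"
  obtain r B where "r > 0" and b: "\<And>z w. z \<in> ball (snd ?c x) r \<Longrightarrow> w \<in> ball (snd ?c x) r \<Longrightarrow>
       edist (chart_inv ?c z) (chart_inv ?c w) \<le> ennreal (B * norm (w - z))"
    using path_ball[OF chart_at[OF assms]] by metis
  then have "edist (chart_inv ?c (snd ?c x)) (chart_inv ?c (snd ?c x)) \<le> ennreal (B * norm (snd ?c x - snd ?c x))"
    by (intro b) auto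
  then show ?thesis using chart_at[OF assms] by simp
qed

lemma edist_sym: "edist x y = edist y x"
proof -
  have "edist x y \<le> edist y x" for x y
    unfolding edist_def[of y x]
  proof (rule INF_greatest)
    fix \<gamma> assume "\<gamma> \<in> {\<gamma>. path_from_to S y x \<gamma>}"
    then have p: "pw_C1_path S 0 1 \<gamma>" "\<gamma> 0 = y" "\<gamma> 1 = x" by (auto simp: path_from_to_def)
    have im: "{0..1} = (\<lambda>s. (-1) * s + 1) ` {0..1::real}"
      by (auto simp: image_iff intro!: bexI[of _ "1 - _"])
    note q = path_affine[OF p(1) _ im]
    have "path_from_to S x y (\<lambda>s. \<gamma> ((-1) * s + 1))"
      using q(1) p by (simp add: path_from_to_def)
    from edist_le[OF this] show "edist x y \<le> path_length S h {0..1} \<gamma>" using q(2) by simp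
  qed
  then show ?thesis by (intro antisym) auto
qed

lemma edist_triangle: "edist x z \<le> edist x y + edist y z"
proof (cases "(\<exists>\<gamma>. path_from_to S x y \<gamma>) \<and> (\<exists>\<gamma>. path_from_to S y z \<gamma>)")
  case False
  then have "edist x y = \<infinity> \<or> edist y z = \<infinity>" by (auto simp: edist_def)
  then show ?thesis by auto
next
  case True
  have *: "edist x z \<le> path_length S h {0..1} \<gamma> + path_length S h {0..1} \<delta>"
    if "path_from_to S x y \<gamma>" "path_from_to S y z \<delta>" for \<gamma> \<delta>
  proof -
    have g: "pw_C1_path S 0 1 \<gamma>" "\<gamma> 0 = x" "\<gamma> 1 = y" and d: "pw_C1_path S 0 1 \<delta>" "\<delta> 0 = y" "\<delta> 1 = z"
      using that by (auto simp: path_from_to_def)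
    have im1: "{0..1} = (\<lambda>s. 1 * s + (-1)) ` {1..2::real}"
      by (auto simp: image_iff intro!: bexI[of _ "1 + _"])
    note d' = path_affine[OF d(1) _ im1]
    let ?d = "\<lambda>s. \<delta> (1 * s + -1)"
    define \<eta> where "\<eta> = (\<lambda>t. if t \<le> 1 then \<gamma> t else ?d t)"
    have e: "pw_C1_path S 0 2 \<eta>" "path_length S h {0..2} \<eta> = path_length S h {0..1} \<gamma> + path_length S h {1..2} ?d"
      unfolding \<eta>_def using path_join[OF g(1) d'(1)] g d by auto
    have im2: "{0..2} = (\<lambda>s. 2 * s + 0) ` {0..1::real}"
      by (auto simp: image_iff intro!: bexI[of _ "_ / 2"])
    note e' = path_affine[OF e(1) _ im2]
    have "path_from_to S x z (\<lambda>s. \<eta> (2 * s + 0))"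
      using e'(1) g d by (simp add: path_from_to_def \<eta>_def)
    from edist_le[OF this] show ?thesis using e'(2) e(2) d'(2) by simp
  qed
  have "edist x z \<le> (INF \<gamma>\<in>{\<gamma>. path_from_to S x y \<gamma>}. INF \<delta>\<in>{\<delta>. path_from_to S y z \<delta>}. path_length S h {0..1} \<gamma> + path_length S h {0..1} \<delta>)"
    using * by (intro INF_greatest) auto
  also have "\<dots> = edist x y + edist y z"
  proof -
    have "(INF \<delta>\<in>{\<delta>. path_from_to S y z \<delta>}. a + path_length S h {0..1} \<delta>) = a + edist y z" for a
      unfolding edist_def using True INF_add_const_ennreal[of "{\<delta>. path_from_to S y z \<delta>}" "path_length S h {0..1}" a]
      by (simp add: add.commute)
    moreover have "(INF \<gamma>\<in>{\<gamma>. path_from_to S x y \<gamma>}. path_length S h {0..1} \<gamma> + b) = edist x y + b" for b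
      unfolding edist_def using True by (intro INF_add_const_ennreal) auto
    ultimately show ?thesis by (simp only:)
  qed
  finally show ?thesis .
qed

lemma edist_small_nbhd:
  assumes x: "x \<in> points S" and "e > 0"
  obtains U where "openin (surf_top S) U" "x \<in> U" "\<And>y. y \<in> U \<Longrightarrow> edist x y < ennreal e"
proof -
  let ?c = "chart_at S x"
  note c = chart_at[OF x]
  obtain r B where rB: "r > 0" "B > 0" "ball (snd ?c x) r \<subseteq> snd ?c ` fst ?c" and b: "\<And>z w. z \<in> ball (snd ?c x) r \<Longrightarrow> w \<in> ball (snd ?c x) r \<Longrightarrow>
       edist (chart_inv ?c z) (chart_inv ?c w) \<le> ennreal (B * norm (w - z))"
    using path_ball[OF chart_at[OF x]] by metis
  define s where "s = min r (e / B)"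
  have s: "s > 0" using rB \<open>e > 0\<close> by (simp add: s_def)
  show ?thesis
  proof (rule that)
    show "openin (surf_top S) (chart_inv ?c ` ball (snd ?c x) s)"
      by (rule inv_image_open[OF c(1) open_ball]) (use rB in \<open>auto simp: s_def\<close>)
    show "x \<in> chart_inv ?c ` ball (snd ?c x) s"
      using s inv_coord[OF c] by (intro image_eqI[of _ _ "snd ?c x"]) auto
    fix y assume "y \<in> chart_inv ?c ` ball (snd ?c x) s"
    then obtain w where w: "w \<in> ball (snd ?c x) s" "y = chart_inv ?c w" by blast
    have "edist (chart_inv ?c (snd ?c x)) (chart_inv ?c w) \<le> ennreal (B * norm (w - snd ?c x))"
      using w rB by (intro b) (auto simp: s_def)
    also have "\<dots> < ennreal e"
    proof (rule ennreal_lessI[OF \<open>e > 0\<close>])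
      have "norm (w - snd ?c x) < e / B" using w by (auto simp: s_def dist_norm norm_minus_commute)
      then show "B * norm (w - snd ?c x) < e" using rB by (simp add: field_simps)
    qed
    finally show "edist x y < ennreal e" using w inv_coord[OF c] by simp
  qed
qed

text \<open>Points close to each other are at finite distance, so the points at finite distance from \<open>x\<close> form an
open set, and so do those at infinite distance; the surface is connected.\<close>
lemma edist_finite:
  assumes x: "x \<in> points S" and y: "y \<in> points S"
  shows "edist x y < \<infinity>"
proof -
  have op: "openin (surf_top S) {y \<in> points S. P (edist x y < \<infinity>)}" for P :: "bool \<Rightarrow> bool"
  proof (subst openin_subopen, intro ballI)
    fix y assume y: "y \<in> {y \<in> points S. P (edist x y < \<infinity>)}"
    then have yp: "y \<in> points S" by simp
    obtain U where U: "openin (surf_top S) U" "y \<in> U" "\<And>z. z \<in> U \<Longrightarrow> edist y z < ennreal 1"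
      using edist_small_nbhd[OF yp, of 1] by auto
    have fin: "edist x z < \<infinity> \<longleftrightarrow> edist x y < \<infinity>" if "z \<in> U" for z
    proof -
      have yz: "edist y z < \<infinity>" using U(3)[OF that] by (rule less_trans) simp
      have "edist x z < \<infinity>" if "edist x y < \<infinity>"
        by (rule le_less_trans[OF edist_triangle[of x z y]]) (use that yz in simp)
      moreover have "edist x y < \<infinity>" if "edist x z < \<infinity>"
        by (rule le_less_trans[OF edist_triangle[of x y z]]) (use that yz edist_sym[of y z] in simp)
      ultimately show ?thesis by blast
    qed
    have "U \<subseteq> {y \<in> points S. P (edist x y < \<infinity>)}"
    proof
      fix z assume z: "z \<in> U"
      then show "z \<in> {y \<in> points S. P (edist x y < \<infinity>)}"
        using fin[OF z] y openin_subset[OF U(1)] by auto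
    qed
    then show "\<exists>T. openin (surf_top S) T \<and> y \<in> T \<and> T \<subseteq> {y \<in> points S. P (edist x y < \<infinity>)}" using U by blast
  qed
  have "openin (surf_top S) {y \<in> points S. edist x y < \<infinity>}" using op[of "\<lambda>b. b"] by simp
  moreover have "closedin (surf_top S) {y \<in> points S. edist x y < \<infinity>}"
    unfolding closedin_def
  proof
    have "points S - {y \<in> points S. edist x y < \<infinity>} = {y \<in> points S. \<not> edist x y < \<infinity>}" by auto
    then show "openin (surf_top S) (points S - {y \<in> points S. edist x y < \<infinity>})" using op[of Not] by simp
  qed auto
  ultimately have "{y \<in> points S. edist x y < \<infinity>} = {} \<or> {y \<in> points S. edist x y < \<infinity>} = points S"
    using rs unfolding riemann_surface_def connected_space_clopen_in by blast
  moreover have "x \<in> {y \<in> points S. edist x y < \<infinity>}" using x edist_refl[OF x] by simp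
  ultimately show ?thesis using y by blast
qed

lemma Lipschitz_edist:
  fixes F :: "'a \<Rightarrow> real"
  assumes F: "continuous_map (surf_top S) euclidean F"
    and dF: "\<And>q. q \<in> points S \<Longrightarrow> \<exists>L. ((F \<circ> chart_inv (chart_at S q)) has_derivative L) (at (snd (chart_at S q) q))
       \<and> (\<forall>u. \<bar>L u\<bar> \<le> sqrt (h (chart_at S q) (snd (chart_at S q) q) u u))"
  shows "ennreal \<bar>F y - F x\<bar> \<le> edist x y"
  unfolding edist_def
proof (rule INF_greatest)
  fix \<gamma> assume "\<gamma> \<in> {\<gamma>. path_from_to S x y \<gamma>}"
  then have "pw_C1_path S 0 1 \<gamma>" "\<gamma> 0 = x" "\<gamma> 1 = y" by (auto simp: path_from_to_def)
  then show "ennreal \<bar>F y - F x\<bar> \<le> path_length S h {0..1} \<gamma>"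
    using Lipschitz_along_path[where h = h and F = F and a = 0 and b = 1 and \<gamma> = \<gamma>] F dF by auto
qed

end

section \<open>Completeness from a proper Lipschitz function\<close>

context riemann
begin

lemma continuous_map_chartwise:
  fixes F :: "'a \<Rightarrow> 'b::topological_space"
  assumes "\<And>q. q \<in> points S \<Longrightarrow> \<exists>c\<in>charts S. q \<in> fst c \<and> isCont (F \<circ> chart_inv c) (snd c q)"
  shows "continuous_map (surf_top S) euclidean F"
  unfolding continuous_map_def
proof (intro conjI allI impI)
  fix V :: "'b set" assume "openin euclidean V"
  then have V: "open V" by simp
  show "openin (surf_top S) {q \<in> points S. F q \<in> V}"
  proof (subst openin_subopen, intro ballI)
    fix q assume q: "q \<in> {q \<in> points S. F q \<in> V}"
    then obtain c where c: "c \<in> charts S" "q \<in> fst c" "isCont (F \<circ> chart_inv c) (snd c q)"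
      using assms by blast
    obtain A where A: "open A" "snd c q \<in> A" "\<And>z. z \<in> A \<Longrightarrow> (F \<circ> chart_inv c) z \<in> V"
      using continuous_at_open[THEN iffD1, OF c(3), rule_format, of V] V q c(1,2) by auto
    let ?A = "A \<inter> snd c ` fst c"
    have "openin (surf_top S) (chart_inv c ` ?A)"
      using A(1) coord_open[OF c(1)] by (intro inv_image_open[OF c(1)]) auto
    moreover have "q \<in> chart_inv c ` ?A" using A(2) c by (intro image_eqI[of _ _ "snd c q"]) auto
    moreover have "chart_inv c ` ?A \<subseteq> {q \<in> points S. F q \<in> V}"
      using A(3) chart_sub[OF c(1)] inv_in by fastforce
    ultimately show "\<exists>T. openin (surf_top S) T \<and> q \<in> T \<and> T \<subseteq> {q \<in> points S. F q \<in> V}" by blast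
  qed
qed simp

lemma compact_chart_cball:
  assumes c: "c \<in> charts S" and r: "cball z0 r \<subseteq> snd c ` fst c"
  shows "compactin (surf_top S) (chart_inv c ` cball z0 r)" "closedin (surf_top S) (chart_inv c ` cball z0 r)"
proof -
  have "compactin (top_of_set (snd c ` fst c)) (cball z0 r)"
    using r by (simp add: compactin_subtopology)
  then show 1: "compactin (surf_top S) (chart_inv c ` cball z0 r)"
    using image_compactin[OF _ cont_inv[OF c]] by blast
  then show "closedin (surf_top S) (chart_inv c ` cball z0 r)"
    using rs by (intro compactin_imp_closedin) (auto simp: riemann_surface_def)
qed

text \<open>Meant for \<open>\<phi>\<close> supported in a closed disc inside the image of the chart.\<close>
definition extend_by_zero :: "'a chart \<Rightarrow> (complex \<Rightarrow> real) \<Rightarrow> 'a \<Rightarrow> real" where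
  "extend_by_zero c \<phi> q = (if q \<in> fst c then \<phi> (snd c q) else 0)"

text \<open>The closed disc is compact and so closed in the surface; its complement is a neighbourhood of
every point outside the chart.\<close>
lemma extend_by_zero_local:
  assumes c: "c \<in> charts S" and r: "cball z0 r \<subseteq> snd c ` fst c"
    and supp: "\<And>z. z \<notin> cball z0 r \<Longrightarrow> \<phi> z = 0"
    and d: "d \<in> charts S" and q: "q \<in> fst d" "q \<notin> fst c"
  obtains A where "open A" "snd d q \<in> A" "A \<subseteq> snd d ` fst d"
    "\<And>z. z \<in> A \<Longrightarrow> chart_inv d z \<notin> chart_inv c ` cball z0 r"
    "\<And>z. z \<in> A \<Longrightarrow> extend_by_zero c \<phi> (chart_inv d z) = 0"
proof -
  let ?C = "chart_inv c ` cball z0 r"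
  let ?A = "snd d ` (fst d - ?C)"
  have "openin (surf_top S) (fst d - ?C)"
    using chart_open[OF d] compact_chart_cball[OF c r] by blast
  then have op: "open ?A" by (rule coord_image_open[OF d]) auto
  have out: "chart_inv d z \<in> fst d - ?C" if "z \<in> ?A" for z
    using that inv_coord[OF d] by auto
  have "q \<notin> ?C"
  proof
    assume "q \<in> ?C"
    then obtain z where "z \<in> cball z0 r" "q = chart_inv c z" by blast
    then show False using q(2) r inv_in[of z c] by auto
  qed
  show ?thesis
  proof (rule that[OF op])
    show "snd d q \<in> ?A" using q \<open>q \<notin> ?C\<close> by blast
    fix z assume z: "z \<in> ?A"
    show "chart_inv d z \<notin> ?C" using out[OF z] by blast
    show "extend_by_zero c \<phi> (chart_inv d z) = 0"
    proof (cases "chart_inv d z \<in> fst c")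
      case True
      have "snd c (chart_inv d z) \<notin> cball z0 r"
      proof
        assume "snd c (chart_inv d z) \<in> cball z0 r"
        then have "chart_inv c (snd c (chart_inv d z)) \<in> ?C" by blast
        then show False using out[OF z] inv_coord[OF c True] by simp
      qed
      then show ?thesis by (simp add: extend_by_zero_def supp)
    qed (simp add: extend_by_zero_def)
  qed auto
qed

end

lemma square_pos_part_deriv:
  "((\<lambda>s::real. (max 0 s)\<^sup>2) has_field_derivative 2 * max 0 s) (at s)"
proof -
  consider "s < 0" | "s = 0" | "s > 0" by linarith
  then show ?thesis
  proof cases
    case 1
    have "((\<lambda>s::real. 0) has_field_derivative 2 * max 0 s) (at s)" using 1 by simp
    then show ?thesis
      by (rule has_field_derivative_transform_within_open[of _ _ _ "{..<0}"]) (use 1 in auto)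
  next
    case 3
    have "((\<lambda>s::real. s\<^sup>2) has_field_derivative 2 * max 0 s) (at s)" using 3 by (auto intro!: derivative_eq_intros)
    then show ?thesis
      by (rule has_field_derivative_transform_within_open[of _ _ _ "{0<..}"]) (use 3 in auto)
  next
    case 2
    have "((\<lambda>h. (max 0 h)\<^sup>2 / h) \<longlongrightarrow> 0) (at (0::real))"
    proof (rule Lim_null_comparison)
      have "norm ((max 0 h)\<^sup>2 / h) \<le> \<bar>h\<bar>" for h :: real
        by (auto simp: max_def power2_eq_square)
      then show "\<forall>\<^sub>F h::real in at 0. norm ((max 0 h)\<^sup>2 / h) \<le> \<bar>h\<bar>" by simp
      show "((\<lambda>h::real. \<bar>h\<bar>) \<longlongrightarrow> 0) (at 0)" by (auto intro!: tendsto_eq_intros)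
    qed
    then show ?thesis using 2 by (simp add: DERIV_def)
  qed
qed

context riemann_metric
begin

text \<open>A radial bump at \<open>x\<close>, small enough to be 1-Lipschitz, separates \<open>x\<close> from \<open>y\<close>: it has
its strict maximum at \<open>x\<close>. This handles at once the points \<open>y\<close> inside and outside the
chart.\<close>
lemma edist_pos:
  assumes x: "x \<in> points S" and y: "y \<in> points S" and "x \<noteq> y"
  shows "edist x y > 0"
proof -
  define c where "c = chart_at S x"
  have c: "c \<in> charts S" "x \<in> fst c" using chart_at[OF x] by (auto simp: c_def)
  define z0 where "z0 = snd c x"
  obtain r where r: "r > 0" "cball z0 r \<subseteq> snd c ` fst c"
    using coord_open[OF c(1)] c(2) unfolding z0_def by (metis image_eqI open_contains_cball)
  obtain k B where k: "k > 0" "\<And>z u. z \<in> cball z0 r \<Longrightarrow> k\<^sup>2 * (norm u)\<^sup>2 \<le> h c z u u"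
    using h_two_sided_bound[OF c(1) compact_cball r(2)] by metis
  \<comment> \<open>the gradient of the bump has norm at most \<open>a * 4 * r ^ 3\<close>, and \<open>k * |u|\<close> is a lower bound for the length of \<open>u\<close>\<close>
  define a where "a = k / (4 * r ^ 3)"
  define \<phi> where "\<phi> w = a * (max 0 (r\<^sup>2 - (norm (w - z0))\<^sup>2))\<^sup>2" for w
  define L where "L w u = a * (2 * max 0 (r\<^sup>2 - (norm (w - z0))\<^sup>2) * (- (2 * ((w - z0) \<bullet> u))))" for w u
  define F where "F = extend_by_zero c \<phi>"
  have a: "a > 0" using k r by (simp add: a_def)
  have supp: "\<phi> z = 0" if "z \<notin> cball z0 r" for z
  proof -
    have "r < norm (z - z0)" using that by (simp add: dist_norm norm_minus_commute)
    then have "r\<^sup>2 \<le> (norm (z - z0))\<^sup>2" using r by (intro power_mono) auto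
    then show ?thesis by (simp add: \<phi>_def)
  qed
  have d\<phi>: "(\<phi> has_derivative L w) (at w)" for w
  proof -
    have n: "((\<lambda>w. r\<^sup>2 - (norm (w - z0))\<^sup>2) has_derivative (\<lambda>u. - (2 * ((w - z0) \<bullet> u)))) (at w)"
      unfolding power2_norm_eq_inner
      by (auto intro!: derivative_eq_intros simp: inner_commute)
    from has_derivative_compose[OF n square_pos_part_deriv[THEN has_field_derivative_imp_has_derivative]]
    have "((\<lambda>w. (max 0 (r\<^sup>2 - (norm (w - z0))\<^sup>2))\<^sup>2) has_derivative
       (\<lambda>u. 2 * max 0 (r\<^sup>2 - (norm (w - z0))\<^sup>2) * (- (2 * ((w - z0) \<bullet> u))))) (at w)" .
    from has_derivative_mult_right[OF this, of a] show ?thesis unfolding \<phi>_def L_def .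
  qed
  have L0: "L w u = 0" if "w \<notin> cball z0 r" for w u
  proof -
    have "r < norm (w - z0)" using that by (simp add: dist_norm norm_minus_commute)
    then have "r\<^sup>2 \<le> (norm (w - z0))\<^sup>2" using r by (intro power_mono) auto
    then show ?thesis by (simp add: L_def)
  qed
  have Lb: "\<bar>L w u\<bar> \<le> sqrt (h c w u u)" if w: "w \<in> snd c ` fst c" for w u
  proof (cases "w \<in> cball z0 r")
    case True
    then have wr: "norm (w - z0) \<le> r" by (simp add: dist_norm norm_minus_commute)
    have "\<bar>L w u\<bar> = a * (2 * max 0 (r\<^sup>2 - (norm (w - z0))\<^sup>2) * (2 * \<bar>(w - z0) \<bullet> u\<bar>))"
      using a by (simp add: L_def abs_mult)
    also have "\<dots> \<le> a * (2 * r\<^sup>2 * (2 * (r * norm u)))"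
    proof -
      have "\<bar>(w - z0) \<bullet> u\<bar> \<le> norm (w - z0) * norm u" by (rule Cauchy_Schwarz_ineq2)
      also have "\<dots> \<le> r * norm u" using wr by (intro mult_right_mono) auto
      finally have "2 * \<bar>(w - z0) \<bullet> u\<bar> \<le> 2 * (r * norm u)" by simp
      moreover have "2 * max 0 (r\<^sup>2 - (norm (w - z0))\<^sup>2) \<le> 2 * r\<^sup>2" by simp
      ultimately show ?thesis using a by (intro mult_left_mono mult_mono) auto
    qed
    also have "\<dots> = k * norm u" using r by (simp add: a_def field_simps power2_eq_square power3_eq_cube)
    also have "\<dots> \<le> sqrt (h c w u u)" using k(2)[OF True, of u] k(1) by (intro real_le_rsqrt) (simp add: power_mult_distrib)
    finally show ?thesis .
  next
    case False
    then show ?thesis using L0[OF False] h_nonneg[OF c(1) w] by simp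
  qed
  have dF: "\<exists>L'. ((F \<circ> chart_inv d) has_derivative L') (at (snd d q)) \<and> (\<forall>u. \<bar>L' u\<bar> \<le> sqrt (h d (snd d q) u u))"
    if d: "d \<in> charts S" and q: "q \<in> fst d" for d q
  proof (cases "q \<in> fst c")
    case True
    let ?T' = "deriv (transition d c) (snd d q)"
    have "((snd c \<circ> chart_inv d) has_derivative (\<lambda>u. ?T' * u)) (at (snd d q))"
      using transition_deriv[OF d c(1) q True] by (simp add: has_field_derivative_def)
    moreover have "(\<phi> has_derivative L (snd c q)) (at ((snd c \<circ> chart_inv d) (snd d q)))"
      using d\<phi>[of "snd c q"] inv_coord[OF d q] by simp
    ultimately have "((\<phi> \<circ> (snd c \<circ> chart_inv d)) has_derivative (L (snd c q) \<circ> (\<lambda>u. ?T' * u))) (at (snd d q))"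
      by (rule diff_chain_at)
    then have "((F \<circ> chart_inv d) has_derivative (L (snd c q) \<circ> (\<lambda>u. ?T' * u))) (at (snd d q))"
      by (rule has_derivative_transform_within_open[OF _ overlap_open[OF d c(1)]])
         (use True q d in \<open>auto simp: F_def extend_by_zero_def\<close>)
    moreover have "\<bar>(L (snd c q) \<circ> (\<lambda>u. ?T' * u)) u\<bar> \<le> sqrt (h d (snd d q) u u)" for u
      using Lb[of "snd c q" "?T' * u"] True h_transform[OF d c(1) q True, of u u] by simp
    ultimately show ?thesis by blast
  next
    case False
    obtain A where A: "open A" "snd d q \<in> A" and "A \<subseteq> snd d ` fst d"
      "\<And>z. z \<in> A \<Longrightarrow> chart_inv d z \<notin> chart_inv c ` cball z0 r" and A4: "\<And>z. z \<in> A \<Longrightarrow> extend_by_zero c \<phi> (chart_inv d z) = 0"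
      by (rule extend_by_zero_local[OF c(1) r(2) supp d q False]) (assumption, rule that)
    have "((\<lambda>_. 0::real) has_derivative (\<lambda>_. 0)) (at (snd d q))" by simp
    then have "((F \<circ> chart_inv d) has_derivative (\<lambda>_. 0)) (at (snd d q))"
      by (rule has_derivative_transform_within_open[OF _ A(1,2)]) (simp add: F_def A4)
    then show ?thesis using h_nonneg[OF d, of "snd d q"] q by (intro exI[of _ "\<lambda>_. 0"]) auto
  qed
  have cont: "continuous_map (surf_top S) euclidean F"
  proof (rule continuous_map_chartwise)
    fix q assume q: "q \<in> points S"
    show "\<exists>c\<in>charts S. q \<in> fst c \<and> isCont (F \<circ> chart_inv c) (snd c q)"
      using dF[OF chart_at[OF q]] chart_at[OF q] has_derivative_continuous by blast
  qed
  have "F y < F x"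
  proof (cases "y \<in> fst c")
    case True
    have "snd c y \<noteq> z0" using inv_coord[OF c(1)] True c(2) \<open>x \<noteq> y\<close> unfolding z0_def by metis
    then have "(norm (snd c y - z0))\<^sup>2 > 0" by simp
    then have "max 0 (r\<^sup>2 - (norm (snd c y - z0))\<^sup>2) < r\<^sup>2" using r by simp
    then have "(max 0 (r\<^sup>2 - (norm (snd c y - z0))\<^sup>2))\<^sup>2 < (r\<^sup>2)\<^sup>2" by (intro power_strict_mono) auto
    then show ?thesis using True c(2) a by (simp add: F_def extend_by_zero_def \<phi>_def z0_def)
  next
    case False
    then show ?thesis using c(2) a r by (simp add: F_def extend_by_zero_def \<phi>_def z0_def)
  qed
  then have "0 < ennreal \<bar>F y - F x\<bar>" by simp
  also have "\<dots> \<le> edist x y"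
    by (rule Lipschitz_edist[OF cont]) (use dF chart_at in blast)
  finally show ?thesis .
qed

lemma riemannian_dist_edist:
  assumes "x \<in> points S" "y \<in> points S"
  shows "ennreal (riemannian_dist S h x y) = edist x y"
  using edist_finite[OF assms] by (simp add: riemannian_dist_def edist_def)

lemma riemannian_dist_metric: "Metric_space (points S) (riemannian_dist S h)"
proof
  let ?d = "riemannian_dist S h"
  show nn: "0 \<le> ?d x y" for x y by (simp add: riemannian_dist_def)
  show "?d x y = ?d y x" for x y
    using edist_sym[of x y] by (simp add: riemannian_dist_def edist_def)
  show "?d x y = 0 \<longleftrightarrow> x = y" if "x \<in> points S" "y \<in> points S" for x y
    using edist_pos[OF that] edist_refl[OF that(1)] riemannian_dist_edist[OF that] nn[of x y]
    by (metis ennreal_0 ennreal_eq_0_iff less_irrefl order_antisym)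
  show "?d x z \<le> ?d x y + ?d y z" if "x \<in> points S" "y \<in> points S" "z \<in> points S" for x y z
    using edist_triangle[of x z y] that nn
    by (simp flip: riemannian_dist_edist ennreal_plus)
qed

text \<open>A Cauchy sequence is bounded, so \<open>F\<close> is bounded on it, so it stays in a compact set and has a
cluster point, to which it converges. The cluster point is taken in the topology of the surface; small
neighbourhoods there have small diameter.\<close>
theorem complete_of_proper_Lipschitz:
  fixes F :: "'a \<Rightarrow> real"
  assumes F: "continuous_map (surf_top S) euclidean F"
    and dF: "\<And>q. q \<in> points S \<Longrightarrow> \<exists>L. ((F \<circ> chart_inv (chart_at S q)) has_derivative L) (at (snd (chart_at S q) q))
       \<and> (\<forall>u. \<bar>L u\<bar> \<le> sqrt (h (chart_at S q) (snd (chart_at S q) q) u u))"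
    and proper: "\<And>R. compactin (surf_top S) {q \<in> points S. F q \<le> R}"
  shows "complete_riemannian_metric S h"
proof -
  let ?d = "riemannian_dist S h"
  interpret Metric_space "points S" ?d by (rule riemannian_dist_metric)
  have Lip: "\<bar>F y - F x\<bar> \<le> ?d x y" if "x \<in> points S" "y \<in> points S" for x y
  proof -
    have "ennreal \<bar>F y - F x\<bar> \<le> ennreal (?d x y)"
      using Lipschitz_edist[OF F dF, of y x] riemannian_dist_edist[OF that] by simp
    then show ?thesis by simp
  qed
  have "mcomplete"
    unfolding mcomplete_def
  proof (intro allI impI)
    fix \<sigma> assume C: "MCauchy \<sigma>"
    then have ran: "\<sigma> n \<in> points S" for n by (auto simp: MCauchy_def)
    have C': "\<exists>N. \<forall>n n'. N \<le> n \<longrightarrow> N \<le> n' \<longrightarrow> ?d (\<sigma> n) (\<sigma> n') < e" if "e > 0" for e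
      using C that by (simp add: MCauchy_def)
    obtain N where N: "\<And>n n'. N \<le> n \<Longrightarrow> N \<le> n' \<Longrightarrow> ?d (\<sigma> n) (\<sigma> n') < 1" using C'[of 1] by auto
    let ?K = "{q \<in> points S. F q \<le> F (\<sigma> N) + 1}"
    have inK: "\<sigma> n \<in> ?K" if "n \<ge> N" for n
      using Lip[OF ran ran, of n N] N[OF order_refl that] ran[of n] by (auto simp: commute)
    have "\<exists>q\<in>?K. \<forall>U. openin (surf_top S) U \<and> q \<in> U \<longrightarrow> (\<exists>\<^sub>F n in sequentially. \<sigma> n \<in> U)"
    proof (rule ccontr)
      assume "\<not> ?thesis"
      then have "\<forall>q\<in>?K. \<exists>U. openin (surf_top S) U \<and> q \<in> U \<and> (\<forall>\<^sub>F n in sequentially. \<sigma> n \<notin> U)"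
        by (simp add: frequently_def)
      then obtain U where U: "\<And>q. q \<in> ?K \<Longrightarrow> openin (surf_top S) (U q) \<and> q \<in> U q \<and> (\<forall>\<^sub>F n in sequentially. \<sigma> n \<notin> U q)"
        by metis
      have cov: "?K \<subseteq> \<Union>(U ` ?K)" using U by blast
      have op: "openin (surf_top S) V" if "V \<in> U ` ?K" for V using that U by blast
      obtain \<F> where \<F>: "finite \<F>" "\<F> \<subseteq> U ` ?K" "?K \<subseteq> \<Union>\<F>"
        using compactinD[OF proper op cov] by blast
      have "\<forall>\<^sub>F n in sequentially. \<forall>V\<in>\<F>. \<sigma> n \<notin> V"
        using \<F>(1,2) U by (intro eventually_ball_finite) auto
      moreover have "\<forall>\<^sub>F n in sequentially. \<sigma> n \<in> ?K" using inK by (auto simp: eventually_sequentially)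
      ultimately have "\<forall>\<^sub>F n in sequentially. False"
        by eventually_elim (use \<F>(3) in blast)
      then show False by simp
    qed
    then obtain q where q: "q \<in> points S" "\<And>U. openin (surf_top S) U \<Longrightarrow> q \<in> U \<Longrightarrow> (\<exists>\<^sub>F n in sequentially. \<sigma> n \<in> U)"
      by blast
    have "limitin mtopology \<sigma> q sequentially"
      unfolding limitin_metric
    proof (intro conjI allI impI)
      fix e :: real assume e: "e > 0"
      obtain M where M: "\<And>n n'. M \<le> n \<Longrightarrow> M \<le> n' \<Longrightarrow> ?d (\<sigma> n) (\<sigma> n') < e / 2" using C'[of "e / 2"] e by auto
      obtain U where U: "openin (surf_top S) U" "q \<in> U" "\<And>y. y \<in> U \<Longrightarrow> edist q y < ennreal (e / 2)"
        using edist_small_nbhd[OF q(1), of "e / 2"] e by auto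
      have "\<exists>\<^sub>F n in sequentially. \<sigma> n \<in> U \<and> n \<ge> M"
        using q(2)[OF U(1,2)] eventually_ge_at_top[of M] by (rule frequently_eventually_frequently)
      then obtain m where m: "\<sigma> m \<in> U" "m \<ge> M" using frequently_ex by blast
      have "ennreal (?d q (\<sigma> m)) < ennreal (e / 2)" using U(3)[OF m(1)] riemannian_dist_edist[OF q(1) ran] by simp
      then have dm: "?d q (\<sigma> m) < e / 2" by (simp add: ennreal_less_iff)
      show "\<forall>\<^sub>F n in sequentially. \<sigma> n \<in> points S \<and> ?d (\<sigma> n) q < e"
        unfolding eventually_sequentially
      proof (intro exI[of _ M] allI impI conjI ran)
        fix n assume "n \<ge> M"
        then have "?d (\<sigma> n) (\<sigma> m) < e / 2" using M m by simp
        then show "?d (\<sigma> n) q < e"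
          using triangle[OF ran ran q(1), of n m] dm commute[of q "\<sigma> m"] by simp
      qed
    qed (rule q(1))
    then show "\<exists>x. limitin mtopology \<sigma> x sequentially" by blast
  qed
  then show ?thesis using hm by (simp add: complete_riemannian_metric_def)
qed

end

section \<open>Smooth conformal densities of compact support\<close>

lemma C_k_SucI:
  "(\<And>z. z \<in> A \<Longrightarrow> (f has_derivative (\<lambda>h. Re h * fx z + Im h * fy z)) (at z)) \<Longrightarrow>
   C_k_on k fx A \<Longrightarrow> C_k_on k fy A \<Longrightarrow> C_k_on (Suc k) f A"
  by auto

lemma C_k_SucE:
  assumes "C_k_on (Suc k) f A"
  obtains fx fy where "\<And>z. z \<in> A \<Longrightarrow> (f has_derivative (\<lambda>h. Re h * fx z + Im h * fy z)) (at z)"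
    "C_k_on k fx A" "C_k_on k fy A"
  using assms by auto

lemma C_k_subset: "C_k_on k f A \<Longrightarrow> B \<subseteq> A \<Longrightarrow> C_k_on k f B"
proof (induction k arbitrary: f)
  case (Suc k)
  from Suc.prems(1) obtain fx fy where "\<And>z. z \<in> A \<Longrightarrow> (f has_derivative (\<lambda>h. Re h * fx z + Im h * fy z)) (at z)" "C_k_on k fx A" "C_k_on k fy A"
    by (rule C_k_SucE) (rule that)
  then show ?case using Suc by (intro C_k_SucI[of B f fx fy]) auto
qed (auto intro: continuous_on_subset)

lemma C_k_cong:
  assumes "open A" "\<And>z. z \<in> A \<Longrightarrow> f z = g z" "C_k_on k f A"
  shows "C_k_on k g A"
  using assms(2,3)
proof (induction k)
  case 0 then show ?case by (auto intro: continuous_on_eq)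
next
  case (Suc k)
  then obtain fx fy where f: "\<And>z. z \<in> A \<Longrightarrow> (f has_derivative (\<lambda>h. Re h * fx z + Im h * fy z)) (at z)"
    and k: "C_k_on k fx A" "C_k_on k fy A" by auto
  have "(g has_derivative (\<lambda>h. Re h * fx z + Im h * fy z)) (at z)" if "z \<in> A" for z
    using f[OF that] by (rule has_derivative_transform_within_open[OF _ assms(1) that]) (use Suc in auto)
  then show ?case using k by (intro C_k_SucI[of A g fx fy])
qed

lemma C_k_mono: "C_k_on (Suc k) f A \<Longrightarrow> C_k_on k f A"
proof (induction k arbitrary: f)
  case 0
  then show ?case
    by (auto intro!: continuous_at_imp_continuous_on dest: has_derivative_continuous)
next
  case (Suc k)
  from Suc.prems obtain fx fy where "\<And>z. z \<in> A \<Longrightarrow> (f has_derivative (\<lambda>h. Re h * fx z + Im h * fy z)) (at z)"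
    "C_k_on (Suc k) fx A" "C_k_on (Suc k) fy A" by (rule C_k_SucE) (rule that)
  then show ?case using Suc.IH by (intro C_k_SucI[of A f fx fy])
qed

lemma C_k_const: "C_k_on k (\<lambda>_. a) A"
proof (induction k arbitrary: a)
  case (Suc k)
  then show ?case by (intro C_k_SucI[of A _ "\<lambda>_. 0" "\<lambda>_. 0"]) auto
qed simp

lemma C_k_add: "C_k_on k f A \<Longrightarrow> C_k_on k g A \<Longrightarrow> C_k_on k (\<lambda>z. f z + g z) A"
proof (induction k arbitrary: f g)
  case (Suc k)
  from Suc.prems(1) obtain fx fy where f:
    "\<And>z. z \<in> A \<Longrightarrow> (f has_derivative (\<lambda>h. Re h * fx z + Im h * fy z)) (at z)" "C_k_on k fx A" "C_k_on k fy A"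
    by (rule C_k_SucE) (rule that)
  from Suc.prems(2) obtain gx gy where g:
    "\<And>z. z \<in> A \<Longrightarrow> (g has_derivative (\<lambda>h. Re h * gx z + Im h * gy z)) (at z)" "C_k_on k gx A" "C_k_on k gy A"
    by (rule C_k_SucE) (rule that)
  show ?case
    by (rule C_k_SucI[of A _ "\<lambda>z. fx z + gx z" "\<lambda>z. fy z + gy z"])
      (use f g Suc.IH in \<open>auto intro!: has_derivative_eq_rhs[OF has_derivative_add] simp: algebra_simps\<close>)
qed (auto intro: continuous_intros)

lemma C_k_mult: "C_k_on k f A \<Longrightarrow> C_k_on k g A \<Longrightarrow> C_k_on k (\<lambda>z. f z * g z) A"
proof (induction k arbitrary: f g)
  case (Suc k)
  from Suc.prems(1) obtain fx fy where f:
    "\<And>z. z \<in> A \<Longrightarrow> (f has_derivative (\<lambda>h. Re h * fx z + Im h * fy z)) (at z)" "C_k_on k fx A" "C_k_on k fy A"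
    by (rule C_k_SucE) (rule that)
  from Suc.prems(2) obtain gx gy where g:
    "\<And>z. z \<in> A \<Longrightarrow> (g has_derivative (\<lambda>h. Re h * gx z + Im h * gy z)) (at z)" "C_k_on k gx A" "C_k_on k gy A"
    by (rule C_k_SucE) (rule that)
  show ?case
  proof (rule C_k_SucI[of A _ "\<lambda>z. f z * gx z + fx z * g z" "\<lambda>z. f z * gy z + fy z * g z"])
    show "((\<lambda>z. f z * g z) has_derivative (\<lambda>h. Re h * (f z * gx z + fx z * g z) + Im h * (f z * gy z + fy z * g z))) (at z)"
      if "z \<in> A" for z
      using has_derivative_mult[OF f(1)[OF that] g(1)[OF that]]
      by (rule has_derivative_eq_rhs) (simp add: fun_eq_iff algebra_simps)
  qed (intro C_k_add Suc.IH f g C_k_mono[OF Suc.prems(1)] C_k_mono[OF Suc.prems(2)])+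
qed (auto intro: continuous_intros)

lemma C_k_uminus: "C_k_on k f A \<Longrightarrow> C_k_on k (\<lambda>z. - f z) A"
  using C_k_mult[OF C_k_const[of k "-1"], of f A] by simp

lemma C_k_diff: "C_k_on k f A \<Longrightarrow> C_k_on k g A \<Longrightarrow> C_k_on k (\<lambda>z. f z - g z) A"
  using C_k_add[OF _ C_k_uminus, of k f A g] by simp

lemma C_k_sum: "(\<And>i. i \<in> I \<Longrightarrow> C_k_on k (f i) A) \<Longrightarrow> C_k_on k (\<lambda>z. \<Sum>i\<in>I. f i z) A"
  by (induction I rule: infinite_finite_induct) (auto intro: C_k_const C_k_add)

lemma C_k_Un:
  assumes "open A" "open B" "C_k_on k f A" "C_k_on k f B"
  shows "C_k_on k f (A \<union> B)"
  using assms(3,4)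
proof (induction k arbitrary: f)
  case 0
  then show ?case using assms by (auto intro: continuous_on_open_Un)
next
  case (Suc k)
  from Suc.prems(1) obtain fx fy where f: 
    "\<And>z. z \<in> A \<Longrightarrow> (f has_derivative (\<lambda>h. Re h * fx z + Im h * fy z)) (at z)" "C_k_on k fx A" "C_k_on k fy A" by (rule C_k_SucE) (rule that)
  from Suc.prems(2) obtain gx gy where g:
    "\<And>z. z \<in> B \<Longrightarrow> (f has_derivative (\<lambda>h. Re h * gx z + Im h * gy z)) (at z)" "C_k_on k gx B" "C_k_on k gy B"
    by (rule C_k_SucE) (rule that)
  have eq: "fx z = gx z \<and> fy z = gy z" if "z \<in> A" "z \<in> B" for z
    using fun_cong[OF has_derivative_unique[OF f(1) g(1)], OF that, of 1]
      fun_cong[OF has_derivative_unique[OF f(1) g(1)], OF that, of \<i>] by simp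
  define kx where "kx z = (if z \<in> A then fx z else gx z)" for z
  define ky where "ky z = (if z \<in> A then fy z else gy z)" for z
  have "C_k_on k kx A" "C_k_on k ky A"
    by (rule C_k_cong[OF assms(1) _ f(2)], simp add: kx_def, rule C_k_cong[OF assms(1) _ f(3)], simp add: ky_def)
  moreover have "C_k_on k kx B" "C_k_on k ky B"
    by (rule C_k_cong[OF assms(2) _ g(2)], simp add: kx_def eq, rule C_k_cong[OF assms(2) _ g(3)], simp add: ky_def eq)
  ultimately have "C_k_on k kx (A \<union> B)" "C_k_on k ky (A \<union> B)" using Suc.IH by blast+
  moreover have "(f has_derivative (\<lambda>h. Re h * kx z + Im h * ky z)) (at z)" if "z \<in> A \<union> B" for z
    using f(1)[of z] g(1)[of z] that by (auto simp: kx_def ky_def)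
  ultimately show ?case by (intro C_k_SucI[of "A \<union> B" f kx ky])
qed

lemma C_k_Re_Im:
  assumes "open A" "f holomorphic_on A"
  shows "C_k_on k (\<lambda>z. Re (f z)) A \<and> C_k_on k (\<lambda>z. Im (f z)) A"
  using assms(2)
proof (induction k arbitrary: f)
  case 0
  then show ?case by (auto intro!: continuous_intros holomorphic_on_imp_continuous_on)
next
  case (Suc k)
  have d: "(f has_derivative (\<lambda>h. deriv f z * h)) (at z)" if "z \<in> A" for z
    using holomorphic_derivI[OF Suc.prems assms(1) that] by (simp add: has_field_derivative_def)
  have IH: "C_k_on k (\<lambda>z. Re (deriv f z)) A" "C_k_on k (\<lambda>z. Im (deriv f z)) A"
    using Suc.IH[OF holomorphic_deriv[OF Suc.prems assms(1)]] by auto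
  have "((\<lambda>z. Re (f z)) has_derivative (\<lambda>h. Re h * Re (deriv f z) + Im h * - Im (deriv f z))) (at z)" if "z \<in> A" for z
    using has_derivative_Re[OF d[OF that]] by (rule has_derivative_eq_rhs) (simp add: fun_eq_iff algebra_simps)
  moreover have "((\<lambda>z. Im (f z)) has_derivative (\<lambda>h. Re h * Im (deriv f z) + Im h * Re (deriv f z))) (at z)" if "z \<in> A" for z
    using has_derivative_Im[OF d[OF that]] by (rule has_derivative_eq_rhs) (simp add: fun_eq_iff algebra_simps)
  ultimately show ?case
    using IH C_k_uminus[OF IH(2)]
    by (intro conjI C_k_SucI[of A "\<lambda>z. Re (f z)" "\<lambda>z. Re (deriv f z)" "\<lambda>z. - Im (deriv f z)"]
        C_k_SucI[of A "\<lambda>z. Im (f z)" "\<lambda>z. Im (deriv f z)" "\<lambda>z. Re (deriv f z)"])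
qed

lemma C_k_norm_square:
  assumes "open A" "f holomorphic_on A"
  shows "C_k_on k (\<lambda>z. (norm (f z))\<^sup>2) A"
  using C_k_add[OF C_k_mult C_k_mult] C_k_Re_Im[OF assms, of k]
  by (simp add: cmod_power2 power2_eq_square[of "Re _"] power2_eq_square[of "Im _"])

lemma C_k_compose_holomorphic:
  assumes "open A" "\<tau> holomorphic_on A" "\<tau> ` A \<subseteq> B" "C_k_on k f B"
  shows "C_k_on k (\<lambda>z. f (\<tau> z)) A"
  using assms(4)
proof (induction k arbitrary: f)
  case 0
  then show ?case
    using continuous_on_compose2[OF _ holomorphic_on_imp_continuous_on[OF assms(2)] assms(3)] by simp
next
  case (Suc k)
  from Suc.prems obtain fx fy where f: 
    "\<And>z. z \<in> B \<Longrightarrow> (f has_derivative (\<lambda>h. Re h * fx z + Im h * fy z)) (at z)" "C_k_on k fx B" "C_k_on k fy B"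
    by (rule C_k_SucE) (rule that)
  let ?D = "\<lambda>z. deriv \<tau> z"
  have d: "((\<lambda>z. f (\<tau> z)) has_derivative (\<lambda>h. Re h * (fx (\<tau> z) * Re (?D z) + fy (\<tau> z) * Im (?D z))
      + Im h * (fy (\<tau> z) * Re (?D z) - fx (\<tau> z) * Im (?D z)))) (at z)" if z: "z \<in> A" for z
  proof -
    have "(\<tau> has_derivative (\<lambda>h. ?D z * h)) (at z)"
      using holomorphic_derivI[OF assms(2,1) z] by (simp add: has_field_derivative_def)
    moreover have "(f has_derivative (\<lambda>h. Re h * fx (\<tau> z) + Im h * fy (\<tau> z))) (at (\<tau> z))"
      using f(1) z assms(3) by blast
    ultimately have "((\<lambda>z. f (\<tau> z)) has_derivative (\<lambda>h. Re (?D z * h) * fx (\<tau> z) + Im (?D z * h) * fy (\<tau> z))) (at z)"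
      by (rule has_derivative_compose)
    then show ?thesis by (rule has_derivative_eq_rhs) (simp add: fun_eq_iff algebra_simps)
  qed
  have IH: "C_k_on k (\<lambda>z. fx (\<tau> z)) A" "C_k_on k (\<lambda>z. fy (\<tau> z)) A" using Suc.IH f by auto
  have D: "C_k_on k (\<lambda>z. Re (?D z)) A" "C_k_on k (\<lambda>z. Im (?D z)) A"
    using C_k_Re_Im[OF assms(1) holomorphic_deriv[OF assms(2,1)]] by auto
  have "C_k_on k (\<lambda>z. fx (\<tau> z) * Re (?D z) + fy (\<tau> z) * Im (?D z)) A"
     "C_k_on k (\<lambda>z. fy (\<tau> z) * Re (?D z) - fx (\<tau> z) * Im (?D z)) A"
    by (intro C_k_add C_k_diff C_k_mult IH D)+
  with d show ?case by (rule C_k_SucI)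
qed

text \<open>The case \<open>P = 1\<close> is the classical smooth function that vanishes for \<open>s \<le> 0\<close>. The polynomial
factor makes the family closed under differentiation.\<close>
definition flat :: "real poly \<Rightarrow> real \<Rightarrow> real" where
  "flat P s = (if s > 0 then poly P (1 / s) * exp (- (1 / s)) else 0)"

lemma poly_times_exp_tendsto_0: "((\<lambda>t. poly R t * exp (- t)) \<longlongrightarrow> (0::real)) at_top"
proof -
  have "((\<lambda>t. \<Sum>i\<le>degree R. Polynomial.coeff R i * (t ^ i / exp t)) \<longlongrightarrow> (\<Sum>i\<le>degree R. Polynomial.coeff R i * 0)) at_top"
    by (intro tendsto_sum tendsto_mult tendsto_const tendsto_power_div_exp_0)
  then show ?thesis
    by (simp add: poly_altdef sum_divide_distrib exp_minus field_simps)
qed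

lemma flat_deriv:
  "(flat P has_field_derivative flat ([:0, 0, 1:] * (P - pderiv P)) s) (at s)"
proof -
  let ?Q = "[:0, 0, 1:] * (P - pderiv P)"
  consider "s < 0" | "s = 0" | "s > 0" by linarith
  then show ?thesis
  proof cases
    case 1
    have "((\<lambda>s::real. 0) has_field_derivative flat ?Q s) (at s)" using 1 by (simp add: flat_def)
    then show ?thesis
      by (rule has_field_derivative_transform_within_open[of _ _ _ "{..<0}"]) (use 1 in \<open>auto simp: flat_def\<close>)
  next
    case 3
    have "((\<lambda>s. poly P (1 / s) * exp (- (1 / s))) has_field_derivative flat ?Q s) (at s)"
      using 3 by (auto intro!: derivative_eq_intros DERIV_chain2[OF poly_DERIV]
        simp: flat_def field_simps power2_eq_square)
    then show ?thesis
      by (rule has_field_derivative_transform_within_open[of _ _ _ "{0<..}"]) (use 3 in \<open>auto simp: flat_def\<close>)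
  next
    case 2
    have r: "((\<lambda>h. flat P h / h) \<longlongrightarrow> 0) (at_right 0)"
    proof -
      have "((\<lambda>h::real. poly ([:0, 1:] * P) (inverse h) * exp (- inverse h)) \<longlongrightarrow> 0) (at_right 0)"
        by (rule filterlim_compose[OF poly_times_exp_tendsto_0 filterlim_inverse_at_top_right])
      then show ?thesis
        by (rule tendsto_cong[THEN iffD1, rotated])
           (auto simp: eventually_at_filter flat_def field_simps)
    qed
    have l: "((\<lambda>h. flat P h / h) \<longlongrightarrow> 0) (at_left 0)"
      by (rule tendsto_eventually) (auto simp: eventually_at_filter flat_def)
    show ?thesis using filterlim_split_at[OF l r] 2 by (simp add: DERIV_def flat_def)
  qed
qed

text \<open>Since the derivative of \<open>flat P\<close> is again of the form \<open>flat Q\<close>, induction on \<open>k\<close> for all \<open>P\<close>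
simultaneously suffices.\<close>
lemma C_k_flat: "C_k_on k g A \<Longrightarrow> C_k_on k (\<lambda>z. flat P (g z)) A"
proof (induction k arbitrary: P)
  case 0
  have "continuous_on UNIV (flat P)"
    using flat_deriv DERIV_isCont continuous_at_imp_continuous_on by blast
  then show ?case using 0 by (auto intro: continuous_on_compose2[where g = "flat P"])
next
  case (Suc k)
  from Suc.prems obtain gx gy where g: 
    "\<And>z. z \<in> A \<Longrightarrow> (g has_derivative (\<lambda>h. Re h * gx z + Im h * gy z)) (at z)" "C_k_on k gx A" "C_k_on k gy A"
    by (rule C_k_SucE) (rule that)
  let ?Q = "[:0, 0, 1:] * (P - pderiv P)"
  have d: "((\<lambda>z. flat P (g z)) has_derivative (\<lambda>h. Re h * (flat ?Q (g z) * gx z) + Im h * (flat ?Q (g z) * gy z))) (at z)"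
    if z: "z \<in> A" for z
  proof -
    have "((\<lambda>z. flat P (g z)) has_derivative (\<lambda>h. flat ?Q (g z) * (Re h * gx z + Im h * gy z))) (at z)"
      using has_derivative_compose[OF g(1)[OF z] flat_deriv[THEN has_field_derivative_imp_has_derivative]] .
    then show ?thesis by (rule has_derivative_eq_rhs) (simp add: fun_eq_iff algebra_simps)
  qed
  have "C_k_on k (\<lambda>z. flat ?Q (g z)) A" using Suc.IH C_k_mono[OF Suc.prems] by blast
  then have "C_k_on k (\<lambda>z. flat ?Q (g z) * gx z) A" "C_k_on k (\<lambda>z. flat ?Q (g z) * gy z) A"
    using g by (auto intro: C_k_mult)
  with d show ?case by (rule C_k_SucI)
qed

definition bump :: "complex \<Rightarrow> real \<Rightarrow> complex \<Rightarrow> real" where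
  "bump z0 r z = flat 1 (r\<^sup>2 - (norm (z - z0))\<^sup>2)"

lemma bump_C_k: "C_k_on k (bump z0 r) A"
proof -
  have "C_k_on k (\<lambda>z. (norm (z - z0))\<^sup>2) UNIV"
    by (rule C_k_norm_square) (auto intro!: holomorphic_intros)
  then have "C_k_on k (\<lambda>z. flat 1 (r\<^sup>2 - (norm (z - z0))\<^sup>2)) UNIV"
    by (intro C_k_flat C_k_diff C_k_const)
  then show ?thesis unfolding bump_def[abs_def] by (rule C_k_subset) simp
qed

lemma bump_nonneg: "bump z0 r z \<ge> 0"
  by (simp add: bump_def flat_def)

lemma bump_pos: "z \<in> ball z0 r \<Longrightarrow> bump z0 r z > 0"
  by (auto simp: bump_def flat_def dist_norm norm_minus_commute intro!: power_strict_mono)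

lemma bump_zero: "r > 0 \<Longrightarrow> z \<notin> ball z0 r \<Longrightarrow> bump z0 r z = 0"
  by (auto simp: bump_def flat_def dist_norm norm_minus_commute not_less intro!: power_mono)

lemma inner_mult_left_complex: "(w * u) \<bullet> (w * v) = (norm w)\<^sup>2 * (u \<bullet> v)" for u v w :: complex
  unfolding cmod_power2 by (simp add: inner_complex_def algebra_simps power2_eq_square)

context riemann
begin

text \<open>The coefficient of a tensor \<open>\<rho> |dz|\<^sup>2\<close>, with its transformation law.\<close>
definition conformal_density :: "('a chart \<Rightarrow> complex \<Rightarrow> real) \<Rightarrow> bool" where
  "conformal_density \<rho> \<longleftrightarrow> (\<forall>c\<in>charts S. smooth_on (\<rho> c) (snd c ` fst c)) \<and>
     (\<forall>c\<in>charts S. \<forall>d\<in>charts S. \<forall>q\<in>fst c \<inter> fst d.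
        \<rho> c (snd c q) = \<rho> d (snd d q) * (norm (deriv (transition c d) (snd c q)))\<^sup>2)"

lemma conformal_density_tensor:
  assumes "conformal_density \<rho>"
  shows "sym_tensor S (\<lambda>c z u v. \<rho> c z * (u \<bullet> v))"
  unfolding sym_tensor_def
proof (intro conjI ballI allI)
  fix c z assume "c \<in> charts S" 
  show "bilinear (\<lambda>u v. \<rho> c z * (u \<bullet> v))"
    by (auto simp: bilinear_def algebra_simps inner_add_left inner_add_right intro!: linearI)
  show "\<rho> c z * (u \<bullet> v) = \<rho> c z * (v \<bullet> u)" for u v by (simp add: inner_commute)
next
  fix c u v assume "c \<in> charts S"
  then have "C_k_on k (\<rho> c) (snd c ` fst c)" for k
    using assms by (simp add: conformal_density_def smooth_on_def)
  then show "smooth_on (\<lambda>z. \<rho> c z * (u \<bullet> v)) (snd c ` fst c)"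
    unfolding smooth_on_def by (intro allI C_k_mult C_k_const)
next
  fix c d z u v assume cd: "c \<in> charts S" "d \<in> charts S" and "z \<in> snd c ` (fst c \<inter> fst d)"
  then obtain q where q: "q \<in> fst c \<inter> fst d" "z = snd c q" by blast
  have "\<rho> c (snd c q) = \<rho> d (snd d q) * (norm (deriv (transition c d) (snd c q)))\<^sup>2"
    using assms cd q(1) unfolding conformal_density_def by blast
  moreover have "transition c d (snd c q) = snd d q" using q by (intro transition_coord cd) auto
  ultimately show "\<rho> c z * (u \<bullet> v) = \<rho> d (transition c d z) * ((deriv (transition c d) z * u) \<bullet> (deriv (transition c d) z * v))"
    by (simp only: q(2) inner_mult_left_complex mult.assoc)
qed

lemma conformal_density_sum:
  assumes "\<And>i. i \<in> I \<Longrightarrow> conformal_density (\<rho> i)"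
  shows "conformal_density (\<lambda>c z. \<Sum>i\<in>I. \<rho> i c z)"
  unfolding conformal_density_def smooth_on_def
proof (intro conjI ballI allI)
  fix c k assume "c \<in> charts S"
  then show "C_k_on k (\<lambda>z. \<Sum>i\<in>I. \<rho> i c z) (snd c ` fst c)"
    using assms unfolding conformal_density_def smooth_on_def by (intro C_k_sum) blast
next
  fix c d q assume "c \<in> charts S" "d \<in> charts S" "q \<in> fst c \<inter> fst d"
  then have "\<rho> i c (snd c q) = \<rho> i d (snd d q) * (norm (deriv (transition c d) (snd c q)))\<^sup>2" if "i \<in> I" for i
    using assms[OF that] unfolding conformal_density_def by blast
  then show "(\<Sum>i\<in>I. \<rho> i c (snd c q)) = (\<Sum>i\<in>I. \<rho> i d (snd d q)) * (norm (deriv (transition c d) (snd c q)))\<^sup>2"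
    unfolding sum_distrib_right by (rule sum.cong[OF refl])
qed

lemma transition_deriv_compose:
  assumes "c \<in> charts S" "d \<in> charts S" "e \<in> charts S" "q \<in> fst c" "q \<in> fst d" "q \<in> fst e"
  shows "deriv (transition c e) (snd c q) = deriv (transition d e) (snd d q) * deriv (transition c d) (snd c q)"
proof -
  let ?z = "snd c q"
  have "((snd e \<circ> chart_inv d) has_field_derivative deriv (transition d e) (snd d q)) (at ((snd d \<circ> chart_inv c) ?z))"
    using transition_deriv[OF assms(2,3,5,6)] assms by simp
  from DERIV_chain[OF this transition_deriv[OF assms(1,2,4,5)]]
  have "((snd e \<circ> chart_inv c) has_field_derivative deriv (transition d e) (snd d q) * deriv (transition c d) ?z) (at ?z)"
    by (rule has_field_derivative_transform_within_open[OF _ overlap_open[OF assms(1,2)]])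
       (use assms in auto)
  then show ?thesis unfolding transition_def by (rule DERIV_imp_deriv)
qed

text \<open>The tensor that is a bump times \<open>|dz|\<^sup>2\<close> in the chart \<open>c\<close>, transported to the other charts. In a
chart \<open>d\<close> it is smooth on the overlap with \<open>c\<close> and zero off the closed disc, and these two open sets
cover \<open>d\<close>.\<close>
lemma bump_density:
  assumes c: "c \<in> charts S" and r: "r > 0" "cball z0 r \<subseteq> snd c ` fst c"
  defines "\<rho> \<equiv> \<lambda>d z. if chart_inv d z \<in> fst c then bump z0 r (snd c (chart_inv d z)) * (norm (deriv (transition d c) z))\<^sup>2 else 0"
  shows "conformal_density \<rho>"
    "\<And>d q. d \<in> charts S \<Longrightarrow> q \<in> fst d \<Longrightarrow> \<rho> d (snd d q) \<ge> 0"
    "\<And>d q. d \<in> charts S \<Longrightarrow> q \<in> fst d \<Longrightarrow> q \<in> chart_inv c ` ball z0 r \<Longrightarrow> \<rho> d (snd d q) > 0"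
    "\<And>d q. d \<in> charts S \<Longrightarrow> q \<in> fst d \<Longrightarrow> q \<notin> chart_inv c ` cball z0 r \<Longrightarrow> \<rho> d (snd d q) = 0"
proof -
  have val: "\<rho> d (snd d q) = (if q \<in> fst c then bump z0 r (snd c q) * (norm (deriv (transition d c) (snd d q)))\<^sup>2 else 0)"
    if "d \<in> charts S" "q \<in> fst d" for d q using that by (simp add: \<rho>_def)
  show "\<rho> d (snd d q) \<ge> 0" if "d \<in> charts S" "q \<in> fst d" for d q
    using that by (simp add: val bump_nonneg)
  show "\<rho> d (snd d q) > 0" if d: "d \<in> charts S" "q \<in> fst d" and q: "q \<in> chart_inv c ` ball z0 r" for d q
  proof -
    obtain z where z: "z \<in> ball z0 r" "q = chart_inv c z" using q by blast
    then have "z \<in> snd c ` fst c" using r ball_subset_cball by blast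
    then have "q \<in> fst c" "snd c q = z" using z by simp_all
    then show ?thesis using val[OF d] z bump_pos transition_deriv_nz[OF d(1) c d(2)] by simp
  qed
  show "\<rho> d (snd d q) = 0" if d: "d \<in> charts S" "q \<in> fst d" and q: "q \<notin> chart_inv c ` cball z0 r" for d q
  proof (cases "q \<in> fst c")
    case True
    have "snd c q \<notin> cball z0 r" using q inv_coord[OF c True] by (metis imageI)
    then have "snd c q \<notin> ball z0 r" using ball_subset_cball by blast
    then show ?thesis using val[OF d] bump_zero[OF r(1)] by simp
  qed (simp add: val[OF d])
  note zero = this
  show "conformal_density \<rho>"
    unfolding conformal_density_def
  proof (intro conjI ballI)
    fix d assume d: "d \<in> charts S"
    let ?A = "snd d ` (fst d \<inter> fst c)" and ?C = "chart_inv c ` cball z0 r"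
    let ?B = "snd d ` (fst d - ?C)"
    have A: "open ?A" by (rule overlap_open[OF d c])
    have "openin (surf_top S) (fst d - ?C)"
      using chart_open[OF d] compact_chart_cball[OF c r(2)] by blast
    then have B: "open ?B" by (rule coord_image_open[OF d]) auto
    have "?C \<subseteq> fst c" using r(2) inv_in by (metis (no_types, lifting) image_subset_iff subsetD)
    then have un: "?A \<union> ?B = snd d ` fst d" by blast
    show "smooth_on (\<rho> d) (snd d ` fst d)"
      unfolding smooth_on_def un[symmetric]
    proof (intro allI C_k_Un A B)
      fix k
      have "C_k_on k (\<lambda>z. bump z0 r (transition d c z) * (norm (deriv (transition d c) z))\<^sup>2) ?A"
        by (intro C_k_mult C_k_norm_square A holomorphic_deriv transition_holo d c
             C_k_compose_holomorphic[OF A transition_holo[OF d c] subset_refl] bump_C_k)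
      then show "C_k_on k (\<rho> d) ?A"
        by (rule C_k_cong[OF A, rotated]) (use d in \<open>auto simp: \<rho>_def transition_def\<close>)
      show "C_k_on k (\<rho> d) ?B"
        by (rule C_k_cong[OF B _ C_k_const[of k 0]]) (use zero[OF d] in auto)
    qed
  next
    fix d e q assume d: "d \<in> charts S" and e: "e \<in> charts S" and q: "q \<in> fst d \<inter> fst e"
    then show "\<rho> d (snd d q) = \<rho> e (snd e q) * (norm (deriv (transition d e) (snd d q)))\<^sup>2"
      using transition_deriv_compose[OF d e c, of q]
      by (cases "q \<in> fst c") (auto simp: val norm_mult power_mult_distrib)
  qed
qed

text \<open>A finite sum of bump tensors over coordinate discs that cover \<open>C\<close>.\<close>
lemma compact_positive_density:
  assumes C: "compactin (surf_top S) C"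
  obtains \<rho> K where "conformal_density \<rho>" "compactin (surf_top S) K"
    "\<And>d q. d \<in> charts S \<Longrightarrow> q \<in> fst d \<Longrightarrow> \<rho> d (snd d q) \<ge> 0"
    "\<And>d q. d \<in> charts S \<Longrightarrow> q \<in> fst d \<Longrightarrow> q \<in> C \<Longrightarrow> \<rho> d (snd d q) > 0"
    "\<And>d q. d \<in> charts S \<Longrightarrow> q \<in> fst d \<Longrightarrow> q \<notin> K \<Longrightarrow> \<rho> d (snd d q) = 0"
proof -
  have Cp: "C \<subseteq> points S" using C by (simp add: compactin_subset_topspace)
  have "\<exists>r>0. cball (snd (chart_at S q) q) r \<subseteq> snd (chart_at S q) ` fst (chart_at S q)" if "q \<in> C" for q
    using coord_open[OF chart_at(1)] chart_at(2) that Cp by (metis image_eqI open_contains_cball subsetD)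
  then obtain r where r: "\<And>q. q \<in> C \<Longrightarrow> r q > 0"
    "\<And>q. q \<in> C \<Longrightarrow> cball (snd (chart_at S q) q) (r q) \<subseteq> snd (chart_at S q) ` fst (chart_at S q)"
    by metis
  define N where "N q = chart_inv (chart_at S q) ` ball (snd (chart_at S q) q) (r q)" for q
  have ca: "chart_at S q \<in> charts S" "q \<in> fst (chart_at S q)" if "q \<in> C" for q
    using chart_at Cp that by auto
  have op: "openin (surf_top S) V" if V: "V \<in> N ` C" for V
  proof -
    obtain q where q: "q \<in> C" "V = N q" using V by blast
    have "ball (snd (chart_at S q) q) (r q) \<subseteq> snd (chart_at S q) ` fst (chart_at S q)"
      using r(2)[OF q(1)] ball_subset_cball by (rule order_trans[rotated])
    then show ?thesis unfolding q(2) N_def by (rule inv_image_open[OF ca(1)[OF q(1)] open_ball])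
  qed
  have "q \<in> N q" if "q \<in> C" for q
    unfolding N_def using r(1)[OF that] inv_coord[OF ca[OF that]]
    by (intro image_eqI[of _ _ "snd (chart_at S q) q"]) auto
  then have cov: "C \<subseteq> \<Union>(N ` C)" by blast
  obtain \<F> where F: "finite \<F>" "\<F> \<subseteq> N ` C" "C \<subseteq> \<Union>\<F>" using compactinD[OF C op cov] by blast
  obtain Q where Q: "finite Q" "Q \<subseteq> C" "\<F> = N ` Q" using finite_subset_image[OF F(1,2)] by blast
  define \<mu> where "\<mu> p d z = (if chart_inv d z \<in> fst (chart_at S p)
     then bump (snd (chart_at S p) p) (r p) (snd (chart_at S p) (chart_inv d z)) * (norm (deriv (transition d (chart_at S p)) z))\<^sup>2 else 0)" for p d z
  have pQ: "p \<in> C" if "p \<in> Q" for p using Q that by blast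
  note bd = bump_density[OF ca(1)[OF pQ] r(1)[OF pQ] r(2)[OF pQ], folded \<mu>_def]
  define K where "K = (\<Union>p\<in>Q. chart_inv (chart_at S p) ` cball (snd (chart_at S p) p) (r p))"
  show ?thesis
  proof (rule that)
    show "conformal_density (\<lambda>d z. \<Sum>p\<in>Q. \<mu> p d z)"
      by (rule conformal_density_sum) (rule bd(1))
    show "compactin (surf_top S) K"
      unfolding K_def using Q compact_chart_cball(1)[OF ca(1)[OF pQ] r(2)[OF pQ]] by (intro compactin_Union) auto
    fix d q assume d: "d \<in> charts S" "q \<in> fst d"
    show "(\<Sum>p\<in>Q. \<mu> p d (snd d q)) \<ge> 0" by (intro sum_nonneg bd(2)[OF _ _ _ d])
    show "(\<Sum>p\<in>Q. \<mu> p d (snd d q)) > 0" if qC: "q \<in> C"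
    proof -
      obtain p where p: "p \<in> Q" "q \<in> N p" using F(3) Q(3) qC by blast
      show ?thesis
        by (rule sum_pos2[OF Q(1) p(1)]) (use bd(3)[OF p(1) p(1) p(1) d] bd(2)[OF _ _ _ d] p(2) in \<open>auto simp: N_def\<close>)
    qed
    show "(\<Sum>p\<in>Q. \<mu> p d (snd d q)) = 0" if "q \<notin> K"
      by (intro sum.neutral ballI bd(4)[OF _ _ _ d]) (use that in \<open>auto simp: K_def\<close>)
  qed
qed

end

section \<open>Punctured Riemann surfaces\<close>

context riemann
begin

lemma hausdorff: "Hausdorff_space (surf_top S)"
  using rs by (simp add: riemann_surface_def)

lemma finite_closed: "finite P \<Longrightarrow> P \<subseteq> points S \<Longrightarrow> closedin (surf_top S) P"
  using hausdorff by (simp add: closedin_Hausdorff_finite)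

lemma openin_minus_finite:
  assumes "finite P" "openin (surf_top S) U"
  shows "openin (surf_top S) (U - P)"
proof -
  have "closedin (surf_top S) (P \<inter> points S)" using assms by (intro finite_closed) auto
  then have "openin (surf_top S) (U - P \<inter> points S)" using assms(2) by (simp add: openin_diff)
  moreover have "U - P \<inter> points S = U - P" using openin_subset[OF assms(2)] by auto
  ultimately show ?thesis by simp
qed

text \<open>Remove one point at a time. A punctured coordinate disc around the point is connected, so it lies on
one side of any separation, and the point can be added to that side.\<close>
lemma connectedin_minus_finite:
  assumes "finite P"
  shows "connectedin (surf_top S) (points S - P)"
  using assms
proof (induction P)
  case empty
  then show ?case using rs by (simp add: riemann_surface_def connectedin_topspace)
next
  case (insert p P)
  let ?X = "surf_top S" and ?Y = "points S - P"
  show ?case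
  proof (cases "p \<in> ?Y")
    case False
    then have "points S - insert p P = ?Y" by auto
    then show ?thesis using insert.IH by simp
  next
    case True
    define c where "c = chart_at S p"
    have c: "c \<in> charts S" "p \<in> fst c" using chart_at True by (auto simp: c_def)
    have "openin ?X (fst c - P)" using openin_minus_finite[OF insert(1) chart_open[OF c(1)]] .
    then have "open (snd c ` (fst c - P))" by (intro coord_image_open[OF c(1)]) auto
    moreover have "snd c p \<in> snd c ` (fst c - P)" using c True by blast
    ultimately obtain r where r: "r > 0" "ball (snd c p) r \<subseteq> snd c ` (fst c - P)"
      by (meson open_contains_ball)
    let ?b = "ball (snd c p) r"
    define B where "B = chart_inv c ` ?b"
    have bD: "?b \<subseteq> snd c ` fst c" using r(2) by blast
    have B: "openin ?X B" unfolding B_def by (rule inv_image_open[OF c(1) open_ball bD])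
    have pB: "p \<in> B" unfolding B_def using r inv_coord[OF c] by (intro image_eqI[of _ _ "snd c p"]) auto
    have BY: "B \<subseteq> ?Y"
    proof
      fix q assume "q \<in> B"
      then obtain z where z: "z \<in> ?b" "q = chart_inv c z" by (auto simp: B_def)
      then obtain q' where q': "q' \<in> fst c - P" "z = snd c q'" using r(2) by blast
      then have "q = q'" using z inv_coord[OF c(1)] by simp
      then show "q \<in> ?Y" using q' chart_sub[OF c(1)] by blast
    qed
    have "B - {p} = chart_inv c ` (?b - {snd c p})"
    proof (intro equalityI subsetI)
      fix q assume "q \<in> B - {p}"
      then obtain z where "z \<in> ?b" "q = chart_inv c z" "q \<noteq> p" by (auto simp: B_def)
      then show "q \<in> chart_inv c ` (?b - {snd c p})" using inv_coord[OF c] by (intro image_eqI[of _ _ z]) auto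
    next
      fix q assume "q \<in> chart_inv c ` (?b - {snd c p})"
      then obtain z where z: "z \<in> ?b" "z \<noteq> snd c p" "q = chart_inv c z" by blast
      then have "snd c q = z" using coord_inv[of z c] bD by blast
      then show "q \<in> B - {p}" using z by (auto simp: B_def)
    qed
    moreover have "connectedin (top_of_set (snd c ` fst c)) (?b - {snd c p})"
      using connected_punctured_ball[of "snd c p" r] bD by (auto simp: connectedin_subtopology)
    ultimately have conB: "connectedin ?X (B - {p})"
      using connectedin_continuous_map_image[OF cont_inv[OF c(1)]] by simp
    have eq: "points S - insert p P = ?Y - {p}" by blast
    show ?thesis
      unfolding connectedin
    proof (intro conjI notI)
      assume "\<exists>E1 E2. openin ?X E1 \<and> openin ?X E2 \<and> points S - insert p P \<subseteq> E1 \<union> E2 \<and>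
         E1 \<inter> E2 \<inter> (points S - insert p P) = {} \<and> E1 \<inter> (points S - insert p P) \<noteq> {} \<and> E2 \<inter> (points S - insert p P) \<noteq> {}"
      then obtain E1 E2 where E: "openin ?X E1" "openin ?X E2" "?Y - {p} \<subseteq> E1 \<union> E2"
         "E1 \<inter> E2 \<inter> (?Y - {p}) = {}" "E1 \<inter> (?Y - {p}) \<noteq> {}" "E2 \<inter> (?Y - {p}) \<noteq> {}"
        unfolding eq by blast
      have *: False if E: "openin ?X E1" "openin ?X E2" "?Y - {p} \<subseteq> E1 \<union> E2"
         "E1 \<inter> E2 \<inter> (?Y - {p}) = {}" "E1 \<inter> (?Y - {p}) \<noteq> {}" "E2 \<inter> (?Y - {p}) \<noteq> {}" and B1: "B - {p} \<subseteq> E1" for E1 E2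
      proof -
        have "openin ?X (E1 \<union> B)" "openin ?X (E2 - {p})"
          using E(1,2) B openin_minus_finite[of "{p}" E2] by auto
        moreover have "?Y \<subseteq> (E1 \<union> B) \<union> (E2 - {p})" using E(3) pB by blast
        moreover have "(E1 \<union> B) \<inter> (E2 - {p}) \<inter> ?Y = {}" using E(4) B1 by blast
        moreover have "(E1 \<union> B) \<inter> ?Y \<noteq> {}" "(E2 - {p}) \<inter> ?Y \<noteq> {}" using E(5,6) by blast+
        ultimately show False using insert.IH unfolding connectedin by blast
      qed
      have sub: "B - {p} \<subseteq> ?Y - {p}" using BY by blast
      have "B - {p} \<subseteq> E1 \<or> B - {p} \<subseteq> E2"
      proof (rule ccontr)
        assume "\<not> ?thesis"
        then have "E2 \<inter> (B - {p}) \<noteq> {}" "E1 \<inter> (B - {p}) \<noteq> {}" using sub E(3) by blast+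
        moreover have "B - {p} \<subseteq> E1 \<union> E2" "E1 \<inter> E2 \<inter> (B - {p}) = {}" using sub E(3,4) by blast+
        ultimately show False using conB E(1,2) unfolding connectedin by blast
      qed
      then show False
      proof
        assume "B - {p} \<subseteq> E1" then show False using *[OF E] by blast
      next
        assume "B - {p} \<subseteq> E2"
        moreover have "?Y - {p} \<subseteq> E2 \<union> E1" "E2 \<inter> E1 \<inter> (?Y - {p}) = {}" using E by blast+
        ultimately show False using *[OF E(2,1) _ _ E(6,5)] by blast
      qed
    qed auto
  qed
qed

lemma points_puncture [simp]: "points (puncture S P) = points S - P"
  by (auto simp: puncture_def)

lemma charts_punctureE:
  assumes "c' \<in> charts (puncture S P)"
  obtains c where "c \<in> charts S" "c' = chart_minus P c"
  using assms by (auto simp: puncture_def)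

lemma chart_inv_minus:
  assumes "c \<in> charts S" "z \<in> snd c ` (fst c - P)"
  shows "chart_inv (chart_minus P c) z = chart_inv c z"
proof -
  obtain q where q: "q \<in> fst c - P" "z = snd c q" using assms by blast
  have "inj_on (snd c) (fst c - P)" using coord_inj[OF assms(1)] by (rule inj_on_subset) auto
  then have "chart_inv (chart_minus P c) z = q" using q by (simp add: chart_inv_def chart_minus_def)
  then show ?thesis using q assms(1) by simp
qed

lemma riemann_puncture:
  assumes fin: "finite P" and ne: "points S - P \<noteq> {}"
  shows "riemann (puncture S P)"
proof
  let ?M = "puncture S P" and ?X = "surf_top S"
  have top: "surf_top ?M = subtopology ?X (points S - P)" by (simp add: puncture_def)
  have op: "openin ?X (fst c - P)" if "c \<in> charts S" for c
    using openin_minus_finite[OF fin chart_open[OF that]] .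
  have sub: "fst c - P \<subseteq> points S - P" if "c \<in> charts S" for c using chart_sub[OF that] by blast
  show "riemann_surface ?M"
    unfolding riemann_surface_def
  proof (intro conjI ballI)
    show "points ?M \<noteq> {}" using ne by simp
    show "connected_space (surf_top ?M)" using connectedin_minus_finite[OF fin] by (simp add: top connectedin_def)
    show "Hausdorff_space (surf_top ?M)" unfolding top using hausdorff by (rule Hausdorff_space_subtopology)
    show "second_countable (surf_top ?M)" unfolding top
      using rs by (intro second_countable_subtopology) (simp add: riemann_surface_def)
    have "(\<Union>c\<in>charts ?M. fst c) = (\<Union>c\<in>charts S. fst c) - P" by (auto simp: puncture_def chart_minus_def)
    also have "\<dots> = points ?M" using rs by (simp add: riemann_surface_def)
    finally show "(\<Union>c\<in>charts ?M. fst c) = points ?M" .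
  next
    fix c' assume "c' \<in> charts ?M"
    then obtain c where c: "c \<in> charts S" "c' = chart_minus P c" by (rule charts_punctureE)
    have "homeomorphic_map (subtopology (subtopology ?X (fst c)) (fst c - P))
        (subtopology (top_of_set (snd c ` fst c)) (snd c ` (fst c - P))) (snd c)"
      by (rule homeomorphic_map_subtopologies[OF coord_homeo[OF c(1)]]) (use chart_sub[OF c(1)] in auto)
    moreover have "subtopology (subtopology ?X (fst c)) (fst c - P) = subtopology (surf_top ?M) (fst c')"
      using sub[OF c(1)] by (simp add: top c(2) chart_minus_def subtopology_subtopology Int_absorb1 inf.absorb2)
    moreover have "subtopology (top_of_set (snd c ` fst c)) (snd c ` (fst c - P)) = top_of_set (snd c' ` fst c')"
      by (simp add: c(2) chart_minus_def subtopology_subtopology inf.absorb2 image_mono)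
    ultimately have "homeomorphic_map (subtopology (surf_top ?M) (fst c')) (top_of_set (snd c' ` fst c')) (snd c')"
      by (simp add: c(2) chart_minus_def)
    moreover have "open (snd c' ` fst c')"
      using coord_image_open[OF c(1) op[OF c(1)]] by (simp add: c(2) chart_minus_def)
    moreover have "openin (surf_top ?M) (fst c')"
      using op[OF c(1)] sub[OF c(1)] unfolding top c(2) chart_minus_def
      by (metis fst_conv inf.absorb2 openin_subtopology_Int2)
    ultimately show "chart_on (surf_top ?M) c'" by (simp add: chart_on_def)
  next
    fix c' d' assume "c' \<in> charts ?M" "d' \<in> charts ?M"
    then obtain c d where c: "c \<in> charts S" "c' = chart_minus P c" and d: "d \<in> charts S" "d' = chart_minus P d"
      by (metis charts_punctureE)
    have "transition c d holomorphic_on snd c' ` (fst c' \<inter> fst d')"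
      by (rule holomorphic_on_subset[OF transition_holo[OF c(1) d(1)]]) (auto simp: c(2) d(2) chart_minus_def)
    moreover have "transition c d z = transition c' d' z" if "z \<in> snd c' ` (fst c' \<inter> fst d')" for z
    proof -
      have "z \<in> snd c ` (fst c - P)" using that by (auto simp: c(2) chart_minus_def)
      then show ?thesis using chart_inv_minus[OF c(1)] by (simp add: transition_def c(2) d(2)) (simp add: chart_minus_def)
    qed
    ultimately show "transition c' d' holomorphic_on snd c' ` (fst c' \<inter> fst d')"
      by (rule holomorphic_transform)
  qed
qed

text \<open>A form \<open>u dF\<close> is holomorphic if \<open>u\<close> and \<open>F\<close> are, by the chain rule. All three forms of the
catenoid pullback have this shape.\<close>
lemma exact_multiple_holomorphic_form:
  assumes F: "\<And>c. c \<in> charts S \<Longrightarrow> (F \<circ> chart_inv c) holomorphic_on snd c ` fst c"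
    and u: "\<And>c. c \<in> charts S \<Longrightarrow> (u \<circ> chart_inv c) holomorphic_on snd c ` fst c"
    and \<eta>: "\<And>c z. c \<in> charts S \<Longrightarrow> z \<in> snd c ` fst c \<Longrightarrow> \<eta> c z = u (chart_inv c z) * deriv (F \<circ> chart_inv c) z"
  shows "holomorphic_form S \<eta>"
  unfolding holomorphic_form_def
proof (intro conjI ballI)
  fix c assume c: "c \<in> charts S"
  have "(\<lambda>z. (u \<circ> chart_inv c) z * deriv (F \<circ> chart_inv c) z) holomorphic_on snd c ` fst c"
    by (intro holomorphic_intros u[OF c] holomorphic_deriv F[OF c] coord_open[OF c])
  then show "\<eta> c holomorphic_on snd c ` fst c"
    by (rule holomorphic_transform) (simp add: \<eta>[OF c])
next
  fix c d z assume c: "c \<in> charts S" and d: "d \<in> charts S" and "z \<in> snd c ` (fst c \<inter> fst d)"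
  then obtain q where q: "q \<in> fst c" "q \<in> fst d" and z: "z = snd c q" by blast
  have dF: "((F \<circ> chart_inv e) has_field_derivative deriv (F \<circ> chart_inv e) (snd e q)) (at (snd e q))"
    if "e \<in> charts S" "q \<in> fst e" for e
    using holomorphic_derivI[OF F[OF that(1)] coord_open[OF that(1)]] that by blast
  have "((F \<circ> chart_inv d) has_field_derivative deriv (F \<circ> chart_inv d) (snd d q)) (at ((snd d \<circ> chart_inv c) z))"
    using dF[OF d q(2)] inv_coord[OF c q(1)] z by simp
  from DERIV_chain[where g = "snd d \<circ> chart_inv c" and x = z and s = UNIV, OF this] transition_deriv[OF c d q]
  have "((F \<circ> chart_inv d \<circ> (snd d \<circ> chart_inv c)) has_field_derivative
      deriv (F \<circ> chart_inv d) (snd d q) * deriv (transition c d) z) (at z)"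
    by (simp add: z)
  then have "((F \<circ> chart_inv c) has_field_derivative deriv (F \<circ> chart_inv d) (snd d q) * deriv (transition c d) z) (at z)"
    by (rule has_field_derivative_transform_within_open[OF _ overlap_open[OF c d]]) (use c d q z in auto)
  then have "deriv (F \<circ> chart_inv c) z = deriv (F \<circ> chart_inv d) (snd d q) * deriv (transition c d) z"
    by (rule DERIV_imp_deriv)
  then show "\<eta> c z = \<eta> d (transition c d z) * deriv (transition c d) z"
    using \<eta>[OF c, of z] \<eta>[OF d, of "snd d q"] q z transition_coord[OF c q(1), of d] inv_coord[OF c q(1)] inv_coord[OF d q(2)]
    by simp
qed

end

section \<open>Maximal maps over the Lorentzian catenoid\<close>

text \<open>The set \<open>P\<close> consists of the zeros and poles of \<open>f\<close>; the hypothesis \<open>ends\<close> says this without a case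
distinction. By \<open>critical\<close>, the critical points of \<open>f\<close> outside \<open>P\<close> stay away from \<open>P\<close>.\<close>
locale catenoid_pullback = riemann S for S :: "'a surface" +
  fixes P :: "'a set" and f :: "'a \<Rightarrow> complex"
  assumes compact: "compact_space (surf_top S)"
    and fin: "finite P" and P: "P \<subseteq> points S"
    and holo: "\<And>c. c \<in> charts S \<Longrightarrow> (f \<circ> chart_inv c) holomorphic_on snd c ` (fst c - P)"
    and nz: "\<And>q. q \<in> points S - P \<Longrightarrow> f q \<noteq> 0"
    and ends: "\<And>p R. p \<in> P \<Longrightarrow> \<exists>U. openin (surf_top S) U \<and> p \<in> U \<and> (\<forall>q\<in>U - P. R < norm (f q) + inverse (norm (f q)))"
    and critical: "\<exists>R. \<forall>c\<in>charts S. \<forall>q\<in>fst c - P. deriv (f \<circ> chart_inv c) (snd c q) = 0 \<longrightarrow> norm (f q) + inverse (norm (f q)) \<le> R"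
    and noncirc: "\<exists>q\<in>points S - P. norm (f q) \<noteq> 1"
begin

abbreviation M where "M \<equiv> puncture S P"

definition dlog :: "'a one_form" where
  "dlog c z = deriv (f \<circ> chart_inv c) z / f (chart_inv c z)"

sublocale M: riemann M
  using riemann_puncture[OF fin] noncirc by blast

lemma holo_M:
  assumes "c \<in> charts M"
  shows "(f \<circ> chart_inv c) holomorphic_on snd c ` fst c"
proof -
  obtain c0 where c: "c0 \<in> charts S" "c = chart_minus P c0" using assms by (rule charts_punctureE)
  have "(f \<circ> chart_inv c0) holomorphic_on snd c ` fst c" using holo[OF c(1)] by (simp add: c(2) chart_minus_def)
  then show ?thesis
    by (rule holomorphic_transform) (use chart_inv_minus[OF c(1)] c(2) in \<open>auto simp: chart_minus_def\<close>)
qed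

lemma f_nz: "q \<in> points M \<Longrightarrow> f q \<noteq> 0"
  using nz by simp

lemma f_inv_nz: "c \<in> charts M \<Longrightarrow> z \<in> snd c ` fst c \<Longrightarrow> f (chart_inv c z) \<noteq> 0"
  by (rule f_nz[OF subsetD[OF M.chart_sub M.inv_in]])

lemma deriv_f:
  "c \<in> charts M \<Longrightarrow> q \<in> fst c \<Longrightarrow>
    ((f \<circ> chart_inv c) has_field_derivative deriv (f \<circ> chart_inv c) (snd c q)) (at (snd c q))"
  by (rule holomorphic_derivI[OF holo_M M.coord_open]) auto

lemma fun_times_dlog:
  assumes c: "c \<in> charts M" and z: "z \<in> snd c ` fst c"
  shows "fun_times_form f dlog c z = deriv (f \<circ> chart_inv c) z"
    "fun_times_form (\<lambda>q. inverse (f q)) dlog c z = inverse ((f (chart_inv c z))\<^sup>2) * deriv (f \<circ> chart_inv c) z"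
proof -
  let ?D = "snd c ` fst c" and ?g = "f \<circ> chart_inv c"
  note h = holo_M[OF c] M.coord_open[OF c]
  have d: "deriv ?g holomorphic_on ?D" using h by (rule holomorphic_deriv)
  have l: "(\<lambda>z. dlog c z) holomorphic_on ?D"
    unfolding dlog_def using d h f_inv_nz[OF c] by (auto intro!: holomorphic_intros simp: o_def)
  have 1: "(\<lambda>z. f (chart_inv c z) * dlog c z) analytic_on {z}"
    using h l z by (intro analytic_on_subset[OF analytic_on_open[THEN iffD2, of ?D]]) (auto intro!: holomorphic_intros simp: o_def)
  have 2: "(\<lambda>z. inverse (f (chart_inv c z)) * dlog c z) analytic_on {z}"
    using h l z f_inv_nz[OF c] by (intro analytic_on_subset[OF analytic_on_open[THEN iffD2, of ?D]]) (auto intro!: holomorphic_intros simp: o_def)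
  show "fun_times_form f dlog c z = deriv ?g z"
    unfolding fun_times_form_def remove_sings_at_analytic[OF 1] using f_inv_nz[OF c z] by (simp add: dlog_def)
  show "fun_times_form (\<lambda>q. inverse (f q)) dlog c z = inverse ((f (chart_inv c z))\<^sup>2) * deriv ?g z"
    unfolding fun_times_form_def remove_sings_at_analytic[OF 2] by (simp add: dlog_def power2_eq_square field_simps)
qed

lemma continuous_f: "continuous_map (surf_top M) euclidean f"
proof (rule M.continuous_map_chartwise)
  fix q assume "q \<in> points M"
  note c = M.chart_at[OF this]
  show "\<exists>c\<in>charts M. q \<in> fst c \<and> isCont (f \<circ> chart_inv c) (snd c q)"
    using c DERIV_isCont[OF deriv_f[OF c]] by blast
qed

lemma continuous_compose_f:
  assumes "continuous_on (- {0}) g"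
  shows "continuous_map (surf_top M) euclidean (\<lambda>q. g (f q))"
proof -
  have "continuous_map (surf_top M) (top_of_set (- {0})) f"
    using continuous_f f_nz by (auto simp: continuous_map_in_subtopology)
  then have "continuous_map (surf_top M) euclidean (g \<circ> f)"
    using assms by (intro continuous_map_compose[of _ "top_of_set (- {0})"]) auto
  then show ?thesis by (simp add: o_def)
qed

lemma form_integral_dlog:
  assumes "pw_C1_path M 0 1 \<gamma>"
  shows "Re (form_integral M dlog \<gamma>) = ln (norm (f (\<gamma> 1))) - ln (norm (f (\<gamma> 0)))"
proof (rule M.form_integral_log_derivative[OF assms continuous_f f_nz])
  fix c q assume c: "c \<in> charts M" "q \<in> fst c"
  have "f q \<noteq> 0" using f_nz M.chart_sub[OF c(1)] c(2) by blast
  then have "f q * dlog c (snd c q) = deriv (f \<circ> chart_inv c) (snd c q)"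
    using c by (simp add: dlog_def)
  then show "((f \<circ> chart_inv c) has_field_derivative f q * dlog c (snd c q)) (at (snd c q))"
    using deriv_f[OF c] by (simp only:)
qed

text \<open>The forms \<open>f dlog = df\<close> and \<open>dlog / f = d(-1/f)\<close> are exact, and the real part of \<open>dlog\<close> is
\<open>d ln |f|\<close>. So each period vanishes separately.\<close>
lemma weierstrass: "weierstrass_data M f dlog"
  unfolding weierstrass_data_def
proof (intro conjI allI impI)
  show "riemann_surface M" by (rule M.rs)
  show "meromorphic_fun M f"
    unfolding meromorphic_fun_def
  proof
    fix c assume c: "c \<in> charts M"
    have "(f \<circ> chart_inv c) analytic_on snd c ` fst c"
      using holo_M[OF c] M.coord_open[OF c] by (simp add: analytic_on_open)
    then show "(f \<circ> chart_inv c) nicely_meromorphic_on snd c ` fst c"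
      by (rule analytic_on_imp_nicely_meromorphic_on)
  qed
  show "\<exists>q\<in>points M. f q \<noteq> 0" using noncirc f_nz by auto
  show "\<exists>q\<in>points M. norm (f q) \<noteq> 1" using noncirc by simp
  have inv: "((\<lambda>q. inverse (f q)) \<circ> chart_inv c) holomorphic_on snd c ` fst c" if "c \<in> charts M" for c
    using holo_M[OF that] f_inv_nz[OF that] by (auto intro!: holomorphic_intros simp: o_def)
  have inv2: "((\<lambda>q. inverse ((f q)\<^sup>2)) \<circ> chart_inv c) holomorphic_on snd c ` fst c" if "c \<in> charts M" for c
    using holo_M[OF that] f_inv_nz[OF that] by (auto intro!: holomorphic_intros simp: o_def)
  have one: "((\<lambda>_. 1) \<circ> chart_inv c) holomorphic_on snd c ` fst c" for c :: "'a chart" by (simp add: o_def)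
  show "holomorphic_form M dlog"
    by (rule M.exact_multiple_holomorphic_form[OF holo_M inv]) (auto simp: dlog_def divide_inverse)
  show "holomorphic_form M (fun_times_form f dlog)"
    by (rule M.exact_multiple_holomorphic_form[OF holo_M one]) (auto simp: fun_times_dlog)
  show "holomorphic_form M (fun_times_form (\<lambda>q. inverse (f q)) dlog)"
    by (rule M.exact_multiple_holomorphic_form[OF holo_M inv2]) (auto simp: fun_times_dlog)
  fix x \<gamma> assume "path_from_to M x x \<gamma>"
  then have \<gamma>: "pw_C1_path M 0 1 \<gamma>" "\<gamma> 0 = x" "\<gamma> 1 = x" by (auto simp: path_from_to_def)
  show "Re (form_integral M dlog \<gamma>) = 0"
    using form_integral_dlog[OF \<gamma>(1)] \<gamma> by simp
  have "form_integral M (fun_times_form f dlog) \<gamma> = f (\<gamma> 1) - f (\<gamma> 0)"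
    by (rule M.form_integral_primitive[OF \<gamma>(1) continuous_f]) (use deriv_f fun_times_dlog in auto)
  moreover have "form_integral M (fun_times_form (\<lambda>q. inverse (f q)) dlog) \<gamma> = - inverse (f (\<gamma> 1)) - - inverse (f (\<gamma> 0))"
  proof (rule M.form_integral_primitive[OF \<gamma>(1)])
    show "continuous_map (surf_top M) euclidean (\<lambda>q. - inverse (f q))"
      by (rule continuous_compose_f) (auto intro!: continuous_intros)
    fix c q assume c: "c \<in> charts M" "q \<in> fst c"
    then have "f (chart_inv c (snd c q)) \<noteq> 0" by (intro f_inv_nz) auto
    then show "((\<lambda>q. - inverse (f q)) \<circ> chart_inv c has_field_derivative fun_times_form (\<lambda>q. inverse (f q)) dlog c (snd c q)) (at (snd c q))"
      using deriv_f[OF c] fun_times_dlog(2)[OF c(1), of "snd c q"] c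
      by (auto simp: o_def power2_eq_square intro!: derivative_eq_intros)
  qed
  ultimately show "form_integral M (fun_times_form f dlog) \<gamma> +
      cnj (form_integral M (fun_times_form (\<lambda>q. inverse (f q)) dlog) \<gamma>) = 0"
    using \<gamma> by simp
qed

text \<open>The composition of the Lorentzian catenoid with \<open>f\<close>.\<close>
lemma maximal:
  assumes z0: "z0 \<in> points M"
  shows "\<exists>X. maximal_map M f dlog z0 X"
proof -
  define A where "A w = (- inverse w + w) / 2" for w :: complex
  define B where "B w = \<i> / 2 * (- inverse w - w)" for w :: complex
  define X where "X q = (vector [Re (A (f q) - A (f z0)), Re (B (f q) - B (f z0)), ln (norm (f q)) - ln (norm (f z0))] :: real ^ 3)" for q
  let ?g = "fun_times_form f dlog" and ?g' = "fun_times_form (\<lambda>q. inverse (f q)) dlog"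
  have "X z = vector [Re (form_integral M (\<lambda>c w. (?g' c w + ?g c w) / 2) \<gamma>),
                      Re (form_integral M (\<lambda>c w. \<i> / 2 * (?g' c w - ?g c w)) \<gamma>),
                      Re (form_integral M dlog \<gamma>)]"
    if "path_from_to M z0 z \<gamma>" for z \<gamma>
  proof -
    have \<gamma>: "pw_C1_path M 0 1 \<gamma>" "\<gamma> 0 = z0" "\<gamma> 1 = z" using that by (auto simp: path_from_to_def)
    have 1: "form_integral M (\<lambda>c w. (?g' c w + ?g c w) / 2) \<gamma> = A (f (\<gamma> 1)) - A (f (\<gamma> 0))"
    proof (rule M.form_integral_primitive[OF \<gamma>(1)])
      show "continuous_map (surf_top M) euclidean (\<lambda>q. A (f q))"
        by (rule continuous_compose_f) (auto simp: A_def intro!: continuous_intros)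
      fix c q assume c: "c \<in> charts M" "q \<in> fst c"
      then have "f (chart_inv c (snd c q)) \<noteq> 0" by (intro f_inv_nz) auto
      then show "((\<lambda>q. A (f q)) \<circ> chart_inv c has_field_derivative (?g' c (snd c q) + ?g c (snd c q)) / 2) (at (snd c q))"
        using deriv_f[OF c] fun_times_dlog[OF c(1), of "snd c q"] c
        by (auto simp: A_def o_def power2_eq_square algebra_simps intro!: derivative_eq_intros)
    qed
    have 2: "form_integral M (\<lambda>c w. \<i> / 2 * (?g' c w - ?g c w)) \<gamma> = B (f (\<gamma> 1)) - B (f (\<gamma> 0))"
    proof (rule M.form_integral_primitive[OF \<gamma>(1)])
      show "continuous_map (surf_top M) euclidean (\<lambda>q. B (f q))"
        by (rule continuous_compose_f) (auto simp: B_def intro!: continuous_intros)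
      fix c q assume c: "c \<in> charts M" "q \<in> fst c"
      then have "f (chart_inv c (snd c q)) \<noteq> 0" by (intro f_inv_nz) auto
      then show "((\<lambda>q. B (f q)) \<circ> chart_inv c has_field_derivative \<i> / 2 * (?g' c (snd c q) - ?g c (snd c q))) (at (snd c q))"
        using deriv_f[OF c] fun_times_dlog[OF c(1), of "snd c q"] c
        by (auto simp: B_def o_def power2_eq_square algebra_simps intro!: derivative_eq_intros)
    qed
    have 3: "Re (form_integral M dlog \<gamma>) = ln (norm (f (\<gamma> 1))) - ln (norm (f (\<gamma> 0)))"
      by (rule form_integral_dlog[OF \<gamma>(1)])
    show ?thesis unfolding 1 2 3 X_def \<gamma>(2,3) ..
  qed
  then have "maximal_map M f dlog z0 X"
    unfolding maximal_map_def Let_def using weierstrass z0 by blast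
  then show ?thesis by blast
qed

text \<open>It tends to infinity both at zeros and at poles of \<open>f\<close>.\<close>
definition height :: "'a \<Rightarrow> real" where
  "height q = (norm (f q) + inverse (norm (f q))) / 2"

lemma continuous_height: "continuous_map (surf_top M) euclidean height"
  unfolding height_def[abs_def] by (rule continuous_compose_f) (auto intro!: continuous_intros)

definition \<iota> :: "'a chart \<Rightarrow> complex \<Rightarrow> real" where
  "\<iota> c z = (norm (fun_times_form (\<lambda>q. inverse (f q)) dlog c z) - norm (fun_times_form f dlog c z))\<^sup>2 / 4"

lemma induced_metric_density: "induced_metric f dlog c z u v = \<iota> c z * (u \<bullet> v)"
  by (simp add: induced_metric_def \<iota>_def)

text \<open>With \<open>r = |f|\<close>, the differential of \<open>(r + 1/r)/2\<close> is \<open>(1 - 1/r\<^sup>2)/2 dr\<close>, while the metric is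
\<open>((1 - 1/r\<^sup>2)/2 |df|)\<^sup>2\<close>; and \<open>|dr| \<le> |df|\<close>.\<close>
lemma height_derivative:
  assumes c: "c \<in> charts M" "q \<in> fst c"
  shows "\<exists>L. ((height \<circ> chart_inv c) has_derivative L) (at (snd c q)) \<and> (\<forall>u. \<bar>L u\<bar> \<le> sqrt (\<iota> c (snd c q) * (u \<bullet> u)))"
proof -
  let ?z = "snd c q" and ?w = "f q"
  let ?D = "deriv (f \<circ> chart_inv c) ?z"
  have w: "?w \<noteq> 0" using f_nz M.chart_sub[OF c(1)] c(2) by blast
  define r where "r = norm ?w"
  have r: "r > 0" using w by (simp add: r_def)
  define L where "L u = (1 - inverse (r\<^sup>2)) / 2 * ((?w \<bullet> (?D * u)) / r)" for u
  have dn: "((\<lambda>w. norm w) has_derivative (\<lambda>h. (?w \<bullet> h) / r)) (at ?w)"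
    using has_derivative_norm[OF w] by (rule has_derivative_eq_rhs) (simp add: r_def sgn_div_norm inner_commute divide_inverse mult.commute)
  have ds: "((\<lambda>s::real. (s + inverse s) / 2) has_field_derivative (1 - inverse (r\<^sup>2)) / 2) (at r)"
    using r by (auto intro!: derivative_eq_intros simp: power2_eq_square)
  have "((\<lambda>w. (norm w + inverse (norm w)) / 2) has_derivative (\<lambda>h. (1 - inverse (r\<^sup>2)) / 2 * ((?w \<bullet> h) / r))) (at ?w)"
  proof -
    have "((\<lambda>s. (s + inverse s) / 2) has_derivative (\<lambda>h. (1 - inverse (r\<^sup>2)) / 2 * h)) (at (norm ?w))"
      using ds by (simp only: has_field_derivative_def r_def)
    from has_derivative_compose[OF dn this] show ?thesis .
  qed
  moreover have "((f \<circ> chart_inv c) has_derivative (\<lambda>u. ?D * u)) (at ?z)"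
    using deriv_f[OF c] by (simp add: has_field_derivative_def)
  ultimately have "((\<lambda>z. (norm ((f \<circ> chart_inv c) z) + inverse (norm ((f \<circ> chart_inv c) z))) / 2) has_derivative L) (at ?z)"
    unfolding L_def using has_derivative_compose[of "f \<circ> chart_inv c" "\<lambda>u. ?D * u" ?z UNIV] c by simp
  then have "((height \<circ> chart_inv c) has_derivative L) (at ?z)"
    by (simp add: height_def[abs_def] o_def)
  moreover have "\<bar>L u\<bar> \<le> sqrt (\<iota> c ?z * (u \<bullet> u))" for u
  proof -
    have "\<bar>?w \<bullet> (?D * u)\<bar> \<le> r * (norm ?D * norm u)"
      using Cauchy_Schwarz_ineq2[of ?w "?D * u"] by (simp add: r_def norm_mult)
    then have "\<bar>?w \<bullet> (?D * u)\<bar> / r \<le> norm ?D * norm u" using r by (simp add: field_simps)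
    then have "\<bar>L u\<bar> \<le> \<bar>1 - inverse (r\<^sup>2)\<bar> / 2 * (norm ?D * norm u)"
      using r unfolding L_def abs_mult abs_divide by (intro mult_mono) auto
    also have "\<dots> = sqrt (\<iota> c ?z * (u \<bullet> u))"
    proof -
      have "\<iota> c ?z = (inverse (r\<^sup>2) * norm ?D - norm ?D)\<^sup>2 / 4"
        using fun_times_dlog[OF c(1), of ?z] c by (simp add: \<iota>_def norm_mult norm_inverse norm_power r_def)
      also have "\<dots> = (\<bar>1 - inverse (r\<^sup>2)\<bar> / 2 * norm ?D)\<^sup>2"
        by (simp add: power_mult_distrib power_divide) (simp add: power2_eq_square algebra_simps)
      finally have "\<iota> c ?z * (u \<bullet> u) = (\<bar>1 - inverse (r\<^sup>2)\<bar> / 2 * (norm ?D * norm u))\<^sup>2"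
        by (simp add: power_mult_distrib power_divide dot_square_norm)
      then show ?thesis by simp
    qed
    finally show ?thesis .
  qed
  ultimately show ?thesis by blast
qed

lemma ends_height:
  assumes "p \<in> P"
  shows "\<exists>U. openin (surf_top S) U \<and> p \<in> U \<and> (\<forall>q\<in>U - P. R < height q)"
proof -
  obtain U where "openin (surf_top S) U" "p \<in> U" "\<And>q. q \<in> U - P \<Longrightarrow> 2 * R < norm (f q) + inverse (norm (f q))"
    using ends[OF assms, of "2 * R"] by blast
  moreover have "R < height q" if "2 * R < norm (f q) + inverse (norm (f q))" for q
    using that unfolding height_def less_divide_eq_numeral1 by (simp only: mult.commute)
  ultimately show ?thesis by (intro exI[of _ U]) blast
qed

text \<open>A sublevel set is closed in \<open>M\<close>, and every puncture has a neighbourhood that misses it, so it is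
closed in the compact surface \<open>S\<close>.\<close>
lemma compact_sublevel: "compactin (surf_top M) {q \<in> points M. height q \<le> R}"
proof -
  let ?C = "{q \<in> points M. height q \<le> R}"
  have top: "surf_top M = subtopology (surf_top S) (points S - P)" by (simp add: puncture_def)
  have Mop: "openin (surf_top S) (points S - P)" by (rule openin_minus_finite[OF fin]) auto
  have "openin (surf_top M) {q \<in> points M. height q \<in> {R<..}}"
    using continuous_height by (rule openin_continuous_map_preimage) simp
  then have o1: "openin (surf_top S) {q \<in> points M. height q \<in> {R<..}}"
    unfolding top using Mop openin_open_subtopology by blast
  have "closedin (surf_top S) ?C"
    unfolding closedin_def
  proof
    show "openin (surf_top S) (points S - ?C)"
    proof (subst openin_subopen, intro ballI)
      fix q assume q: "q \<in> points S - ?C"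
      show "\<exists>T. openin (surf_top S) T \<and> q \<in> T \<and> T \<subseteq> points S - ?C"
      proof (cases "q \<in> P")
        case True
        then obtain U where U: "openin (surf_top S) U" "q \<in> U" "\<forall>q\<in>U - P. R < height q"
          using ends_height by blast
        have "U \<subseteq> points S - ?C"
        proof
          fix x assume x: "x \<in> U"
          have "x \<notin> ?C"
          proof (cases "x \<in> P")
            case False
            then have "R < height x" using U(3) x by blast
            then show ?thesis by simp
          qed simp
          then show "x \<in> points S - ?C" using x openin_subset[OF U(1)] by blast
        qed
        then show ?thesis using U by blast
      next
        case False
        then show ?thesis using q o1 by (intro exI[of _ "{q \<in> points M. height q \<in> {R<..}}"]) auto
      qed
    qed
  qed auto
  then have "compactin (surf_top S) ?C" by (rule closedin_compact_space[OF compact])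
  then show ?thesis unfolding top by (auto simp: compactin_subtopology)
qed

text \<open>Although \<open>\<iota>\<close> involves absolute values of holomorphic functions, it is smooth: in
\<open>(|\<omega>/g| - |g\<omega>|)\<^sup>2\<close> the mixed product is \<open>|\<omega>/g| |g\<omega>| = |\<omega>|\<^sup>2\<close>, so only squares of absolute values occur.\<close>
lemma \<iota>_density: "M.conformal_density \<iota>"
proof -
  let ?A = "fun_times_form (\<lambda>q. inverse (f q)) dlog" and ?B = "fun_times_form f dlog"
  have hol: "holomorphic_form M ?A" "holomorphic_form M ?B" "holomorphic_form M dlog"
    using weierstrass by (auto simp: weierstrass_data_def)
  show ?thesis
    unfolding M.conformal_density_def smooth_on_def
  proof (intro conjI ballI allI)
    fix c k assume c: "c \<in> charts M"
    let ?D = "snd c ` fst c"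
    have h: "?A c holomorphic_on ?D" "?B c holomorphic_on ?D" "dlog c holomorphic_on ?D"
      using hol c by (auto simp: holomorphic_form_def)
    have "C_k_on k (\<lambda>z. (norm (?A c z))\<^sup>2 * (1/4) + (norm (?B c z))\<^sup>2 * (1/4) - (norm (dlog c z))\<^sup>2 * (1/2)) ?D"
      by (intro C_k_diff C_k_add C_k_mult C_k_const C_k_norm_square M.coord_open[OF c] h)
    then show "C_k_on k (\<iota> c) ?D"
    proof (rule C_k_cong[OF M.coord_open[OF c], rotated])
      fix z assume z: "z \<in> ?D"
      have "norm (?A c z) * norm (?B c z) = (norm (dlog c z))\<^sup>2"
        unfolding fun_times_dlog[OF c z] dlog_def
        by (simp add: norm_mult norm_divide norm_inverse norm_power power2_eq_square field_simps)
      then show "(norm (?A c z))\<^sup>2 * (1/4) + (norm (?B c z))\<^sup>2 * (1/4) - (norm (dlog c z))\<^sup>2 * (1/2) = \<iota> c z"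
        by (simp add: \<iota>_def power2_diff field_simps)
    qed
  next
    fix c d q assume cd: "c \<in> charts M" "d \<in> charts M" and q: "q \<in> fst c \<inter> fst d"
    let ?t = "deriv (transition c d) (snd c q)"
    have "snd c q \<in> snd c ` (fst c \<inter> fst d)" using q by blast
    then have "?A c (snd c q) = ?A d (transition c d (snd c q)) * ?t" "?B c (snd c q) = ?B d (transition c d (snd c q)) * ?t"
      using hol(1,2) cd unfolding holomorphic_form_def by blast+
    moreover have "transition c d (snd c q) = snd d q" using M.transition_coord[OF cd(1)] q by blast
    ultimately have "?A c (snd c q) = ?A d (snd d q) * ?t" "?B c (snd c q) = ?B d (snd d q) * ?t" by simp_all
    then show "\<iota> c (snd c q) = \<iota> d (snd d q) * (norm ?t)\<^sup>2"
      by (simp add: \<iota>_def norm_mult left_diff_distrib[symmetric] power_mult_distrib)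
  qed
qed

text \<open>The induced metric degenerates only where \<open>|f| = 1\<close> or \<open>df = 0\<close>, hence only in the sublevel set
\<open>C\<close>. Correcting it by a density that is positive on \<open>C\<close> enlarges it, so \<open>height\<close> remains 1-Lipschitz.\<close>
lemma complete: "complete_maximal M f dlog"
proof -
  obtain R where R: "\<And>c q. c \<in> charts S \<Longrightarrow> q \<in> fst c - P \<Longrightarrow> deriv (f \<circ> chart_inv c) (snd c q) = 0 \<Longrightarrow> norm (f q) + inverse (norm (f q)) \<le> R"
    using critical by blast
  \<comment> \<open>\<open>height = 1\<close> is the locus \<open>|f| = 1\<close>, and the factor \<open>1/2\<close> is that in the definition of \<open>height\<close>\<close>
  define C where "C = {q \<in> points M. height q \<le> max 1 (R / 2)}"
  have "compactin (surf_top M) C" unfolding C_def by (rule compact_sublevel)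
  then obtain \<rho> K where \<rho>: "M.conformal_density \<rho>" "compactin (surf_top M) K"
    "\<And>d q. d \<in> charts M \<Longrightarrow> q \<in> fst d \<Longrightarrow> \<rho> d (snd d q) \<ge> 0"
    "\<And>d q. d \<in> charts M \<Longrightarrow> q \<in> fst d \<Longrightarrow> q \<in> C \<Longrightarrow> \<rho> d (snd d q) > 0"
    "\<And>d q. d \<in> charts M \<Longrightarrow> q \<in> fst d \<Longrightarrow> q \<notin> K \<Longrightarrow> \<rho> d (snd d q) = 0"
    using M.compact_positive_density by blast
  define h where "h c z u v = (\<iota> c z + \<rho> c z) * (u \<bullet> v)" for c z and u v :: complex
  have "M.conformal_density (\<lambda>c z. \<Sum>i\<in>UNIV. (if i then \<iota> else \<rho>) c z)"
    by (rule M.conformal_density_sum) (use \<iota>_density \<rho>(1) in auto)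
  then have "M.conformal_density (\<lambda>c z. \<iota> c z + \<rho> c z)"
    by (simp add: UNIV_bool add.commute)
  then have sym: "sym_tensor M h" unfolding h_def[abs_def] by (rule M.conformal_density_tensor)
  have \<iota>0: "\<iota> c z \<ge> 0" for c z by (simp add: \<iota>_def)
  have pos: "\<iota> c (snd c q) + \<rho> c (snd c q) > 0" if c: "c \<in> charts M" "q \<in> fst c" for c q
  proof (cases "q \<in> C")
    case True
    then show ?thesis using \<rho>(4)[OF c] \<iota>0[of c "snd c q"] by linarith
  next
    case False
    have q: "q \<in> points M" using M.chart_sub[OF c(1)] c(2) by blast
    then have hq: "height q > 1" "height q > R / 2" using False by (auto simp: C_def)
    obtain c0 where c0: "c0 \<in> charts S" "c = chart_minus P c0" using c(1) by (rule charts_punctureE)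
    have qc0: "q \<in> fst c0 - P" using c(2) c0(2) by (simp add: chart_minus_def)
    have op: "open (snd c0 ` (fst c0 - P))"
      using openin_minus_finite[OF fin chart_open[OF c0(1)]] by (rule coord_image_open[OF c0(1)]) auto
    have sc: "snd c = snd c0" by (simp add: c0(2) chart_minus_def)
    have "\<forall>\<^sub>F z in nhds (snd c q). z \<in> snd c0 ` (fst c0 - P)"
      unfolding sc by (rule eventually_nhds_in_open[OF op]) (use qc0 in blast)
    then have "\<forall>\<^sub>F z in nhds (snd c q). (f \<circ> chart_inv c) z = (f \<circ> chart_inv c0) z"
      by eventually_elim (simp add: c0(2) chart_inv_minus[OF c0(1)])
    then have "deriv (f \<circ> chart_inv c) (snd c q) = deriv (f \<circ> chart_inv c0) (snd c0 q)"
      by (rule deriv_cong_ev) (simp add: c0(2) chart_minus_def)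
    moreover have "deriv (f \<circ> chart_inv c0) (snd c0 q) \<noteq> 0"
      using R[OF c0(1) qc0] hq(2) by (auto simp: height_def)
    ultimately have D: "deriv (f \<circ> chart_inv c) (snd c q) \<noteq> 0" by simp
    define r where "r = norm (f q)"
    have r: "r > 0" using f_nz[OF q] by (simp add: r_def)
    have "r \<noteq> 1" using hq(1) by (auto simp: height_def r_def)
    then have "r\<^sup>2 \<noteq> 1" using r by (simp add: power2_eq_1_iff)
    then have "inverse (r\<^sup>2) \<noteq> 1" by simp
    moreover have "\<iota> c (snd c q) = (inverse (r\<^sup>2) * norm (deriv (f \<circ> chart_inv c) (snd c q)) - norm (deriv (f \<circ> chart_inv c) (snd c q)))\<^sup>2 / 4"
      using fun_times_dlog[OF c(1), of "snd c q"] c by (simp add: \<iota>_def norm_mult norm_inverse norm_power r_def)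
    moreover have "inverse (r\<^sup>2) * a - a = (inverse (r\<^sup>2) - 1) * a" for a :: real by (simp add: left_diff_distrib)
    ultimately have "\<iota> c (snd c q) \<noteq> 0" using D by (simp only: power2_eq_square) simp
    then show ?thesis using \<iota>0[of c "snd c q"] \<rho>(3)[OF c] by linarith
  qed
  have "riemannian_metric M h"
    unfolding riemannian_metric_def h_def
    using sym pos by (auto simp: h_def[abs_def] intro!: mult_pos_pos)
  then interpret hm: riemann_metric M h
    by unfold_locales
  have "complete_riemannian_metric M h"
  proof (rule hm.complete_of_proper_Lipschitz[OF continuous_height _ compact_sublevel])
    fix q assume q: "q \<in> points M"
    note c = M.chart_at[OF q]
    obtain L where L: "((height \<circ> chart_inv (chart_at M q)) has_derivative L) (at (snd (chart_at M q) q))"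
      "\<And>u. \<bar>L u\<bar> \<le> sqrt (\<iota> (chart_at M q) (snd (chart_at M q) q) * (u \<bullet> u))"
      using height_derivative[OF c] by blast
    have "\<bar>L u\<bar> \<le> sqrt (h (chart_at M q) (snd (chart_at M q) q) u u)" for u
    proof -
      have "sqrt (\<iota> (chart_at M q) (snd (chart_at M q) q) * (u \<bullet> u)) \<le> sqrt (h (chart_at M q) (snd (chart_at M q) q) u u)"
        using \<rho>(3)[OF c] by (simp add: h_def distrib_right)
      then show ?thesis using L(2)[of u] by linarith
    qed
    then show "\<exists>L. ((height \<circ> chart_inv (chart_at M q)) has_derivative L) (at (snd (chart_at M q) q)) \<and>
        (\<forall>u. \<bar>L u\<bar> \<le> sqrt (h (chart_at M q) (snd (chart_at M q) q) u u))" using L(1) by blast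
  qed
  moreover have "h = (\<lambda>c z u v. induced_metric f dlog c z u v + \<rho> c z * (u \<bullet> v))"
    by (simp add: h_def[abs_def] induced_metric_density distrib_right)
  moreover have "sym_tensor M (\<lambda>c z u v. \<rho> c z * (u \<bullet> v))" by (rule M.conformal_density_tensor[OF \<rho>(1)])
  moreover have "\<forall>c\<in>charts M. \<forall>z\<in>snd c ` (fst c - K). \<forall>u v. \<rho> c z * (u \<bullet> v) = 0" using \<rho>(5) by auto
  ultimately show ?thesis
    unfolding complete_maximal_def using \<rho>(2)
    by (intro exI[of _ K] exI[of _ "\<lambda>c z u v. \<rho> c z * (u \<bullet> v)"]) simp
qed

text \<open>A path into the puncture has unbounded height, and its length is at least the increase of
the height.\<close>
lemma complete_end_at:
  assumes x: "x \<in> P"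
  shows "complete_end S P f dlog x"
  unfolding complete_end_def
proof (intro allI impI, elim conjE)
  fix \<gamma> assume path: "\<forall>b\<in>{0..<1}. pw_C1_path M 0 b \<gamma>" and lim: "limitin (surf_top S) \<gamma> x (at_left 1)"
  let ?L = "path_length M (induced_metric f dlog) {0..<1} \<gamma>"
  have "ennreal r \<le> ?L" for r :: real
  proof -
    obtain U where U: "openin (surf_top S) U" "x \<in> U" "\<forall>q\<in>U - P. height (\<gamma> 0) + \<bar>r\<bar> < height q"
      using ends_height[OF x] by blast
    have "\<forall>\<^sub>F t in at_left 1. \<gamma> t \<in> U" using lim U by (simp add: limitin_def)
    moreover have "\<forall>\<^sub>F t in at_left (1::real). t \<in> {0<..<1}" by (rule eventually_at_left_real) simp
    ultimately have "\<forall>\<^sub>F t in at_left (1::real). \<gamma> t \<in> U \<and> t \<in> {0<..<1}" by (rule eventually_conj)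
    then obtain b where b: "\<gamma> b \<in> U" "0 < b" "b < 1"
      using eventually_happens[of _ "at_left (1::real)"] trivial_limit_at_left_real by auto
    have p: "pw_C1_path M 0 b \<gamma>" using path b by auto
    have "\<gamma> b \<in> points M" by (rule M.path_points[OF p]) (use b in auto)
    then have "height (\<gamma> 0) + \<bar>r\<bar> < height (\<gamma> b)" using U(3) b by auto
    then have "ennreal r \<le> ennreal \<bar>height (\<gamma> b) - height (\<gamma> 0)\<bar>" by (intro ennreal_leI) linarith
    also have "\<dots> \<le> path_length M (induced_metric f dlog) {0..b} \<gamma>"
      by (rule M.Lipschitz_along_path[OF p _ continuous_height])
         (use b height_derivative M.chart_at in \<open>auto simp: induced_metric_density\<close>)
    also have "\<dots> \<le> ?L"
      unfolding path_length_def by (rule nn_integral_mono) (use b in \<open>auto simp: indicator_def\<close>)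
    finally show ?thesis .
  qed
  note bound = this
  show "?L = \<infinity>"
  proof (cases ?L)
    case (real r)
    then show ?thesis using bound[of "r + 1"] by simp
  qed simp
qed

text \<open>Write \<open>f = k(w) (w - z)\<close> with \<open>k(z) \<noteq> 0\<close>. The three forms are \<open>f' / f ^ j\<close> for \<open>j = 0, 1, 2\<close>, of
order \<open>-j\<close>.\<close>
lemma simple_end_at:
  assumes x: "x \<in> P" and f0: "f x = 0"
    and simple: "\<And>c. c \<in> charts S \<Longrightarrow> x \<in> fst c \<Longrightarrow> \<exists>A. open A \<and> snd c x \<in> A \<and>
       (f \<circ> chart_inv c) holomorphic_on A \<and> deriv (f \<circ> chart_inv c) (snd c x) \<noteq> 0"
  shows "simple_end S P f dlog x"
  unfolding simple_end_def
proof (intro ballI impI)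
  fix c assume c: "c \<in> charts S" "x \<in> fst c"
  let ?z = "snd c x" and ?c = "chart_minus P c" and ?g = "f \<circ> chart_inv c"
  obtain A0 where A0: "open A0" "?z \<in> A0" "?g holomorphic_on A0" "deriv ?g ?z \<noteq> 0"
    using simple[OF c] by blast
  define A where "A = A0 \<inter> snd c ` (fst c - (P - {x}))"
  have "open (snd c ` (fst c - (P - {x})))"
    by (rule coord_image_open[OF c(1) openin_minus_finite[OF _ chart_open[OF c(1)]]]) (use fin in auto)
  then have A: "open A" "?z \<in> A" "?g holomorphic_on A"
    using A0 c by (auto simp: A_def intro: holomorphic_on_subset)
  have An: "w \<in> snd c ` (fst c - P)" if "w \<in> A - {?z}" for w
    using that by (auto simp: A_def)
  have gz: "?g ?z = 0" using f0 inv_coord[OF c] by simp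
  define k where "k w = (if w = ?z then deriv ?g ?z else ?g w / (w - ?z))" for w
  have "k = (\<lambda>w. if w = ?z then deriv ?g ?z else (?g w - ?g ?z) / (w - ?z))"
    by (simp only: k_def[abs_def] gz diff_zero)
  then have k: "k holomorphic_on A"
    using pole_lemma[OF A(3), of ?z] A(1,2) by (simp add: interior_open)
  have kz: "k ?z \<noteq> 0" using A0(4) by (simp add: k_def)
  have gk: "?g w = k w * (w - ?z)" if "w \<in> A" for w using gz by (simp add: k_def)
  have kc: "continuous_on A k" using k by (rule holomorphic_on_imp_continuous_on)
  have B': "open {w \<in> A. k w \<noteq> 0}"
  proof -
    have "open (A \<inter> k -` (- {0}))"
      by (rule continuous_open_preimage[OF kc A(1)]) auto
    moreover have "A \<inter> k -` (- {0}) = {w \<in> A. k w \<noteq> 0}" by auto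
    ultimately show ?thesis by simp
  qed
  define B where "B = {w \<in> A. k w \<noteq> 0}"
  have B: "open B" "?z \<in> B" "B \<subseteq> A" "\<And>w. w \<in> B \<Longrightarrow> k w \<noteq> 0" using B' A(2) kz by (auto simp: B_def)
  have dg: "deriv ?g holomorphic_on B" using holomorphic_deriv[OF A(3,1)] B(3) by (rule holomorphic_on_subset)
  have inv: "chart_inv ?c w = chart_inv c w" if "w \<in> B - {?z}" for w
    using chart_inv_minus[OF c(1) An] that B(3) by blast
  have op: "open (B - {?z})" using B(1) by auto
  have ev: "\<forall>\<^sub>F w in at ?z. w \<in> B - {?z}"
    using eventually_at_in_open[OF B(1,2)] .
  have dB: "deriv (f \<circ> chart_inv ?c) w = deriv ?g w" if w: "w \<in> B - {?z}" for w
    by (rule deriv_cong_ev[OF _ refl]) (use eventually_nhds_in_open[OF op w] inv in \<open>auto elim: eventually_mono\<close>)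
  have l: "dlog ?c w = deriv ?g w / ?g w" if "w \<in> B - {?z}" for w
    using dB[OF that] inv[OF that] by (simp add: dlog_def)
  have g0: "?g w \<noteq> 0" if "w \<in> B - {?z}" for w using gk[of w] B that by auto
  have merg: "?g meromorphic_on {?z}"
    by (intro analytic_on_imp_meromorphic_on analytic_on_subset[OF analytic_on_open[THEN iffD2, OF A(1,3)]]) (use A in auto)
  have merd: "deriv ?g meromorphic_on {?z}"
    by (intro analytic_on_imp_meromorphic_on analytic_on_subset[OF analytic_on_open[THEN iffD2, OF B(1) dg]]) (use B in auto)
  have "\<forall>\<^sub>F w in at ?z. ?g w = (f \<circ> chart_inv ?c) w"
    using ev by eventually_elim (simp add: inv)
  then have m1: "(f \<circ> chart_inv ?c) meromorphic_on {?z}"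
    using merg meromorphic_on_cong[of "{?z}" ?g "f \<circ> chart_inv ?c" "{?z}"] by simp
  have "\<forall>\<^sub>F w in at ?z. deriv ?g w / ?g w = dlog ?c w"
    using ev by eventually_elim (simp only: l)
  then have m2: "dlog ?c meromorphic_on {?z}"
    using meromorphic_on_divide[OF merd merg] meromorphic_on_cong[of "{?z}" "\<lambda>w. deriv ?g w / ?g w" "dlog ?c" "{?z}"] by simp
  have zo: "zorder (\<lambda>w. deriv ?g w / ?g w ^ j) ?z = - int j" for j
  proof (rule zorder_eqI[OF B(1,2)])
    show "(\<lambda>w. deriv ?g w / k w ^ j) holomorphic_on B"
      using dg holomorphic_on_subset[OF k B(3)] B(4) by (auto intro!: holomorphic_intros)
    show "deriv ?g ?z / k ?z ^ j \<noteq> 0" using A0(4) kz by simp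
    show "deriv ?g w / ?g w ^ j = deriv ?g w / k w ^ j * (w - ?z) powi - int j" if "w \<in> B" "w \<noteq> ?z" for w
    proof -
      have "w \<in> A" using that B(3) by blast
      then show ?thesis
        by (simp only: gk power_mult_distrib power_int_minus power_int_of_nat) (simp add: divide_inverse)
    qed
  qed
  have ft: "fun_times_form u dlog ?c w = v w"
    if w: "w \<in> B - {?z}" and v: "v holomorphic_on B - {?z}" "\<And>w. w \<in> B - {?z} \<Longrightarrow> v w = u (chart_inv c w) * (deriv ?g w / ?g w)" for u v w
  proof -
    have "\<forall>\<^sub>F y in at w. u (chart_inv ?c y) * dlog ?c y = v y"
      using eventually_at_in_open'[OF op w] inv l v(2) by (auto elim!: eventually_mono)
    then have "remove_sings (\<lambda>y. u (chart_inv ?c y) * dlog ?c y) w = remove_sings v w"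
      by (rule remove_sings_cong) simp
    also have "\<dots> = v w"
      by (rule remove_sings_at_analytic[OF analytic_on_subset[OF analytic_on_open[THEN iffD2, OF op v(1)]]])
         (use w in auto)
    finally show ?thesis by (simp add: fun_times_form_def)
  qed
  have hB: "?g holomorphic_on B - {?z}" "deriv ?g holomorphic_on B - {?z}"
    using A(3) dg B(3) by (auto intro: holomorphic_on_subset)
  have "zorder (\<eta> ?c) ?z \<ge> -2" if "\<eta> \<in> {fun_times_form (\<lambda>q. inverse (f q)) dlog, fun_times_form f dlog, dlog}" for \<eta>
  proof -
    have quot: "(\<lambda>w. D w / G w ^ j) holomorphic_on T"
      if "G holomorphic_on T" "D holomorphic_on T" "\<And>w. w \<in> T \<Longrightarrow> G w \<noteq> 0" for G D :: "complex \<Rightarrow> complex" and T j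
      using that by (intro holomorphic_intros) auto
    have e1: "\<forall>\<^sub>F w in at ?z. fun_times_form (\<lambda>q. inverse (f q)) dlog ?c w = deriv ?g w / ?g w ^ 2"
      using ev by eventually_elim (rule ft[OF _ quot[OF hB g0]], auto simp: power2_eq_square divide_inverse)
    have e2: "\<forall>\<^sub>F w in at ?z. fun_times_form f dlog ?c w = deriv ?g w / ?g w ^ 0"
      using ev by eventually_elim (rule ft[OF _ quot[OF hB g0]], use g0 in auto)
    have e3: "\<forall>\<^sub>F w in at ?z. dlog ?c w = deriv ?g w / ?g w ^ 1"
      using ev by eventually_elim (use l in auto)
    have "zorder (fun_times_form (\<lambda>q. inverse (f q)) dlog ?c) ?z = - 2" 
      using zorder_cong[OF e1 refl] zo[of 2] by simp
    moreover have "zorder (fun_times_form f dlog ?c) ?z = 0"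
      using zorder_cong[OF e2 refl] zo[of 0] by simp
    moreover have "zorder (dlog ?c) ?z = - 1"
      using zorder_cong[OF e3 refl] zo[of 1] by simp
    ultimately show ?thesis using that by auto
  qed
  then show "let c' = chart_minus P c; z = snd c x
         in (f \<circ> chart_inv c') meromorphic_on {z} \<and> dlog c' meromorphic_on {z} \<and>
            (\<forall>\<eta>\<in>{fun_times_form (\<lambda>q. inverse (f q)) dlog, fun_times_form f dlog, dlog}.
                is_pole (\<eta> c') z \<longrightarrow> - 2 \<le> zorder (\<eta> c') z)"
    using m1 m2 unfolding Let_def by blast
qed

end

section \<open>The superelliptic curve\<close>

text \<open>Inversion in the unit sphere of \<open>\<complex>\<^sup>2\<close>. It turns a closed unbounded set that avoids the origin
into a bounded one whose only missing limit point is \<open>0\<close>, so that a one-point compactification is realised inside the given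
type of points; the value at \<open>0\<close> is \<open>0\<close>.\<close>
definition inversion :: "complex \<times> complex \<Rightarrow> complex \<times> complex" where
  "inversion P = inverse ((norm P)\<^sup>2) *\<^sub>R P"

lemma norm_inversion [simp]: "norm (inversion P) = inverse (norm P)"
  by (cases "P = 0") (auto simp: inversion_def power2_eq_square)

lemma inversion_inversion [simp]: "inversion (inversion P) = P"
proof (cases "P = 0")
  case False
  then show ?thesis
    using norm_inversion[of P] by (simp add: inversion_def[of "inversion P"]) (simp add: inversion_def power_inverse)
qed (simp add: inversion_def)

lemma inversion_0 [simp]: "inversion 0 = 0"
  by (simp add: inversion_def)

lemma inversion_eq_0_iff [simp]: "inversion P = 0 \<longleftrightarrow> P = 0"
  by (metis inversion_0 inversion_inversion)

lemma continuous_on_inversion: "continuous_on (- {0}) inversion"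
  unfolding inversion_def by (intro continuous_intros) auto

lemma continuous_on_inversion_comp:
  "continuous_on A g \<Longrightarrow> (\<And>z. z \<in> A \<Longrightarrow> g z \<noteq> 0) \<Longrightarrow> continuous_on A (\<lambda>z. inversion (g z))"
  by (rule continuous_on_compose2[OF continuous_on_inversion]) auto

lemma second_countable_euclidean: "second_countable (euclidean :: 'b::second_countable_topology topology)"
proof -
  obtain B :: "'b set set" where B: "countable B" "topological_basis B"
    using ex_countable_basis by blast
  have "\<exists>V\<in>B. x \<in> V \<and> V \<subseteq> U" if "open U" "x \<in> U" for U x
    using topological_basisE[OF B(2) that] by metis
  then show ?thesis
    unfolding second_countable_def using B(1) topological_basis_open[OF B(2)] by (intro exI[of _ B]) auto
qed

text \<open>The curve \<open>x\<^sup>n = y\<^sup>2 + 1\<close> with \<open>n = 2p + 1\<close>. As \<open>n\<close> is odd, it has a single point at infinity.\<close>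
locale superelliptic =
  fixes p :: nat
  assumes p: "p \<ge> 1"
begin

definition n :: nat where "n = 2 * p + 1"

lemma n: "n \<ge> 3" "odd n" "n > 0" using p by (auto simp: n_def)

text \<open>The principal \<open>n\<close>th root.\<close>
definition rt :: "complex \<Rightarrow> complex" where
  "rt z = exp (Ln z / of_nat n)"

lemma rt_power: "z \<noteq> 0 \<Longrightarrow> rt z ^ n = z"
  using n by (simp add: rt_def flip: exp_of_nat_mult)

lemma rt_nz [simp]: "rt z \<noteq> 0" by (simp add: rt_def)

lemma rt_holo: "f holomorphic_on A \<Longrightarrow> (\<And>z. z \<in> A \<Longrightarrow> f z \<notin> \<real>\<^sub>\<le>\<^sub>0) \<Longrightarrow> (\<lambda>z. rt (f z)) holomorphic_on A"
  unfolding rt_def using n by (intro holomorphic_intros) auto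

lemma rt_cont: "continuous_on A f \<Longrightarrow> (\<And>z. z \<in> A \<Longrightarrow> f z \<notin> \<real>\<^sub>\<le>\<^sub>0) \<Longrightarrow> continuous_on A (\<lambda>z. rt (f z))"
  unfolding rt_def using n by (intro continuous_intros) auto

definition A :: "(complex \<times> complex) set" where
  "A = {(x, y). x ^ n = y\<^sup>2 + 1}"

text \<open>A point \<open>P \<noteq> 0\<close> of the compact curve stands for the affine point \<open>inversion P\<close>, with coordinates
\<open>X P\<close> and \<open>Y P\<close>, and \<open>0\<close> stands for the point at infinity, where \<open>X\<close> and \<open>Y\<close> have the default value
\<open>0\<close>.\<close>
definition K :: "(complex \<times> complex) set" where
  "K = {P. P = 0 \<or> inversion P \<in> A}"

abbreviation X :: "complex \<times> complex \<Rightarrow> complex" where "X P \<equiv> fst (inversion P)"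
abbreviation Y :: "complex \<times> complex \<Rightarrow> complex" where "Y P \<equiv> snd (inversion P)"

lemma A_closed: "closed A"
proof -
  have "A = {P. fst P ^ n = (snd P)\<^sup>2 + 1}" by (auto simp: A_def)
  then show ?thesis by (auto intro!: closed_Collect_eq continuous_intros)
qed

lemma A_nz: "0 \<notin> A" using n by (auto simp: A_def zero_prod_def power_0_left)

lemma in_K: "inversion P \<in> A \<Longrightarrow> P \<in> K" by (simp add: K_def)

lemma inversion_in_K: "P \<in> A \<Longrightarrow> inversion P \<in> K - {0}"
  using A_nz by (auto simp: K_def)

lemma K_eq: "P \<in> K \<Longrightarrow> P \<noteq> 0 \<Longrightarrow> X P ^ n = (Y P)\<^sup>2 + 1"
  by (auto simp: K_def A_def split: prod.splits)

lemma K_compact: "compact K"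
proof -
  have "open (- {0} \<inter> inversion -` (- A))"
    by (rule continuous_open_preimage[OF continuous_on_inversion]) (use A_closed in auto)
  moreover have "- {0} \<inter> inversion -` (- A) = - K" by (auto simp: K_def)
  ultimately have "closed K" by (simp add: closed_def)
  moreover have "bounded K"
  proof -
    obtain r where r: "r > 0" "ball 0 r \<subseteq> - A"
      using A_closed A_nz open_contains_ball[of "- A"] by (auto simp: closed_def)
    have "norm P \<le> inverse r" if "P \<in> K" for P
    proof (cases "P = 0")
      case False
      then have "inversion P \<in> A" using that by (simp add: K_def)
      then have "inversion P \<notin> ball 0 r" using r(2) by blast
      then have "r \<le> inverse (norm P)" by simp
      then show ?thesis using r False by (metis inverse_inverse_eq le_imp_inverse_le)
    qed (use r in simp)
    then show ?thesis unfolding bounded_iff by blast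
  qed
  ultimately show ?thesis by (simp add: compact_eq_bounded_closed)
qed

lemma cont_XY: "continuous_on (K - {0}) X" "continuous_on (K - {0}) Y"
  by (intro continuous_intros continuous_on_subset[OF continuous_on_inversion]; blast)+

text \<open>The involution \<open>y \<mapsto> -y\<close>, which exchanges the two affine charts.\<close>
definition flip :: "complex \<times> complex \<Rightarrow> complex \<times> complex" where
  "flip P = (fst P, - snd P)"

lemma norm_flip [simp]: "norm (flip P) = norm P"
  by (cases P) (simp add: flip_def norm_Pair)

lemma flip_flip [simp]: "flip (flip P) = P" by (simp add: flip_def)

lemma inversion_flip: "inversion (flip P) = flip (inversion P)"
proof -
  have "inversion (flip P) = inverse ((norm P)\<^sup>2) *\<^sub>R flip P" by (simp add: inversion_def)
  also have "\<dots> = flip (inversion P)" by (simp add: inversion_def flip_def)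
  finally show ?thesis .
qed

lemma XY_flip [simp]: "X (flip P) = X P" "Y (flip P) = - Y P"
  by (simp_all add: inversion_flip) (simp_all add: flip_def)

lemma flip_eq_0 [simp]: "flip P = 0 \<longleftrightarrow> P = 0"
  by (cases P) (auto simp: flip_def zero_prod_def)

lemma flip_K [simp]: "flip P \<in> K \<longleftrightarrow> P \<in> K"
  by (simp add: K_def inversion_flip) (auto simp: A_def flip_def split: prod.splits)

lemma cont_flip: "continuous_on B flip"
  unfolding flip_def by (intro continuous_intros)

text \<open>The branch points of the \<open>n\<close>-sheeted map \<open>Y\<close> are \<open>\<plusminus>\<i>\<close>. The half plane \<open>Im y > -1\<close>
contains only \<open>\<i>\<close>, so \<open>u = (y - \<i>)\<^bsup>1/n\<^esup>\<close> is a coordinate over it; \<open>W\<close> is the mirror image of \<open>U\<close>, and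
\<open>V R\<close> is a neighbourhood of infinity.\<close>
definition U where "U = {P \<in> K. P \<noteq> 0 \<and> Im (Y P) > -1}"
definition W where "W = {P \<in> K. P \<noteq> 0 \<and> Im (Y P) < 1}"
definition V where "V R = {P \<in> K. P = 0 \<or> norm (X P) > R}"

definition DU where "DU = {u. Im (u ^ n) > -2}"

text \<open>On \<open>U\<close> the identity \<open>x\<^sup>n = (y - \<i>)(y + \<i>)\<close> gives \<open>x / (y + \<i>)\<^bsup>1/n\<^esup>\<close> as an \<open>n\<close>th root of \<open>y - \<i>\<close>, and
\<open>y + \<i>\<close> lies in the upper half plane, where the principal root is holomorphic. At infinity the coordinate is the square root
of \<open>1/x\<close> that makes \<open>y\<close> asymptotic to \<open>cV\<^bsup>-n\<^esup>\<close>.\<close>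
definition cU where "cU P = X P / rt (Y P + \<i>)"
definition cW where "cW P = cU (flip P)"
definition cV where "cV P = Y P * inverse (X P) ^ (p + 1) / csqrt (1 - inverse (X P) ^ n)"

text \<open>Parametrisations inverse to the coordinates: \<open>y = u\<^sup>n + \<i>\<close> on \<open>U\<close>, and \<open>x = t\<^sup>-\<^sup>2\<close>,
\<open>y\<^sup>2 = t\<^bsup>-2n\<^esup> (1 - t\<^bsup>2n\<^esup>)\<close> near infinity.\<close>
definition aU where "aU u = (u * rt (u ^ n + 2 * \<i>), u ^ n + \<i>)"
definition pU where "pU u = inversion (aU u)"
definition pW where "pW u = flip (pU u)"
definition aV where "aV t = (inverse t ^ 2, inverse t ^ n * csqrt (1 - t ^ (2 * n)))"
definition pV where "pV t = inversion (aV t)"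

lemma upper_not_nonpos: "Im z > 0 \<Longrightarrow> z \<notin> \<real>\<^sub>\<le>\<^sub>0"
  by (auto simp: complex_nonpos_Reals_iff)

lemma DU_upper: "u \<in> DU \<Longrightarrow> Im (u ^ n + 2 * \<i>) > 0" by (simp add: DU_def)

lemma rt_upper_power: "Im z > 0 \<Longrightarrow> rt z ^ n = z"
  using rt_power[of z] by (cases "z = 0") auto

lemma aU_A: assumes "u \<in> DU" shows "aU u \<in> A"
  using rt_upper_power[OF DU_upper[OF assms]]
  by (simp add: A_def aU_def power_mult_distrib) (simp add: power2_eq_square algebra_simps)

lemma XY_pU: assumes "u \<in> DU"
  shows "X (pU u) = u * rt (u ^ n + 2 * \<i>)" "Y (pU u) = u ^ n + \<i>"
  by (simp_all add: pU_def aU_def)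

lemma pU_U: assumes "u \<in> DU" shows "pU u \<in> U"
proof -
  have "pU u \<in> K - {0}" unfolding pU_def by (rule inversion_in_K[OF aU_A[OF assms]])
  then show ?thesis using assms by (simp add: U_def XY_pU DU_def)
qed

lemma cU_pU [simp]: "u \<in> DU \<Longrightarrow> cU (pU u) = u"
proof -
  assume u: "u \<in> DU"
  have "Y (pU u) + \<i> = u ^ n + 2 * \<i>" by (simp add: XY_pU u)
  then show ?thesis unfolding cU_def XY_pU(1)[OF u] by (simp only:) simp
qed

lemma cU_power:
  assumes "P \<in> U" shows "cU P ^ n = Y P - \<i>"
proof -
  have P: "X P ^ n = (Y P - \<i>) * (Y P + \<i>)" "Im (Y P + \<i>) > 0"
    using assms K_eq[of P] by (auto simp: U_def power2_eq_square algebra_simps)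
  then have "Y P + \<i> \<noteq> 0" by (metis less_irrefl zero_complex.simps(2))
  then show ?thesis using P rt_upper_power[OF P(2)] by (simp add: cU_def power_divide)
qed

lemma cU_DU: "P \<in> U \<Longrightarrow> cU P \<in> DU"
  by (simp add: DU_def cU_power) (simp add: U_def)

lemma pU_cU [simp]: assumes "P \<in> U" shows "pU (cU P) = P"
proof -
  have "aU (cU P) = inversion P"
  proof -
    have "cU P ^ n + 2 * \<i> = Y P + \<i>" "cU P ^ n + \<i> = Y P" by (simp_all add: cU_power[OF assms])
    moreover have "cU P * rt (Y P + \<i>) = X P" by (simp add: cU_def)
    ultimately show ?thesis by (simp only: aU_def prod.collapse)
  qed
  then show ?thesis by (simp add: pU_def)
qed

lemma W_flip: "P \<in> W \<longleftrightarrow> flip P \<in> U"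
  by (auto simp: U_def W_def)

lemma nz_A: "z \<in> A \<Longrightarrow> z \<noteq> 0" using A_nz by blast

lemma aV_A: assumes "t \<in> ball 0 1" "t \<noteq> 0" shows "aV t \<in> A"
proof -
  have "(inverse t ^ 2) ^ n = (inverse t ^ n) ^ 2" by (simp flip: power_mult add: mult.commute)
  moreover have "(inverse t ^ n)\<^sup>2 * t ^ (2 * n) = 1" using assms by (simp add: power_mult power_inverse power_mult_distrib flip: power_mult power2_eq_square) (simp add: power_mult[symmetric] mult.commute)
  ultimately show ?thesis
    by (simp add: A_def aV_def power_mult_distrib right_diff_distrib)
qed

lemma XY_pV: "X (pV t) = inverse t ^ 2" "Y (pV t) = inverse t ^ n * csqrt (1 - t ^ (2 * n))"
  by (simp_all add: pV_def aV_def)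

lemma pV_0 [simp]: "pV 0 = 0"
proof -
  have "aV 0 = 0" using n by (simp add: aV_def zero_prod_def)
  then show ?thesis by (simp add: pV_def)
qed

lemma pV_V: assumes "t \<in> ball 0 1" shows "pV t \<in> V 1"
proof (cases "t = 0")
  case False
  have "pV t \<in> K - {0}" unfolding pV_def by (rule inversion_in_K[OF aV_A[OF assms False]])
  moreover have "norm (X (pV t)) > 1"
    using assms False by (simp add: XY_pV norm_power norm_inverse) (simp add: one_less_power one_less_inverse)
  ultimately show ?thesis by (simp add: V_def)
qed (simp add: V_def K_def)

lemma power_less_one_csqrt: "norm (z::complex) < 1 \<Longrightarrow> 1 - z \<notin> \<real>\<^sub>\<le>\<^sub>0"
proof
  assume z: "norm z < 1" "1 - z \<in> \<real>\<^sub>\<le>\<^sub>0"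
  then have "Re z \<ge> 1" by (auto simp: complex_nonpos_Reals_iff)
  then show False using z complex_Re_le_cmod[of z] by linarith
qed

lemma norm_power_less_one: "norm (t::complex) < 1 \<Longrightarrow> k > 0 \<Longrightarrow> norm (t ^ k) < 1"
  by (simp add: norm_power power_less_one_iff)

lemma cV_pV [simp]: assumes "t \<in> ball 0 1" shows "cV (pV t) = t"
proof (cases "t = 0")
  case True then show ?thesis by (simp add: cV_def)
next
  case False
  have t: "norm t < 1" using assms by simp
  let ?q = "csqrt (1 - t ^ (2 * n))"
  have "1 - t ^ (2 * n) \<noteq> 0" using power_less_one_csqrt[OF norm_power_less_one[OF t, of "2 * n"]] n by auto
  then have q: "?q \<noteq> 0" by simp
  have v: "inverse (X (pV t)) = t ^ 2" by (simp add: XY_pV power_inverse)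
  have "cV (pV t) = inverse t ^ n * ?q * (t ^ 2) ^ (p + 1) / csqrt (1 - (t ^ 2) ^ n)"
    unfolding cV_def v by (simp add: XY_pV)
  also have "(t ^ 2) ^ (p + 1) = t ^ (n + 1)" by (simp only: power_mult[symmetric]) (simp add: n_def)
  also have "(t ^ 2) ^ n = t ^ (2 * n)" by (simp only: power_mult[symmetric])
  also have "inverse t ^ n * ?q * t ^ (n + 1) / ?q = inverse t ^ n * t ^ (n + 1) * (?q / ?q)" by simp
  also have "\<dots> = t" using q False by (simp add: power_inverse field_simps)
  finally show ?thesis .
qed

text \<open>Here \<open>cV\<^sup>2 = y\<^sup>2 x\<^bsup>-n-1\<^esup> / (1 - x\<^sup>-\<^sup>n)\<close>, and \<open>y\<^sup>2 = x\<^sup>n (1 - x\<^sup>-\<^sup>n)\<close> on the curve. As \<open>|x| > 1\<close>, the square root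
is off its branch cut.\<close>
lemma cV_power:
  assumes P: "P \<in> K" "P \<noteq> 0" "norm (X P) > 1"
  shows "cV P ^ 2 = inverse (X P)" "cV P \<noteq> 0" "Y P = inverse (cV P) ^ n * csqrt (1 - cV P ^ (2 * n))"
proof -
  define v where "v = inverse (X P)"
  let ?q = "csqrt (1 - v ^ n)"
  have X: "X P \<noteq> 0" using P(3) by auto
  have v: "v \<noteq> 0" "norm v < 1" using P X by (auto simp: v_def norm_inverse inverse_less_1_iff)
  have q2: "?q ^ 2 = 1 - v ^ n" by simp
  have "1 - v ^ n \<noteq> 0" using power_less_one_csqrt[OF norm_power_less_one[OF v(2), of n]] n by auto
  then have q: "?q \<noteq> 0" by simp
  have "X P ^ n * v ^ n = 1" using X by (simp add: v_def flip: power_mult_distrib)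
  then have Y2: "(Y P)\<^sup>2 * v ^ n = 1 - v ^ n" using K_eq[OF P(1,2)] by (simp add: algebra_simps)
  have c: "cV P = Y P * v ^ (p + 1) / ?q" by (simp add: cV_def v_def)
  have "cV P ^ 2 = (Y P)\<^sup>2 * v ^ (2 * (p + 1)) / ?q ^ 2" by (simp only: c power_divide power_mult_distrib power_mult[symmetric] mult.commute[of 2])
  also have "v ^ (2 * (p + 1)) = v ^ n * v" by (simp add: n_def)
  also have "(Y P)\<^sup>2 * (v ^ n * v) / ?q ^ 2 = v"
    unfolding q2 mult.assoc[symmetric] Y2 using \<open>1 - v ^ n \<noteq> 0\<close> by simp
  finally show c2: "cV P ^ 2 = inverse (X P)" by (simp add: v_def)
  then show "cV P \<noteq> 0" using X by (metis inverse_zero_imp_zero power_zero_numeral)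
  have Yn: "Y P \<noteq> 0" using Y2 \<open>1 - v ^ n \<noteq> 0\<close> by auto
  have "cV P ^ (2 * n) = v ^ n" by (simp add: power_mult c2 v_def)
  moreover have "cV P ^ n = Y P * v ^ n / ?q"
  proof -
    have "cV P ^ n = (cV P ^ 2) ^ p * cV P" by (simp add: n_def power_mult)
    also have "\<dots> = v ^ p * (Y P * v ^ (p + 1) / ?q)" using c c2 by (simp add: v_def)
    also have "v ^ p * (Y P * v ^ (p + 1) / ?q) = Y P * (v ^ p * v ^ (p + 1)) / ?q" by simp
    also have "v ^ p * v ^ (p + 1) = v ^ n" by (simp only: power_add[symmetric]) (simp add: n_def mult_2)
    finally show ?thesis .
  qed
  ultimately have "inverse (cV P) ^ n * csqrt (1 - cV P ^ (2 * n)) = ?q ^ 2 / (Y P * v ^ n)"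
    by (simp add: power_inverse power2_eq_square)
  also have "\<dots> = (Y P)\<^sup>2 * v ^ n / (Y P * v ^ n)" by (simp only: q2 Y2)
  also have "\<dots> = Y P" using Yn v by (simp add: power2_eq_square)
  finally show "Y P = inverse (cV P) ^ n * csqrt (1 - cV P ^ (2 * n))" by simp
qed

lemma cV_norm: "P \<in> K \<Longrightarrow> P \<noteq> 0 \<Longrightarrow> norm (X P) > 1 \<Longrightarrow> norm (cV P) ^ 2 = inverse (norm (X P))"
  using cV_power(1)[of P] by (metis norm_inverse norm_power)

lemma cV_ball: assumes "P \<in> V 1" shows "cV P \<in> ball 0 1"
proof (cases "P = 0")
  case True then show ?thesis by (simp add: cV_def)
next
  case False
  then have P: "P \<in> K" "norm (X P) > 1" using assms by (auto simp: V_def)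
  then have "norm (cV P) ^ 2 < 1" using cV_norm[OF P(1) False P(2)] by (simp add: inverse_less_1_iff)
  then show ?thesis by (simp add: power_less_one_iff)
qed

lemma pV_cV [simp]: assumes "P \<in> V 1" shows "pV (cV P) = P"
proof (cases "P = 0")
  case True then show ?thesis by (simp add: cV_def)
next
  case False
  then have P: "P \<in> K" "P \<noteq> 0" "norm (X P) > 1" using assms by (auto simp: V_def)
  have "aV (cV P) = inversion P"
    using cV_power[OF P] by (simp add: aV_def prod_eq_iff power_inverse)
  then show ?thesis by (simp add: pV_def)
qed

lemma U_open: "openin (top_of_set K) U"
proof -
  have "open (- {0} \<inter> (\<lambda>P. Im (Y P)) -` {-1<..})"
    by (intro continuous_open_preimage) (auto intro!: continuous_intros continuous_on_inversion)
  then show ?thesis by (rule openin_open[THEN iffD2, OF exI, OF conjI]) (auto simp: U_def)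
qed

lemma W_open: "openin (top_of_set K) W"
proof -
  have "open (- {0} \<inter> (\<lambda>P. Im (Y P)) -` {..<1})"
    by (intro continuous_open_preimage) (auto intro!: continuous_intros continuous_on_inversion)
  then show ?thesis by (rule openin_open[THEN iffD2, OF exI, OF conjI]) (auto simp: W_def)
qed

text \<open>The complement is the image of \<open>{|x| \<le> R}\<close>, which is compact because \<open>|y|\<close> is bounded in terms of
\<open>|x|\<close> on the curve.\<close>
lemma V_open: "openin (top_of_set K) (V R)"
proof -
  let ?B = "{z \<in> A. norm (fst z) \<le> R}"
  have "?B = A \<inter> {z. norm (fst z) \<le> R}" by auto
  moreover have "closed {z :: complex \<times> complex. norm (fst z) \<le> R}"
    by (intro closed_Collect_le continuous_intros)
  ultimately have "closed ?B" using A_closed closed_Int by metis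
  moreover have "bounded ?B"
  proof -
    have "norm z \<le> \<bar>R\<bar> + (\<bar>R\<bar> ^ n + 2)" if z: "z \<in> ?B" for z
    proof -
      obtain x y where xy: "z = (x, y)" by (cases z)
      have "norm x \<le> \<bar>R\<bar>" "y\<^sup>2 = x ^ n - 1" using z by (auto simp: A_def xy)
      then have "norm y ^ 2 \<le> \<bar>R\<bar> ^ n + 1"
        using norm_triangle_ineq4[of "x ^ n" 1] power_mono[of "norm x" "\<bar>R\<bar>" n] by (simp add: norm_power flip: norm_power[of y])
      moreover have "norm y \<le> norm y ^ 2 + 1"
        using zero_le_power2[of "norm y - 1"] by (simp add: power2_diff) (use norm_ge_zero[of y] in linarith)
      ultimately have "norm y \<le> \<bar>R\<bar> ^ n + 2" by linarith
      moreover have "norm z \<le> norm x + norm y" unfolding xy by (rule norm_Pair_le)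
      ultimately show ?thesis using \<open>norm x \<le> \<bar>R\<bar>\<close> by linarith
    qed
    then show ?thesis unfolding bounded_iff by blast
  qed
  ultimately have "compact ?B" by (simp add: compact_eq_bounded_closed)
  moreover have "continuous_on ?B inversion"
    by (rule continuous_on_subset[OF continuous_on_inversion]) (use A_nz in auto)
  ultimately have cl: "closed (inversion ` ?B)" by (simp add: compact_continuous_image compact_imp_closed)
  have "V R = K \<inter> - (inversion ` ?B)"
  proof (intro equalityI subsetI)
    fix P assume "P \<in> V R"
    then show "P \<in> K \<inter> - (inversion ` ?B)" using A_nz by (auto simp: V_def)
  next
    fix P assume P: "P \<in> K \<inter> - (inversion ` ?B)"
    have "inversion P \<notin> ?B"
    proof
      assume "inversion P \<in> ?B"
      then have "inversion (inversion P) \<in> inversion ` ?B" by (rule imageI)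
      then show False using P by simp
    qed
    then show "P \<in> V R" using P by (auto simp: V_def K_def)
  qed
  then show ?thesis by (simp only: openin_open_Int open_Compl[OF cl])
qed


lemma csqrt_cont:
  assumes "continuous_on T f" "\<And>z. z \<in> T \<Longrightarrow> f z \<notin> \<real>\<^sub>\<le>\<^sub>0"
  shows "continuous_on T (\<lambda>z. csqrt (f z))"
proof -
  have "continuous_on (- \<real>\<^sub>\<le>\<^sub>0) csqrt"
    by (rule continuous_on_csqrt)
  then show ?thesis by (rule continuous_on_compose2[OF _ assms(1)]) (use assms(2) in auto)
qed

lemma one_minus_power: "norm (z::complex) < 1 \<Longrightarrow> k > 0 \<Longrightarrow> 1 - z ^ k \<notin> \<real>\<^sub>\<le>\<^sub>0"
  by (rule power_less_one_csqrt[OF norm_power_less_one])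

lemma DU_open: "open DU"
  unfolding DU_def by (intro open_Collect_less continuous_intros)

lemma cont_cU: "continuous_on U cU"
proof -
  have c: "continuous_on U X" "continuous_on U Y"
    by (rule continuous_on_subset[OF cont_XY(1)] continuous_on_subset[OF cont_XY(2)]; auto simp: U_def)+
  show ?thesis unfolding cU_def
    by (intro continuous_intros c rt_cont ballI rt_nz upper_not_nonpos) (simp add: U_def)
qed

lemma cont_pU: "continuous_on DU pU"
  unfolding pU_def aU_def
  by (intro continuous_on_inversion_comp continuous_intros rt_cont upper_not_nonpos DU_upper)
     (use nz_A[OF aU_A] in \<open>auto simp: aU_def\<close>)

lemma cont_cW: "continuous_on W cW"
  unfolding cW_def using continuous_on_compose2[OF cont_cU cont_flip] by (simp add: image_subset_iff W_flip)

lemma cont_pW: "continuous_on DU pW"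
  unfolding pW_def using continuous_on_compose2[OF cont_flip cont_pU] by blast

lemma cW_pW: "u \<in> DU \<Longrightarrow> cW (pW u) = u" by (simp add: cW_def pW_def)
lemma pW_cW: "P \<in> W \<Longrightarrow> pW (cW P) = P" by (simp add: cW_def pW_def W_flip)
lemma cW_DU: "P \<in> W \<Longrightarrow> cW P \<in> DU" by (simp add: cW_def W_flip cU_DU)
lemma pW_W: "u \<in> DU \<Longrightarrow> pW u \<in> W" by (simp add: pW_def W_flip pU_U)

text \<open>At \<open>t = 0\<close>: the affine point \<open>aV t\<close> has norm at least \<open>|t|\<^sup>-\<^sup>2\<close>, so its inversion has norm at most
\<open>|t|\<^sup>2\<close>.\<close>
lemma cont_pV: "continuous_on (ball 0 1) pV"
proof -
  have "isCont pV t" if t: "t \<in> ball 0 1" for t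
  proof (cases "t = 0")
    case True
    have "norm (pV s) \<le> norm s ^ 2" for s
    proof (cases "s = 0")
      case False
      have "norm (inverse s ^ 2) \<le> norm (aV s)" unfolding aV_def by (rule norm_fst_le)
      then have "inverse (norm (aV s)) \<le> inverse (norm (inverse s ^ 2))"
        using False by (intro le_imp_inverse_le) auto
      then show ?thesis by (simp add: pV_def norm_power norm_inverse power_inverse)
    qed simp
    then have le: "\<forall>\<^sub>F s in at 0. norm (pV s) \<le> norm s ^ 2" by simp
    have "((\<lambda>s::complex. norm s ^ 2) \<longlongrightarrow> norm (0::complex) ^ 2) (at 0)" by (intro tendsto_intros)
    then have "((\<lambda>s::complex. norm s ^ 2) \<longlongrightarrow> 0) (at 0)" by simp
    from Lim_null_comparison[OF le this] have "(pV \<longlongrightarrow> 0) (at 0)" .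
    then show ?thesis using True by (simp add: isCont_def)
  next
    case False
    have "continuous_on (ball 0 1 - {0}) pV"
      unfolding pV_def aV_def
    proof (intro continuous_on_inversion_comp continuous_intros csqrt_cont)
      show "1 - t ^ (2 * n) \<notin> \<real>\<^sub>\<le>\<^sub>0" if "t \<in> ball 0 1 - {0}" for t :: complex
        by (rule one_minus_power) (use that n in auto)
      show "(inverse t ^ 2, inverse t ^ n * csqrt (1 - t ^ (2 * n))) \<noteq> 0" if "t \<in> ball 0 1 - {0}" for t :: complex
        using nz_A[OF aV_A, of t] that unfolding aV_def by blast
    qed auto
    moreover have "open (ball 0 1 - {0::complex})" by auto
    ultimately show ?thesis using t False by (metis Diff_iff continuous_on_eq_continuous_at empty_iff insert_iff)
  qed
  then show ?thesis by (simp add: continuous_at_imp_continuous_on)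
qed

lemma cV_formula_cont:
  assumes "continuous_on T f" "continuous_on T g" and f: "\<And>z. z \<in> T \<Longrightarrow> norm (f z) > 1"
  shows "continuous_on T (\<lambda>z. g z * inverse (f z) ^ (p + 1) / csqrt (1 - inverse (f z) ^ n))"
proof (intro continuous_intros assms(1,2) csqrt_cont ballI)
  fix z assume z: "z \<in> T"
  show "f z \<noteq> 0" using f[OF z] by auto
  show "f z \<noteq> 0" using f[OF z] by auto
  show q: "1 - inverse (f z) ^ n \<notin> \<real>\<^sub>\<le>\<^sub>0"
    using f[OF z] n by (intro one_minus_power) (auto simp: norm_inverse inverse_less_1_iff)
  show "csqrt (1 - inverse (f z) ^ n) \<noteq> 0" using q by auto
qed

text \<open>Away from \<open>0\<close> the formula for \<open>cV\<close> is continuous. Near \<open>0\<close> it is not usable; there \<open>cV\<close> is continuous as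
the inverse of a continuous bijection on a compact disc.\<close>
lemma cont_cV: "continuous_on (V 1) cV"
proof -
  \<comment> \<open>\<open>|x| > 4\<close> corresponds to \<open>|t| < 1/2\<close>\<close>
  have sub: "V 4 \<subseteq> V 1" by (auto simp: V_def)
  have im: "V 4 \<subseteq> pV ` cball 0 (1/2)"
  proof
    fix P assume P: "P \<in> V 4"
    have "norm (cV P) \<le> 1 / 2"
    proof (cases "P = 0")
      case False
      then have "norm (cV P) ^ 2 = inverse (norm (X P))" "norm (X P) > 4"
        using P cV_norm[of P] by (auto simp: V_def)
      then have "norm (cV P) ^ 2 \<le> (1 / 2) ^ 2" using le_imp_inverse_le[of 4 "norm (X P)"] by (simp add: power2_eq_square)
      then show ?thesis by (rule power2_le_imp_le) simp
    qed (simp add: cV_def)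
    then show "P \<in> pV ` cball 0 (1/2)"
      using pV_cV[of P] P sub by (intro image_eqI[of _ _ "cV P"]) auto
  qed
  have "continuous_on (pV ` cball 0 (1/2)) cV"
  proof (rule continuous_on_inv)
    show "continuous_on (cball 0 (1/2)) pV" by (rule continuous_on_subset[OF cont_pV]) auto
  qed auto
  then have 1: "continuous_on (V 4) cV" using im by (rule continuous_on_subset)
  have c: "continuous_on (V 1 - {0}) X" "continuous_on (V 1 - {0}) Y"
    by (rule continuous_on_subset[OF cont_XY(1)] continuous_on_subset[OF cont_XY(2)]; auto simp: V_def)+
  have V1: "norm (X P) > 1" if "P \<in> V 1 - {0}" for P using that by (auto simp: V_def)
  have 2: "continuous_on (V 1 - {0}) cV"
    unfolding cV_def by (rule cV_formula_cont[OF c V1])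
  have eq: "V 4 \<union> (V 1 - {0}) = V 1" using sub by (auto simp: V_def K_def)
  have V1K: "V 1 \<subseteq> K" by (auto simp: V_def)
  have o1: "openin (top_of_set (V 4 \<union> (V 1 - {0}))) (V 4)"
    unfolding eq using V_open[of 4] sub V1K by (rule openin_subset_trans)
  have "openin (top_of_set K) (V 1 \<inter> (- {0}))"
    using V_open[of 1] by (metis open_Compl closed_singleton openin_Int_open)
  then have o2: "openin (top_of_set (V 4 \<union> (V 1 - {0}))) (V 1 - {0})"
    unfolding eq using V1K by (simp add: Diff_eq openin_subset_trans)
  show ?thesis using continuous_on_Un_local_open[OF o1 o2 1 2] unfolding eq .
qed

lemma chart_onI:
  assumes Q: "openin (top_of_set K) Q" and D: "open D"
    and maps: "\<And>P. P \<in> Q \<Longrightarrow> \<phi> P \<in> D" "\<And>z. z \<in> D \<Longrightarrow> \<psi> z \<in> Q"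
    and inv: "\<And>P. P \<in> Q \<Longrightarrow> \<psi> (\<phi> P) = P" "\<And>z. z \<in> D \<Longrightarrow> \<phi> (\<psi> z) = z"
    and cont: "continuous_on Q \<phi>" "continuous_on D \<psi>"
  shows "chart_on (top_of_set K) (Q, \<phi>)" "\<phi> ` Q = D" "\<And>z. z \<in> D \<Longrightarrow> chart_inv (Q, \<phi>) z = \<psi> z"
    "top_of_set Q homeomorphic_space top_of_set D"
proof -
  show im: "\<phi> ` Q = D" using maps inv by (auto intro!: image_eqI[of _ \<phi> "\<psi> _"])
  have QK: "Q \<subseteq> K" using Q openin_imp_subset by blast
  have hm: "homeomorphic_maps (top_of_set Q) (top_of_set D) \<phi> \<psi>"
    using maps inv cont by (auto simp: homeomorphic_maps_def)
  then show "top_of_set Q homeomorphic_space top_of_set D" unfolding homeomorphic_space_def by blast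
  from hm have "homeomorphic_maps (top_of_set Q) (top_of_set D) \<phi> \<psi>" .
  then have "homeomorphic_map (top_of_set Q) (top_of_set D) \<phi>" using homeomorphic_map_maps by blast
  then show "chart_on (top_of_set K) (Q, \<phi>)"
    using Q D QK by (simp add: chart_on_def im subtopology_subtopology Int_absorb1 inf.absorb2)
  show "chart_inv (Q, \<phi>) z = \<psi> z" if z: "z \<in> D" for z
  proof -
    have "inj_on \<phi> Q" using inv(1) by (metis inj_onI)
    then show ?thesis using inv_into_f_f[of \<phi> Q "\<psi> z"] maps(2)[OF z] inv(2)[OF z] by (simp add: chart_inv_def)
  qed
qed

lemmas chart_U = chart_onI[OF U_open DU_open cU_DU pU_U pU_cU cU_pU cont_cU cont_pU]
lemmas chart_W = chart_onI[OF W_open DU_open cW_DU pW_W pW_cW cW_pW cont_cW cont_pW]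
lemmas chart_V = chart_onI[OF V_open[of 1] open_ball cV_ball pV_V pV_cV cV_pV cont_cV cont_pV]

definition surf :: "surface_point surface" where
  "surf = \<lparr>surf_top = top_of_set K, charts = {(U, cU), (W, cW), (V 1, cV)}\<rparr>"

lemma XY_U_holo: "(\<lambda>u. X (pU u)) holomorphic_on DU" "(\<lambda>u. Y (pU u)) holomorphic_on DU"
proof -
  have "(\<lambda>u. u * rt (u ^ n + 2 * \<i>)) holomorphic_on DU" "(\<lambda>u. u ^ n + \<i>) holomorphic_on DU"
    by (intro holomorphic_intros rt_holo upper_not_nonpos DU_upper; simp)+
  note h = this
  show "(\<lambda>u. X (pU u)) holomorphic_on DU" using h(1) by (rule holomorphic_transform) (simp add: XY_pU)
  show "(\<lambda>u. Y (pU u)) holomorphic_on DU" using h(2) by (rule holomorphic_transform) (simp add: XY_pU)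
qed

lemma XY_pW [simp]: "X (pW u) = X (pU u)" "Y (pW u) = - Y (pU u)"
  by (simp_all add: pW_def)

lemma XY_W_holo: "(\<lambda>u. X (pW u)) holomorphic_on DU" "(\<lambda>u. Y (pW u)) holomorphic_on DU"
  using XY_U_holo by (auto intro!: holomorphic_intros)

lemma XY_V_holo: "(\<lambda>t. X (pV t)) holomorphic_on ball 0 1 - {0}" "(\<lambda>t. Y (pV t)) holomorphic_on ball 0 1 - {0}"
proof -
  have "1 - t ^ (2 * n) \<notin> \<real>\<^sub>\<le>\<^sub>0" if "t \<in> ball 0 1 - {0}" for t :: complex
    by (rule one_minus_power) (use that n in auto)
  then show "(\<lambda>t. X (pV t)) holomorphic_on ball 0 1 - {0}" "(\<lambda>t. Y (pV t)) holomorphic_on ball 0 1 - {0}"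
    unfolding XY_pV by (intro holomorphic_intros holomorphic_on_csqrt'; simp)+
qed

text \<open>Holomorphy of a coordinate along a parametrised piece of the curve follows from that of \<open>X\<close> and \<open>Y\<close>,
which reduces all transition maps to the parametrisations.\<close>
lemma to_U_holo:
  assumes "(\<lambda>z. X (\<psi> z)) holomorphic_on T" "(\<lambda>z. Y (\<psi> z)) holomorphic_on T" "\<And>z. z \<in> T \<Longrightarrow> \<psi> z \<in> U"
  shows "(\<lambda>z. cU (\<psi> z)) holomorphic_on T"
  unfolding cU_def
proof (intro holomorphic_intros rt_holo upper_not_nonpos assms(1,2))
  show "0 < Im (Y (\<psi> z) + \<i>)" if "z \<in> T" for z using assms(3)[OF that] by (simp add: U_def)
qed auto

lemma to_W_holo:
  assumes "(\<lambda>z. X (\<psi> z)) holomorphic_on T" "(\<lambda>z. Y (\<psi> z)) holomorphic_on T" "\<And>z. z \<in> T \<Longrightarrow> \<psi> z \<in> W"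
  shows "(\<lambda>z. cW (\<psi> z)) holomorphic_on T"
  unfolding cW_def cU_def XY_flip
proof (intro holomorphic_intros rt_holo upper_not_nonpos assms(1,2))
  show "0 < Im (- Y (\<psi> z) + \<i>)" if "z \<in> T" for z using assms(3)[OF that] by (simp add: W_def)
qed auto

lemma to_V_holo:
  assumes "(\<lambda>z. X (\<psi> z)) holomorphic_on T" "(\<lambda>z. Y (\<psi> z)) holomorphic_on T" "\<And>z. z \<in> T \<Longrightarrow> \<psi> z \<in> V 1" "\<And>z. z \<in> T \<Longrightarrow> \<psi> z \<noteq> 0"
  shows "(\<lambda>z. cV (\<psi> z)) holomorphic_on T"
proof -
  have X: "norm (X (\<psi> z)) > 1" if "z \<in> T" for z using assms(3,4)[OF that] by (auto simp: V_def)
  have "norm (inverse (X (\<psi> z)) ^ n) < 1" if "z \<in> T" for z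
    using X[OF that] n by (intro norm_power_less_one) (auto simp: norm_inverse inverse_less_1_iff)
  then have q: "1 - inverse (X (\<psi> z)) ^ n \<notin> \<real>\<^sub>\<le>\<^sub>0" if "z \<in> T" for z using power_less_one_csqrt that by blast
  have x0: "X (\<psi> z) \<noteq> 0" if "z \<in> T" for z using X[OF that] by auto
  have q0: "csqrt (1 - inverse (X (\<psi> z)) ^ n) \<noteq> 0" if "z \<in> T" for z using q[OF that] by auto
  show ?thesis unfolding cV_def
    by (intro holomorphic_intros holomorphic_on_csqrt' assms(1,2) q x0 q0)
qed

lemma chart_inv_surf:
  "u \<in> DU \<Longrightarrow> chart_inv (U, cU) u = pU u" "u \<in> DU \<Longrightarrow> chart_inv (W, cW) u = pW u" "u \<in> ball 0 1 \<Longrightarrow> chart_inv (V 1, cV) u = pV u"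
  using chart_U(3) chart_W(3) chart_V(3) by blast+

text \<open>The point at infinity belongs to one chart only, so \<open>X\<close> and \<open>Y\<close> are finite and holomorphic on
every overlap of two different charts.\<close>
lemma transitions:
  assumes c: "c \<in> charts surf" and d: "d \<in> charts surf"
  shows "transition c d holomorphic_on snd c ` (fst c \<inter> fst d)"
proof -
  have *: "transition (Q, \<phi>) d holomorphic_on \<phi> ` (Q \<inter> fst d)"
    if Q: "\<And>P. P \<in> Q \<Longrightarrow> \<phi> P \<in> D" "\<And>P. P \<in> Q \<Longrightarrow> \<psi> (\<phi> P) = P" "\<And>z. z \<in> D \<Longrightarrow> chart_inv (Q, \<phi>) z = \<psi> z"
      and XY: "(\<lambda>z. X (\<psi> z)) holomorphic_on \<phi> ` (Q \<inter> fst d)" "(\<lambda>z. Y (\<psi> z)) holomorphic_on \<phi> ` (Q \<inter> fst d)"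
      and nz: "\<And>P. P \<in> Q \<Longrightarrow> P \<in> fst d \<Longrightarrow> P \<noteq> 0" for Q \<phi> \<psi> D
  proof -
    let ?T = "\<phi> ` (Q \<inter> fst d)"
    have in_d: "\<psi> z \<in> fst d" "\<psi> z \<noteq> 0" if "z \<in> ?T" for z using that Q nz by auto
    have "(\<lambda>z. snd d (\<psi> z)) holomorphic_on ?T"
      using d in_d to_U_holo[OF XY] to_W_holo[OF XY] to_V_holo[OF XY] by (auto simp: surf_def)
    then show ?thesis
      by (rule holomorphic_transform) (use Q in \<open>auto simp: transition_def\<close>)
  qed
  have 0: "0 \<notin> U" "0 \<notin> W" by (auto simp: U_def W_def)
  consider "c = (U, cU)" | "c = (W, cW)" | "c = (V 1, cV)" "d = (V 1, cV)" | "c = (V 1, cV)" "fst d = U \<or> fst d = W"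
    using c d by (auto simp: surf_def)
  then show ?thesis
  proof cases
    case 1
    have sub: "cU ` (U \<inter> fst d) \<subseteq> DU" using cU_DU by blast
    show ?thesis
      unfolding 1 fst_conv snd_conv
      by (rule *[OF cU_DU pU_cU chart_inv_surf(1) holomorphic_on_subset[OF XY_U_holo(1) sub] holomorphic_on_subset[OF XY_U_holo(2) sub]])
         (use 0 in auto)
  next
    case 2
    have sub: "cW ` (W \<inter> fst d) \<subseteq> DU" using cW_DU by blast
    show ?thesis
      unfolding 2 fst_conv snd_conv
      by (rule *[OF cW_DU pW_cW chart_inv_surf(2) holomorphic_on_subset[OF XY_W_holo(1) sub] holomorphic_on_subset[OF XY_W_holo(2) sub]])
         (use 0 in auto)
  next
    case 4
    have nz: "P \<noteq> 0" if "P \<in> fst d" for P using 4(2) that 0 by auto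
    have cnz: "cV P \<noteq> 0" if "P \<in> V 1" "P \<in> fst d" for P
    proof
      assume 0: "cV P = 0"
      have "P = pV (cV P)" by (rule pV_cV[OF that(1), symmetric])
      also have "\<dots> = 0" unfolding 0 by (rule pV_0)
      finally show False using nz[OF that(2)] by contradiction
    qed
    have sub: "cV ` (V 1 \<inter> fst d) \<subseteq> ball 0 1 - {0}"
    proof
      fix z assume "z \<in> cV ` (V 1 \<inter> fst d)"
      then obtain P where P: "P \<in> V 1" "P \<in> fst d" "z = cV P" by (auto elim!: imageE)
      show "z \<in> ball 0 1 - {0}" unfolding P(3) using cV_ball[OF P(1)] cnz[OF P(1,2)] by simp
    qed
    show ?thesis
      unfolding 4(1) fst_conv snd_conv
      by (rule *[OF cV_ball pV_cV chart_inv_surf(3) holomorphic_on_subset[OF XY_V_holo(1) sub] holomorphic_on_subset[OF XY_V_holo(2) sub]])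
         (use nz in auto)
  next
    case 3
    have "(\<lambda>z. z) holomorphic_on cV ` (V 1 \<inter> V 1)" by (intro holomorphic_intros)
    then show ?thesis unfolding 3 fst_conv snd_conv
    proof (rule holomorphic_transform)
      fix z assume "z \<in> cV ` (V 1 \<inter> V 1)"
      then obtain P where "P \<in> V 1" "z = cV P" by blast
      then show "z = transition (V 1, cV) (V 1, cV) z"
        by (simp add: transition_def chart_inv_surf(3)[OF cV_ball])
    qed
  qed
qed

lemma DU_scale: assumes "u \<in> DU" "0 \<le> s" "s \<le> 1" shows "complex_of_real s * u \<in> DU"
proof -
  have "Im ((complex_of_real s * u) ^ n) = s ^ n * Im (u ^ n)"
    by (simp add: power_mult_distrib flip: of_real_power)
  moreover have "s ^ n * Im (u ^ n) > -2"
  proof (cases "Im (u ^ n) \<ge> 0")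
    case True
    then have "s ^ n * Im (u ^ n) \<ge> 0" using assms by simp
    then show ?thesis by linarith
  next
    case False
    have "s ^ n \<le> 1" using assms by (simp add: power_le_one)
    then have "s ^ n * Im (u ^ n) \<ge> 1 * Im (u ^ n)" using False by (intro mult_right_mono_neg) auto
    then show ?thesis using assms(1) by (simp add: DU_def)
  qed
  ultimately show ?thesis by (simp add: DU_def)
qed

text \<open>Scaling \<open>u\<close> by \<open>s \<le> 1\<close> scales \<open>u\<^sup>n\<close> by \<open>s\<^sup>n \<le> 1\<close>.\<close>
lemma DU_starlike: "starlike DU"
  unfolding starlike_def
proof (intro bexI[of _ 0] ballI)
  fix u assume u: "u \<in> DU"
  show "closed_segment 0 u \<subseteq> DU"
    using DU_scale[OF u] by (auto simp: in_segment scaleR_conv_of_real)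
next
  show "0 \<in> DU" using n by (simp add: DU_def)
qed

lemma contractible_domains:
  "contractible_space (top_of_set U)" "contractible_space (top_of_set W)" "contractible_space (top_of_set (V 1))"
proof -
  have D: "contractible_space (top_of_set DU)"
    unfolding contractible_space_top_of_set by (rule starlike_imp_contractible[OF DU_starlike])
  have b: "contractible_space (top_of_set (ball (0::complex) 1))"
    unfolding contractible_space_top_of_set by (rule convex_imp_contractible[OF convex_ball])
  have hU: "top_of_set U homeomorphic_space top_of_set DU" by (rule chart_U(4))
  have hW: "top_of_set W homeomorphic_space top_of_set DU" by (rule chart_W(4))
  have hV: "top_of_set (V 1) homeomorphic_space top_of_set (ball (0::complex) 1)" by (rule chart_V(4))
  show "contractible_space (top_of_set U)" using D by (rule homeomorphic_space_contractibility[OF hU, THEN iffD2])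
  show "contractible_space (top_of_set W)" using D by (rule homeomorphic_space_contractibility[OF hW, THEN iffD2])
  show "contractible_space (top_of_set (V 1))" using b by (rule homeomorphic_space_contractibility[OF hV, THEN iffD2])
qed

definition point :: "complex \<Rightarrow> complex \<Rightarrow> complex \<times> complex" where
  "point x y = inversion (x, y)"

lemma point: assumes "x ^ n = y\<^sup>2 + 1"
  shows "point x y \<in> K" "point x y \<noteq> 0" "X (point x y) = x" "Y (point x y) = y"
proof -
  have "(x, y) \<in> A" using assms by (simp add: A_def)
  from inversion_in_K[OF this] show "point x y \<in> K" "point x y \<noteq> 0" by (auto simp: point_def)
qed (simp_all add: point_def)

lemma K_cover: "K = U \<union> W \<union> V 1" "K - {0} = U \<union> W"
  by (auto simp: U_def W_def V_def K_def)

lemma overlap_points: "U \<inter> W \<noteq> {}" "(U \<union> W) \<inter> V 1 \<noteq> {}"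
proof -
  have "point 1 0 \<in> U \<inter> W" using point[of 1 0] by (simp add: U_def W_def)
  then show "U \<inter> W \<noteq> {}" by blast
  define y where "y = csqrt (2 ^ n - 1)"
  have "y\<^sup>2 = 2 ^ n - 1" unfolding y_def by (rule power2_csqrt)
  then have "point 2 y \<in> K - {0}" "point 2 y \<in> V 1"
    using point[of 2 y] by (simp_all add: V_def)
  then have "point 2 y \<in> (U \<union> W) \<inter> V 1" by (simp add: K_cover(2)[symmetric])
  then show "(U \<union> W) \<inter> V 1 \<noteq> {}" by blast
qed

lemma K_connected: "connected K"
proof -
  have c: "connected U" "connected W" "connected (V 1)"
    using contractible_domains contractible_imp_connected by auto
  have "connected (U \<union> W)" by (rule connected_Un[OF c(1,2) overlap_points(1)])
  from connected_Un[OF this c(3) overlap_points(2)] show ?thesis by (simp only: K_cover(1)[symmetric])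
qed

lemma surf_simps [simp]: "surf_top surf = top_of_set K" "points surf = K" "charts surf = {(U, cU), (W, cW), (V 1, cV)}"
  by (simp_all add: surf_def)

lemma surf_riemann: "riemann_surface surf"
  unfolding riemann_surface_def
proof (intro conjI ballI)
  have "0 \<in> K" by (simp add: K_def)
  then show "points surf \<noteq> {}" by auto
  show "connected_space (surf_top surf)" using K_connected connectedin_def[of euclidean K] by simp
  show "Hausdorff_space (surf_top surf)" by (simp add: Hausdorff_space_subtopology)
  show "second_countable (surf_top surf)"
    unfolding surf_simps
    by (rule second_countable_subtopology[OF second_countable_euclidean])
  show "(\<Union>c\<in>charts surf. fst c) = points surf" using K_cover(1) by auto
  show "chart_on (surf_top surf) c" if "c \<in> charts surf" for c
    using that chart_U(1) chart_W(1) chart_V(1) by auto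
qed (rule transitions)

lemma surf_compact: "compact_space (surf_top surf)"
  using K_compact by (simp add: compact_space_subtopology)

end

section \<open>The genus of the superelliptic curve\<close>

context superelliptic
begin

definition \<eta> :: complex where "\<eta> = exp (2 * of_real pi * \<i> / of_nat n)"

lemma \<eta>_power_exp: "\<eta> ^ j = exp (2 * of_real pi * \<i> * of_nat j / of_nat n)"
  unfolding \<eta>_def exp_of_nat_mult[symmetric] by (simp add: field_simps)

lemma \<eta>_n: "\<eta> ^ n = 1"
  unfolding \<eta>_power_exp using n by simp

lemma norm_\<eta> [simp]: "norm \<eta> = 1"
  by (simp add: \<eta>_def)

lemma roots_unity: "{z::complex. z ^ n = 1} = (\<lambda>j. \<eta> ^ j) ` {..<n}"
  using complex_roots_unity[of n] n unfolding \<eta>_power_exp by auto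

text \<open>The automorphism \<open>x \<mapsto> \<eta>x\<close> of the curve; it acts linearly on \<open>\<complex>\<^sup>2\<close> and commutes with inversion.\<close>
definition \<sigma> :: "complex \<times> complex \<Rightarrow> complex \<times> complex" where
  "\<sigma> P = (\<eta> * fst P, snd P)"

lemma norm_\<sigma> [simp]: "norm (\<sigma> P) = norm P"
  by (cases P) (simp add: \<sigma>_def norm_Pair norm_mult)

lemma inversion_\<sigma>: "inversion (\<sigma> P) = \<sigma> (inversion P)"
proof -
  have "inversion (\<sigma> P) = inverse ((norm P)\<^sup>2) *\<^sub>R \<sigma> P" by (simp add: inversion_def)
  also have "\<dots> = \<sigma> (inversion P)" by (simp add: inversion_def \<sigma>_def)
  finally show ?thesis .
qed

lemma XY_\<sigma> [simp]: "X (\<sigma> P) = \<eta> * X P" "Y (\<sigma> P) = Y P"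
  by (simp_all add: inversion_\<sigma>) (simp_all add: \<sigma>_def)

lemma \<sigma>_eq_0 [simp]: "\<sigma> P = 0 \<longleftrightarrow> P = 0"
  by (metis norm_\<sigma> norm_eq_zero)

lemma \<sigma>_K: "P \<in> K \<Longrightarrow> \<sigma> P \<in> K"
proof -
  assume P: "P \<in> K"
  show "\<sigma> P \<in> K"
  proof (cases "P = 0")
    case True then show ?thesis by (simp add: K_def)
  next
    case False
    have "(X (\<sigma> P)) ^ n = (Y (\<sigma> P))\<^sup>2 + 1" using K_eq[OF P False] by (simp add: power_mult_distrib \<eta>_n)
    then have "inversion (\<sigma> P) \<in> A" by (simp add: A_def split_beta)
    then show ?thesis by (rule in_K)
  qed
qed

lemma \<sigma>_maps: "P \<in> U \<Longrightarrow> \<sigma> P \<in> U" "P \<in> W \<Longrightarrow> \<sigma> P \<in> W" "P \<in> V R \<Longrightarrow> \<sigma> P \<in> V R"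
  using \<sigma>_K[of P] by (auto simp: U_def W_def V_def norm_mult)

lemma cont_\<sigma>: "continuous_on B \<sigma>"
  unfolding \<sigma>_def by (intro continuous_intros)

lemma inverse_\<eta>_power: "inverse (\<eta> ^ p) ^ 2 = \<eta>"
proof -
  have "(\<eta> ^ p) ^ 2 * \<eta> = \<eta> ^ n" by (simp add: n_def power_mult mult.commute flip: power_mult)
  then have e: "(\<eta> ^ p) ^ 2 * \<eta> = 1" by (simp add: \<eta>_n)
  have "inverse (\<eta> ^ p) ^ 2 = inverse ((\<eta> ^ p) ^ 2)" by (rule power_inverse)
  also have "\<dots> = \<eta>" using e by (rule inverse_unique)
  finally show ?thesis .
qed

text \<open>In the coordinate \<open>t\<close> with \<open>x = t\<^sup>-\<^sup>2\<close> the automorphism is a rotation by a square root of \<open>\<eta>\<inverse>\<close>,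
and \<open>\<eta>\<^sup>p\<close> is the square root that is an \<open>n\<close>th root of unity, so that \<open>t\<^sup>n\<close> and hence \<open>y\<close> are preserved.\<close>
lemma \<sigma>_pV: assumes t: "t \<in> ball 0 1" shows "\<sigma> (pV t) = pV (\<eta> ^ p * t)"
proof -
  have "(\<eta> ^ p) ^ n = (\<eta> ^ n) ^ p" by (simp only: power_mult[symmetric] mult.commute)
  then have pn: "(\<eta> ^ p) ^ n = 1" by (simp add: \<eta>_n)
  then have p2n: "(\<eta> ^ p) ^ (2 * n) = 1" by (simp only: mult.commute[of 2] power_mult power_one)
  have "inversion (\<sigma> (pV t)) = \<sigma> (aV t)" by (simp add: inversion_\<sigma> pV_def)
  also have "\<dots> = aV (\<eta> ^ p * t)"
  proof -
    have "inverse (\<eta> ^ p * t) ^ 2 = \<eta> * inverse t ^ 2"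
      unfolding inverse_mult_distrib power_mult_distrib inverse_\<eta>_power ..
    moreover have "inverse (\<eta> ^ p * t) ^ n = inverse t ^ n"
      unfolding inverse_mult_distrib power_mult_distrib power_inverse[of "\<eta> ^ p"] pn by simp
    moreover have "(\<eta> ^ p * t) ^ (2 * n) = t ^ (2 * n)"
      unfolding power_mult_distrib p2n by simp
    ultimately show ?thesis unfolding aV_def \<sigma>_def by simp
  qed
  finally have "inversion (inversion (\<sigma> (pV t))) = inversion (aV (\<eta> ^ p * t))" by (rule arg_cong)
  then show ?thesis by (simp add: pV_def)
qed

lemma pV_eq_0: "t \<in> ball 0 1 \<Longrightarrow> pV t = 0 \<longleftrightarrow> t = 0"
  by (metis cV_pV pV_0 centre_in_ball zero_less_one)

lemma V_minus: "V 1 - {0} = pV ` (ball 0 1 - {0})"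
proof (intro equalityI subsetI)
  fix P assume P: "P \<in> V 1 - {0}"
  then have "pV (cV P) = P" "cV P \<in> ball 0 1" using pV_cV cV_ball by auto
  moreover have "cV P \<noteq> 0" using P \<open>pV (cV P) = P\<close> by (metis DiffE pV_0 singletonI)
  ultimately show "P \<in> pV ` (ball 0 1 - {0})" by (metis DiffI image_eqI singletonD)
next
  fix P assume "P \<in> pV ` (ball 0 1 - {0})"
  then show "P \<in> V 1 - {0}" using pV_V pV_eq_0 by auto
qed

lemma path_connected_V_minus: "path_connected (V 1 - {0})"
  unfolding V_minus
proof (rule path_connected_continuous_image)
  show "continuous_on (ball 0 1 - {0}) pV" using cont_pV by (rule continuous_on_subset) auto
  show "path_connected (ball 0 1 - {0::complex})" by (rule path_connected_punctured_ball) simp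
qed

text \<open>A rotation of a punctured disc can be unwound.\<close>
lemma \<sigma>_homotopic_id: "homotopic_with (\<lambda>_. True) (top_of_set (V 1 - {0})) (top_of_set (V 1 - {0})) \<sigma> id"
proof -
  define \<theta> where "\<theta> = 2 * pi * real p / real n"
  have e: "exp (\<i> * of_real \<theta>) = \<eta> ^ p" unfolding \<eta>_power_exp \<theta>_def by (simp add: mult_ac)
  define h where "h = (\<lambda>(s, P). pV (exp (\<i> * of_real (s * \<theta>)) * cV P))"
  have rot: "exp (\<i> * of_real (s * \<theta>)) * cV P \<in> ball 0 1" if "P \<in> V 1" for s P
    using cV_ball[OF that] by (simp add: norm_mult)
  have cV0: "cV P \<noteq> 0" if "P \<in> V 1 - {0}" for P
    using that pV_cV[of P] by (metis DiffE pV_0 singletonI)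
  have "continuous_on ({0..1} \<times> (V 1 - {0})) h"
    unfolding h_def split_beta
  proof (rule continuous_on_compose2[OF cont_pV])
    have c: "continuous_on (V 1 - {0}) cV" using cont_cV by (rule continuous_on_subset) auto
    have "continuous_on ({0..1} \<times> (V 1 - {0})) (\<lambda>z. cV (snd z))"
      by (rule continuous_on_compose2[OF c]) (auto intro!: continuous_intros)
    then show "continuous_on ({0..1} \<times> (V 1 - {0})) (\<lambda>z. exp (\<i> * of_real (fst z * \<theta>)) * cV (snd z))"
      by (intro continuous_intros)
  qed (use rot in auto)
  moreover have "h ` ({0..1} \<times> (V 1 - {0})) \<subseteq> V 1 - {0}"
    using pV_V[OF rot] pV_eq_0[OF rot] cV0 by (auto simp: h_def)
  ultimately have c: "continuous_map (prod_topology (top_of_set {0..1}) (top_of_set (V 1 - {0}))) (top_of_set (V 1 - {0})) h"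
    by auto
  have h0: "h (0, P) = P" if "P \<in> V 1 - {0}" for P using that by (simp add: h_def)
  have h1: "h (1, P) = \<sigma> P" if P: "P \<in> V 1 - {0}" for P
  proof -
    have "h (1, P) = pV (\<eta> ^ p * cV P)" by (simp add: h_def e)
    also have "\<dots> = \<sigma> (pV (cV P))" using P cV_ball by (intro \<sigma>_pV[symmetric]) auto
    also have "\<dots> = \<sigma> P" using P by simp
    finally show ?thesis .
  qed
  have "homotopic_with (\<lambda>_. True) (top_of_set (V 1 - {0})) (top_of_set (V 1 - {0})) id \<sigma>"
    by (subst homotopic_with) (use c h0 h1 in \<open>auto intro!: exI[of _ h]\<close>)
  then show ?thesis by (rule homotopic_with_symD)
qed

text \<open>Over the strip \<open>|Im y| < 1\<close> the function \<open>1 + y\<^sup>2\<close> has a holomorphic \<open>n\<close>th root, and \<open>x\<close> is that root times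
an \<open>n\<close>th root of unity.\<close>
definition sheet :: "complex \<times> complex \<Rightarrow> complex" where
  "sheet P = X P / rt (1 + (Y P)\<^sup>2)"

lemma strip_not_nonpos: assumes "\<bar>Im y\<bar> < 1" shows "1 + y\<^sup>2 \<notin> \<real>\<^sub>\<le>\<^sub>0"
proof
  assume "1 + y\<^sup>2 \<in> \<real>\<^sub>\<le>\<^sub>0"
  then have *: "1 + ((Re y)\<^sup>2 - (Im y)\<^sup>2) \<le> 0" by (simp add: complex_nonpos_Reals_iff Re_power2)
  have "(Im y)\<^sup>2 < 1" using assms by (simp add: abs_square_less_1)
  then show False using * zero_le_power2[of "Re y"] by linarith
qed

lemma strip: "P \<in> U \<inter> W \<Longrightarrow> \<bar>Im (Y P)\<bar> < 1"
  by (auto simp: U_def W_def)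

lemma sheet_power: assumes "P \<in> U \<inter> W" shows "sheet P ^ n = 1"
proof -
  have nz: "1 + (Y P)\<^sup>2 \<noteq> 0" using strip_not_nonpos[OF strip[OF assms]] by auto
  have "X P ^ n = 1 + (Y P)\<^sup>2" using K_eq[of P] assms by (auto simp: U_def)
  then show ?thesis using nz by (simp add: sheet_def power_divide rt_power)
qed

lemma cont_sheet: "continuous_on (U \<inter> W) sheet"
proof -
  have "continuous_on (U \<inter> W) X" "continuous_on (U \<inter> W) Y"
    by (rule continuous_on_subset[OF cont_XY(1)] continuous_on_subset[OF cont_XY(2)]; auto simp: U_def)+
  note c = this
  show ?thesis unfolding sheet_def
    by (intro continuous_on_divide c(1) rt_cont continuous_on_add continuous_on_const continuous_on_power c(2) strip_not_nonpos strip ballI rt_nz)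
qed

lemma sheet_image: "sheet ` (U \<inter> W) = {z. z ^ n = 1}"
proof (intro equalityI subsetI)
  fix z :: complex assume "z \<in> {z. z ^ n = 1}"
  then have "z ^ n = 0\<^sup>2 + 1" by simp
  note P = point[OF this]
  have "point z 0 \<in> U \<inter> W" using P by (simp add: U_def W_def)
  moreover have "sheet (point z 0) = z" using P by (simp add: sheet_def rt_def)
  ultimately show "z \<in> sheet ` (U \<inter> W)" by (metis imageI)
qed (use sheet_power in auto)

text \<open>Each sheet is the graph of a continuous function over the strip.\<close>
lemma sheet_fibre_path_connected: "path_connected {P \<in> U \<inter> W. sheet P = k}"
proof (cases "k ^ n = 1")
  case False
  then have "{P \<in> U \<inter> W. sheet P = k} = {}" using sheet_power by blast
  then show ?thesis by (simp only: path_connected_empty)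
next
  case True
  let ?S = "{y. Im y < 1} \<inter> {y. Im y > -1}"
  define g where "g y = inversion (k * rt (1 + y\<^sup>2), y)" for y
  have st: "1 + y\<^sup>2 \<notin> \<real>\<^sub>\<le>\<^sub>0" if "y \<in> ?S" for y using that by (intro strip_not_nonpos) auto
  have gA: "(k * rt (1 + y\<^sup>2)) ^ n = y\<^sup>2 + 1" if "y \<in> ?S" for y
  proof -
    have "1 + y\<^sup>2 \<noteq> 0" using st[OF that] by auto
    then show ?thesis by (simp add: power_mult_distrib True rt_power)
  qed
  have gp: "g y = point (k * rt (1 + y\<^sup>2)) y" for y by (simp add: g_def point_def)
  have "continuous_on ?S g"
    unfolding g_def
  proof (intro continuous_on_inversion_comp continuous_intros rt_cont st)
    show "(k * rt (1 + y\<^sup>2), y) \<noteq> 0" if "y \<in> ?S" for y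
    proof -
      have "(k * rt (1 + y\<^sup>2), y) \<in> A" using gA[OF that] by (simp add: A_def)
      then show ?thesis by (rule nz_A)
    qed
  qed
  moreover have "path_connected ?S"
    by (intro convex_imp_path_connected convex_Int convex_halfspace_Im_lt convex_halfspace_Im_gt)
  ultimately have "path_connected (g ` ?S)" by (rule path_connected_continuous_image)
  moreover have "g ` ?S = {P \<in> U \<inter> W. sheet P = k}"
  proof (intro equalityI subsetI)
    fix P assume "P \<in> g ` ?S"
    then obtain y where y: "y \<in> ?S" "P = g y" by blast
    note pt = point[OF gA[OF y(1)], folded gp]
    show "P \<in> {P \<in> U \<inter> W. sheet P = k}" unfolding y(2)
      using pt y(1) by (simp add: U_def W_def sheet_def)
  next
    fix P assume "P \<in> {P \<in> U \<inter> W. sheet P = k}"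
    then have P: "P \<in> U \<inter> W" "sheet P = k" by auto
    then have "k * rt (1 + (Y P)\<^sup>2) = X P" by (auto simp: sheet_def)
    then have "g (Y P) = P" by (simp add: g_def)
    moreover have "Y P \<in> ?S" using strip[OF P(1)] by auto
    ultimately show "P \<in> g ` ?S" by (metis imageI)
  qed
  ultimately show ?thesis by simp
qed

lemma roots_finite: "finite {z::complex. z ^ n = 1}"
  unfolding roots_unity by simp

lemma sheet_path_invariant:
  assumes "pathin (top_of_set (U \<inter> W)) g"
  shows "sheet (g 0) = sheet (g 1)"
proof -
  have g: "continuous_on {0..1} g" "g ` {0..1} \<subseteq> U \<inter> W"
    using assms by (auto simp: pathin_def)
  have "continuous_on {0..1} (\<lambda>t. sheet (g t))"
    by (rule continuous_on_compose2[OF cont_sheet g])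
  then have "connected ((\<lambda>t. sheet (g t)) ` {0..1})" by (rule connected_continuous_image) simp
  moreover have "finite ((\<lambda>t. sheet (g t)) ` {0..1})"
    by (rule finite_subset[OF _ roots_finite]) (use g(2) sheet_power in blast)
  ultimately obtain a where "(\<lambda>t. sheet (g t)) ` {0..1} = {a}"
    by (metis (no_types, lifting) atLeastAtMost_iff connected_finite_iff_sing empty_iff imageI less_eq_real_def zero_less_one order_refl)
  then show ?thesis by (metis (no_types, lifting) atLeastAtMost_iff imageI order_refl singletonD zero_le_one)
qed

text \<open>The automorphism multiplies the label of a sheet by the primitive root of unity \<open>\<eta>\<close>.\<close>
lemma reduced_homology_fixed_trivial:
  assumes "z \<in> carrier (reduced_homology_group 0 (top_of_set (U \<inter> W)))"
    "hom_induced 0 (top_of_set (U \<inter> W)) {} (top_of_set (U \<inter> W)) {} \<sigma> z = z"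
  shows "z = \<one>\<^bsub>homology_group 0 (top_of_set (U \<inter> W))\<^esub>"
proof (rule reduced_zeroth_homology_transitive_fixed[OF _ _ _ _ _ _ _ assms, of sheet "\<lambda>z. \<eta> * z"])
  show "path_connectedin (top_of_set (U \<inter> W)) {x \<in> topspace (top_of_set (U \<inter> W)). sheet x = k}" for k
    using sheet_fibre_path_connected[of k] by (auto simp: path_connectedin_subtopology)
  show "finite (sheet ` topspace (top_of_set (U \<inter> W)))" using roots_finite by (simp add: sheet_image)
  show "continuous_map (top_of_set (U \<inter> W)) (top_of_set (U \<inter> W)) \<sigma>"
    using cont_\<sigma> \<sigma>_maps by auto
  show "inj (\<lambda>z. \<eta> * z)"
  proof -
    have "\<eta> \<noteq> 0" using norm_\<eta> by (metis norm_zero zero_neq_one)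
    then show ?thesis by (simp add: inj_def)
  qed
  show "sheet (\<sigma> x) = \<eta> * sheet x" for x by (simp add: sheet_def)
  fix B assume B: "B \<subseteq> sheet ` topspace (top_of_set (U \<inter> W))" "B \<noteq> {}" "(\<lambda>z. \<eta> * z) ` B \<subseteq> B"
  then have B': "B \<subseteq> {z. z ^ n = 1}" by (simp add: sheet_image)
  obtain b where b: "b \<in> B" using B(2) by blast
  have pw: "\<eta> ^ j * b \<in> B" for j
    by (induction j) (use b B(3) in \<open>auto simp: mult.assoc image_subset_iff\<close>)
  have bn: "b ^ n = 1" using b B' by blast
  then have b0: "b \<noteq> 0" using n by (metis power_0_left zero_neq_one not_gr0)
  have "{z. z ^ n = 1} \<subseteq> B"
  proof
    fix z :: complex assume "z \<in> {z. z ^ n = 1}"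
    then have "(z / b) ^ n = 1" by (simp add: power_divide bn)
    then obtain j where "z / b = \<eta> ^ j" using roots_unity by blast
    then have "z = \<eta> ^ j * b" using b0 by (simp add: field_simps)
    then show "z \<in> B" using pw by simp
  qed
  then show "B = sheet ` topspace (top_of_set (U \<inter> W))" using B' by (simp add: sheet_image)
qed (rule sheet_path_invariant)

text \<open>There are \<open>n\<close> sheets over the strip, so the affine part has first homology of rank \<open>n - 1 = 2p\<close>, and the point at
infinity does not change it.\<close>
theorem genus: "has_genus surf p"
proof -
  let ?X = "top_of_set K" and ?A = "top_of_set (K - {0})"
  have sub: "U \<subseteq> K - {0}" "W \<subseteq> K - {0}" "V 1 \<subseteq> K" by (auto simp: U_def W_def V_def)
  have subA: "subtopology ?X (K - {0}) = ?A" by (simp add: subtopology_subtopology inf.absorb2)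
  have UA: "subtopology ?A U = top_of_set U" "subtopology ?A W = top_of_set W" "subtopology ?A (U \<inter> W) = top_of_set (U \<inter> W)"
    using sub by (auto simp: subtopology_subtopology inf.absorb2 le_infI1)
  have oU: "openin ?A U" "openin ?A W"
    using U_open W_open sub(1,2) by (auto intro: openin_subset_trans)
  have cov: "U \<union> W = topspace ?A" using K_cover(2) by simp
  have con: "contractible_space (subtopology ?A U)" "contractible_space (subtopology ?A W)"
    unfolding UA by (rule contractible_domains)+
  note two = homology_one_two_contractibles[OF oU cov con overlap_points(1), unfolded UA]
  have \<sigma>A: "continuous_map ?A ?A \<sigma>" using cont_\<sigma> \<sigma>_K by auto
  have fixed: "c = \<one>\<^bsub>homology_group 1 (subtopology ?X (K - {0}))\<^esub>"
    if "c \<in> carrier (homology_group 1 (subtopology ?X (K - {0})))"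
      "hom_induced 1 (subtopology ?X (K - {0})) {} (subtopology ?X (K - {0})) {} \<sigma> c = c" for c
    unfolding subA
    by (rule two(2)[OF \<sigma>A]) (use that reduced_homology_fixed_trivial \<sigma>_maps in \<open>auto simp: subA\<close>)
  have VA: "V 1 \<inter> (K - {0}) = V 1 - {0}" using sub(3) by blast
  have subV: "subtopology ?X (V 1) = top_of_set (V 1)" "subtopology ?X (V 1 \<inter> (K - {0})) = top_of_set (V 1 - {0})"
  proof -
    have "K \<inter> (V 1 - {0}) = V 1 - {0}" "K \<inter> V 1 = V 1" using sub(3) by blast+
    then show "subtopology ?X (V 1) = top_of_set (V 1)" "subtopology ?X (V 1 \<inter> (K - {0})) = top_of_set (V 1 - {0})"
      unfolding VA by (simp_all only: subtopology_subtopology)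
  qed
  have "homology_group 1 ?X \<cong> homology_group 1 (subtopology ?X (K - {0}))"
  proof (rule homology_one_close_up[where I = "V 1" and f = \<sigma>])
    show "openin ?X (K - {0})" by (metis Diff_eq closed_singleton open_Compl openin_open_Int)
    show "openin ?X (V 1)" by (rule V_open)
    show "K - {0} \<union> V 1 = topspace ?X" using K_cover by auto
    show "contractible_space (subtopology ?X (V 1))" unfolding subV by (rule contractible_domains)
    show "path_connectedin ?X (V 1 \<inter> (K - {0}))"
      unfolding VA using path_connected_V_minus sub(3) by (auto simp: path_connectedin_subtopology)
    show "V 1 \<inter> (K - {0}) \<noteq> {}" using overlap_points(2) by (auto simp flip: K_cover(2))
    show "continuous_map ?X ?X \<sigma>" using cont_\<sigma> \<sigma>_K by auto
    show "\<sigma> \<in> K - {0} \<rightarrow> K - {0}" "\<sigma> \<in> V 1 \<rightarrow> V 1" using \<sigma>_K \<sigma>_maps by auto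
    show "homotopic_with (\<lambda>_. True) (subtopology ?X (V 1 \<inter> (K - {0}))) (subtopology ?X (V 1 \<inter> (K - {0}))) \<sigma> id"
      unfolding subV by (rule \<sigma>_homotopic_id)
  qed (rule fixed)
  also have "homology_group 1 (subtopology ?X (K - {0})) \<cong> reduced_homology_group 0 (top_of_set (U \<inter> W))"
    unfolding subA by (rule two(1))
  also have "reduced_homology_group 0 (top_of_set (U \<inter> W)) \<cong> free_Abelian_group (sheet ` topspace (top_of_set (U \<inter> W)) - {1})"
  proof (rule reduced_zeroth_homology_sheets[OF sheet_path_invariant])
    show "path_connectedin (top_of_set (U \<inter> W)) {x \<in> topspace (top_of_set (U \<inter> W)). sheet x = k}" for k
      using sheet_fibre_path_connected[of k] by (auto simp: path_connectedin_subtopology)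
    show "1 \<in> sheet ` topspace (top_of_set (U \<inter> W))" by (simp add: sheet_image)
  qed
  also have "free_Abelian_group (sheet ` topspace (top_of_set (U \<inter> W)) - {1}) \<cong> free_Abelian_group {..<2 * p}"
    unfolding isomorphic_free_Abelian_groups
  proof -
    have "card (sheet ` topspace (top_of_set (U \<inter> W)) - {1}) = 2 * p"
      using card_complex_roots_unity[of n] n roots_finite by (simp add: sheet_image card_Diff_singleton n_def)
    moreover have "finite (sheet ` topspace (top_of_set (U \<inter> W)) - {1})" using roots_finite by (simp add: sheet_image)
    ultimately show "sheet ` topspace (top_of_set (U \<inter> W)) - {1} \<approx> {..<2 * p}"
      by (simp add: eqpoll_iff_card)
  qed
  finally show ?thesis by (simp add: has_genus_def)
qed

end

section \<open>A meromorphic function with many zeros\<close>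

text \<open>A continuous function with finitely many values is constant on each connected component.\<close>
lemma card_components_ge:
  assumes h: "continuous_map X euclidean (h :: 'a \<Rightarrow> 'b::metric_space)" and T: "finite T" "h ` topspace X = T"
  shows "infinite (connected_components_of X) \<or> card T \<le> card (connected_components_of X)"
proof (cases "finite (connected_components_of X)")
  case fin: True
  have "\<exists>C. C \<in> connected_components_of X \<and> h ` C = {t}" if t: "t \<in> T" for t
  proof -
    obtain x where x: "x \<in> topspace X" "h x = t" using t T(2) by blast
    let ?C = "connected_component_of_set X x"
    have C: "?C \<in> connected_components_of X" using x by (simp add: connected_components_of_def)
    have "connectedin X ?C" by (rule connectedin_connected_component_of)
    then have "connected (h ` ?C)" using connectedin_continuous_map_image[OF h] by fastforce
    moreover have "finite (h ` ?C)"
      using T connected_component_of_subset_topspace[of X x] by (metis finite_subset image_mono)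
    moreover have "x \<in> ?C" using x by (simp add: connected_component_of_refl)
    ultimately have "h ` ?C = {t}"
      using connected_finite_iff_sing[of "h ` ?C"] x(2) by (metis empty_iff image_eqI singletonD)
    then show ?thesis using C by blast
  qed
  then obtain c where c: "\<And>t. t \<in> T \<Longrightarrow> c t \<in> connected_components_of X" "\<And>t. t \<in> T \<Longrightarrow> h ` c t = {t}"
    by metis
  have "inj_on c T" by (metis c(2) inj_onI singleton_inject)
  then have "card T \<le> card (connected_components_of X)"
    by (rule card_inj_on_le) (use c(1) fin in auto)
  then show ?thesis ..
qed simp

locale superelliptic_map = superelliptic +
  fixes d :: nat
  assumes d: "d \<ge> 1"
begin

text \<open>At the point at infinity \<open>X = 0\<close> by default, and \<open>inverse 0 = 0\<close>, so \<open>v\<close> and \<open>f\<close> take their correct values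
\<open>0\<close> and \<open>- 2 * 2 ^ d\<close> there. At the poles \<open>v\<close> has the default value \<open>0\<close>, for the same reason. The constants place the zeros at
\<open>|x| = 1/2\<close>, away from the critical points of \<open>x\<close>, and make the critical values of \<open>f\<close> at least \<open>2\<close> in absolute value.\<close>
definition v :: "complex \<times> complex \<Rightarrow> complex" where "v P = inverse (X P)"
definition f :: "complex \<times> complex \<Rightarrow> complex" where "f P = 2 * (v P ^ d - 2 ^ d)"
definition zeros where "zeros = {P \<in> K. P \<noteq> 0 \<and> X P ^ d = inverse (2 ^ d)}"
definition poles where "poles = {P \<in> K. P \<noteq> 0 \<and> X P = 0}"

lemma root_of_square_card: "c \<noteq> 0 \<Longrightarrow> finite {y::complex. y\<^sup>2 = c} \<and> card {y::complex. y\<^sup>2 = c} = 2"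
  using card_nth_roots[of c 2] finite_nth_roots[of 2 c] by simp

text \<open>Over each \<open>x\<close> with \<open>x\<^sup>n \<noteq> 1\<close> the curve has two points.\<close>
lemma fibre_card:
  assumes "finite R" "\<And>x. x \<in> R \<Longrightarrow> x ^ n \<noteq> 1"
  shows "finite {P \<in> K. P \<noteq> 0 \<and> X P \<in> R}" "card {P \<in> K. P \<noteq> 0 \<and> X P \<in> R} = 2 * card R"
proof -
  let ?D = "SIGMA x:R. {y. y\<^sup>2 = x ^ n - 1}"
  have fc: "finite {y. y\<^sup>2 = x ^ n - 1} \<and> card {y. y\<^sup>2 = x ^ n - 1} = 2" if "x \<in> R" for x
    using root_of_square_card[of "x ^ n - 1"] assms(2)[OF that] by simp
  have D: "finite ?D" using assms(1) fc by (intro finite_SigmaI) auto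
  have "card ?D = 2 * card R" using assms(1) fc by (subst card_SigmaI) auto
  moreover have eq: "{P \<in> K. P \<noteq> 0 \<and> X P \<in> R} = inversion ` ?D"
  proof (intro equalityI subsetI)
    fix P assume P: "P \<in> {P \<in> K. P \<noteq> 0 \<and> X P \<in> R}"
    then have "X P ^ n = (Y P)\<^sup>2 + 1" using K_eq by blast
    then have "(X P, Y P) \<in> ?D" using P by (intro SigmaI) auto
    then have "inversion P \<in> ?D" by (simp only: prod.collapse)
    then show "P \<in> inversion ` ?D" by (metis image_eqI inversion_inversion)
  next
    fix P assume "P \<in> inversion ` ?D"
    then obtain x y where "x \<in> R" "y\<^sup>2 = x ^ n - 1" "P = point x y" by (auto simp: point_def)
    then show "P \<in> {P \<in> K. P \<noteq> 0 \<and> X P \<in> R}" using point[of x y] by simp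
  qed
  moreover have "inj_on inversion ?D" by (metis inj_onI inversion_inversion)
  ultimately show "finite {P \<in> K. P \<noteq> 0 \<and> X P \<in> R}" "card {P \<in> K. P \<noteq> 0 \<and> X P \<in> R} = 2 * card R"
    using D by (simp_all add: card_image)
qed

lemma norm_power_half: assumes "norm (x::complex) ^ d = inverse (2 ^ d)" shows "norm x = 1 / 2"
proof -
  have "norm x ^ d = (1 / 2) ^ d" using assms by (simp add: power_divide inverse_eq_divide)
  then show ?thesis by (rule power_eq_imp_eq_base) (use d in auto)
qed

lemma zeros_poles_card: "finite zeros" "finite poles" "card zeros = 2 * d" "card poles = 2"
proof -
  let ?R = "{x::complex. x ^ d = inverse (2 ^ d)}"
  have R: "finite ?R" "card ?R = d"
    using card_nth_roots[of "inverse (2 ^ d)" d] finite_nth_roots[of d "inverse (2 ^ d)"] d by auto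
  have ne: "x ^ n \<noteq> 1" if "x \<in> ?R" for x :: complex
  proof
    assume x: "x ^ n = 1"
    have "norm x = 1 / 2" using that by (intro norm_power_half) (simp flip: norm_power, simp add: norm_inverse norm_power)
    then have "norm (x ^ n) = (1 / 2) ^ n" by (simp only: norm_power)
    moreover have "(1 / 2 :: real) ^ n < 1" using n by (simp add: power_less_one_iff)
    ultimately show False using x by simp
  qed
  have zp: "zeros = {P \<in> K. P \<noteq> 0 \<and> X P \<in> ?R}" "poles = {P \<in> K. P \<noteq> 0 \<and> X P \<in> {0}}"
    unfolding zeros_def poles_def by simp_all
  have ne0: "x ^ n \<noteq> 1" if "x \<in> {0}" for x :: complex
    using that n by (simp add: power_0_left)
  show "finite zeros" "card zeros = 2 * d"
    unfolding zp(1) using fibre_card[OF R(1)] ne unfolding R(2) by blast+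
  have "finite {0::complex}" by simp
  then show "finite poles" "card poles = 2"
    unfolding zp(2) using fibre_card[of "{0}"] ne0 by (simp_all del: singleton_iff)
qed

lemma zeros_sub: "zeros \<union> poles \<subseteq> K" "zeros \<inter> poles = {}"
  using d by (auto simp: zeros_def poles_def power_0_left)

lemma norm_f: "norm (f P) = 2 * norm (v P ^ d - 2 ^ d)"
  by (simp only: f_def norm_mult) simp

lemma f_eq_0: "f P = 0 \<longleftrightarrow> X P ^ d = inverse (2 ^ d)"
proof -
  have "f P = 0 \<longleftrightarrow> inverse (X P ^ d) = 2 ^ d" by (simp add: f_def v_def power_inverse)
  also have "\<dots> \<longleftrightarrow> X P ^ d = inverse (2 ^ d)" by (metis inverse_inverse_eq)
  finally show ?thesis .
qed

lemma f_0 [simp]: "f 0 = - (2 * 2 ^ d)"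
  using d by (simp add: f_def v_def power_0_left)

lemma f_nonzero: "P \<in> K - (zeros \<union> poles) \<Longrightarrow> f P \<noteq> 0"
  by (cases "P = 0") (auto simp: f_eq_0 zeros_def)

text \<open>The part of the image of a chart on which \<open>v\<close> has no pole. In both affine charts \<open>x = 0\<close> is the centre.\<close>
definition G :: "(complex \<times> complex) chart \<Rightarrow> complex set" where
  "G c = (if c = (V 1, cV) then ball 0 1 else DU - {0})"

lemma Vne: "(U, cU) \<noteq> (V 1, cV)" "(W, cW) \<noteq> (V 1, cV)"
  by (auto simp: U_def W_def V_def K_def)

lemma G_simps: "G (U, cU) = DU - {0}" "G (W, cW) = DU - {0}" "G (V 1, cV) = ball 0 1"
  unfolding G_def by (rule if_not_P, rule Vne, rule if_not_P, rule Vne, rule if_P, rule refl)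

lemma G_open: "c \<in> charts surf \<Longrightarrow> open (G c)"
  using DU_open by (auto simp: G_simps)

lemma cU_eq_0: "cU P = 0 \<longleftrightarrow> X P = 0" by (simp add: cU_def)
lemma cW_eq_0: "cW P = 0 \<longleftrightarrow> X P = 0" by (simp add: cW_def cU_def)

lemma coord_in_G:
  assumes c: "c \<in> charts surf" and P: "P \<in> fst c" "P \<notin> poles"
  shows "snd c P \<in> G c"
proof -
  consider "c = (U, cU)" | "c = (W, cW)" | "c = (V 1, cV)" using c by auto
  then show ?thesis
  proof cases
    case 1
    have PU: "P \<in> U" using P(1) 1 by simp
    then have "X P \<noteq> 0" using P(2) by (simp add: U_def poles_def)
    then show ?thesis using cU_DU[OF PU] unfolding 1 G_simps snd_conv by (simp add: cU_eq_0)
  next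
    case 2
    have PW: "P \<in> W" using P(1) 2 by simp
    then have "X P \<noteq> 0" using P(2) by (simp add: W_def poles_def)
    then show ?thesis using cW_DU[OF PW] unfolding 2 G_simps snd_conv by (simp add: cW_eq_0)
  next
    case 3
    then show ?thesis using P(1) cV_ball[of P] by (simp only: G_simps fst_conv snd_conv)
  qed
qed

lemma v_chart:
  "u \<in> DU - {0} \<Longrightarrow> v (chart_inv (U, cU) u) = inverse (u * rt (u ^ n + 2 * \<i>))"
  "u \<in> DU - {0} \<Longrightarrow> v (chart_inv (W, cW) u) = inverse (u * rt (u ^ n + 2 * \<i>))"
  "t \<in> ball 0 1 \<Longrightarrow> v (chart_inv (V 1, cV) t) = t ^ 2"
  by (simp_all add: v_def chart_inv_surf XY_pU XY_pV power_inverse)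

lemma v_holo: assumes "c \<in> charts surf" shows "(\<lambda>z. v (chart_inv c z)) holomorphic_on G c"
proof -
  have "(\<lambda>u. u * rt (u ^ n + 2 * \<i>)) holomorphic_on DU - {0}"
    by (intro holomorphic_intros rt_holo upper_not_nonpos DU_upper) auto
  then have h: "(\<lambda>u. inverse (u * rt (u ^ n + 2 * \<i>))) holomorphic_on DU - {0}"
    by (intro holomorphic_on_inverse) auto
  have "(\<lambda>t. t ^ 2 :: complex) holomorphic_on ball 0 1" by (intro holomorphic_intros)
  then have "(\<lambda>z. v (chart_inv (V 1, cV) z)) holomorphic_on ball 0 1"
    by (rule holomorphic_transform) (simp only: v_chart)
  moreover have "(\<lambda>z. v (chart_inv (U, cU) z)) holomorphic_on DU - {0}"
    using h by (rule holomorphic_transform) (simp only: v_chart)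
  moreover have "(\<lambda>z. v (chart_inv (W, cW) z)) holomorphic_on DU - {0}"
    using h by (rule holomorphic_transform) (simp only: v_chart)
  ultimately show ?thesis using assms by (auto simp: G_simps)
qed

lemma f_holo: assumes "c \<in> charts surf" shows "(f \<circ> chart_inv c) holomorphic_on G c"
  unfolding f_def o_def by (intro holomorphic_intros v_holo[OF assms])

text \<open>Differentiate \<open>x\<^sup>n = y\<^sup>2 + 1\<close>: if \<open>dx = 0\<close> then \<open>y dy = 0\<close>, and \<open>dy \<noteq> 0\<close> off the centre of the chart.\<close>
lemma X_pU_deriv:
  assumes u: "u \<in> DU" and y: "Y (pU u) \<noteq> 0" and u0: "u \<noteq> 0"
  shows "deriv (\<lambda>u. u * rt (u ^ n + 2 * \<i>)) u \<noteq> 0"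
proof
  let ?g = "\<lambda>u. u * rt (u ^ n + 2 * \<i>)"
  assume D: "deriv ?g u = 0"
  have "?g holomorphic_on DU"
    by (intro holomorphic_intros rt_holo upper_not_nonpos DU_upper)
  then have "(?g has_field_derivative 0) (at u)"
    using holomorphic_derivI[OF _ DU_open u, of ?g] D by simp
  then have "((\<lambda>u. ?g u ^ n) has_field_derivative 0) (at u)"
    using DERIV_power[of ?g 0 u UNIV n] by simp
  then have "((\<lambda>u. (u ^ n + \<i>)\<^sup>2 + 1) has_field_derivative 0) (at u)"
  proof (rule has_field_derivative_transform_within_open[OF _ DU_open u])
    fix w assume "w \<in> DU"
    from aU_A[OF this] show "?g w ^ n = (w ^ n + \<i>)\<^sup>2 + 1" by (simp add: A_def aU_def)
  qed
  moreover have "((\<lambda>u. (u ^ n + \<i>)\<^sup>2 + 1) has_field_derivative (2 * (u ^ n + \<i>) * (of_nat n * u ^ (n - 1)))) (at u)"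
    by (auto intro!: derivative_eq_intros)
  ultimately have "2 * (u ^ n + \<i>) * (of_nat n * u ^ (n - 1)) = 0" by (metis DERIV_unique)
  then have "u ^ n + \<i> = 0" using u0 n unfolding mult_eq_0_iff by simp
  then show False using y by (simp add: XY_pU[OF u])
qed

lemma v_deriv_nonzero:
  assumes c: "c \<in> charts surf" and P: "P \<in> fst c" "P \<noteq> 0" "X P \<noteq> 0" "Y P \<noteq> 0"
  shows "deriv (\<lambda>z. v (chart_inv c z)) (snd c P) \<noteq> 0"
proof -
  let ?g = "\<lambda>u. u * rt (u ^ n + 2 * \<i>)"
  have main: "deriv (\<lambda>z. v (chart_inv c z)) u \<noteq> 0"
    if u: "u \<in> DU" "u \<noteq> 0" "Y (pU u) \<noteq> 0" and eq: "\<And>z. z \<in> DU - {0} \<Longrightarrow> v (chart_inv c z) = inverse (?g z)" for u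
  proof -
    have op: "open (DU - {0})" using DU_open by auto
    have "?g holomorphic_on DU"
      by (intro holomorphic_intros rt_holo upper_not_nonpos DU_upper)
    then have "(?g has_field_derivative deriv ?g u) (at u)"
      by (rule holomorphic_derivI[OF _ DU_open u(1)])
    moreover have "?g u \<noteq> 0" using u by simp
    ultimately have "((\<lambda>u. inverse (?g u)) has_field_derivative - (inverse (?g u) * deriv ?g u * inverse (?g u))) (at u)"
      by (rule DERIV_inverse')
    then have "((\<lambda>z. v (chart_inv c z)) has_field_derivative - (inverse (?g u) * deriv ?g u * inverse (?g u))) (at u)"
      by (rule has_field_derivative_transform_within_open[OF _ op]) (use u eq in auto)
    then have "deriv (\<lambda>z. v (chart_inv c z)) u = - (inverse (?g u) * deriv ?g u * inverse (?g u))"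
      by (rule DERIV_imp_deriv)
    then show ?thesis using X_pU_deriv[OF u(1,3,2)] \<open>?g u \<noteq> 0\<close> by simp
  qed
  consider "c = (U, cU)" | "c = (W, cW)" | "c = (V 1, cV)" using c by auto
  then show ?thesis
  proof cases
    case 1
    have PU: "P \<in> U" using P(1) 1 by simp
    show ?thesis unfolding 1
      by (rule main[unfolded 1]) (use PU P cU_DU v_chart(1) in \<open>auto simp: cU_eq_0\<close>)
  next
    case 2
    have PW: "P \<in> W" using P(1) 2 by simp
    have "pU (cW P) = flip P" using pW_cW[OF PW] by (metis flip_flip pW_def)
    then have "Y (pU (cW P)) \<noteq> 0" using P(4) by simp
    then show ?thesis unfolding 2
      by (intro main[unfolded 2]) (use PW P cW_DU v_chart(2) in \<open>auto simp: cW_eq_0\<close>)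
  next
    case 3
    have PV: "P \<in> V 1" using P(1) 3 by simp
    have "((\<lambda>t::complex. t ^ 2) has_field_derivative 2 * cV P) (at (cV P))"
      by (auto intro!: derivative_eq_intros)
    then have "((\<lambda>z. v (chart_inv (V 1, cV) z)) has_field_derivative 2 * cV P) (at (cV P))"
      by (rule has_field_derivative_transform_within_open[OF _ open_ball cV_ball[OF PV]]) (simp only: v_chart)
    then have "deriv (\<lambda>z. v (chart_inv (V 1, cV) z)) (cV P) = 2 * cV P" by (rule DERIV_imp_deriv)
    moreover have "cV P \<noteq> 0" using pV_cV[OF PV] P(2) by (metis pV_0)
    ultimately show ?thesis unfolding 3 by simp
  qed
qed

lemma f_deriv:
  assumes c: "c \<in> charts surf" and P: "P \<in> fst c" "P \<notin> poles"
  shows "deriv (f \<circ> chart_inv c) (snd c P) = 2 * (of_nat d * v P ^ (d - 1)) * deriv (\<lambda>z. v (chart_inv c z)) (snd c P)"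
proof -
  interpret S: riemann surf by unfold_locales (rule surf_riemann)
  have "((\<lambda>z. v (chart_inv c z)) has_field_derivative deriv (\<lambda>z. v (chart_inv c z)) (snd c P)) (at (snd c P))"
    by (rule holomorphic_derivI[OF v_holo[OF c] G_open[OF c] coord_in_G[OF c P]])
  moreover have "v (chart_inv c (snd c P)) = v P" using S.inv_coord[OF c P(1)] by simp
  ultimately have "((f \<circ> chart_inv c) has_field_derivative 2 * (of_nat d * v P ^ (d - 1)) * deriv (\<lambda>z. v (chart_inv c z)) (snd c P)) (at (snd c P))"
    unfolding f_def o_def by (auto intro!: derivative_eq_intros)
  then show ?thesis by (rule DERIV_imp_deriv)
qed

lemma XY_zeros: assumes "P \<in> zeros" shows "X P \<noteq> 0" "Y P \<noteq> 0" "norm (X P) = 1 / 2"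
proof -
  have P: "P \<in> K" "P \<noteq> 0" "X P ^ d = inverse (2 ^ d)" using assms by (auto simp: zeros_def)
  show h: "norm (X P) = 1 / 2" using P(3) by (intro norm_power_half) (simp flip: norm_power, simp add: norm_inverse norm_power)
  then show "X P \<noteq> 0" by auto
  show "Y P \<noteq> 0"
  proof
    assume "Y P = 0"
    then have "X P ^ n = 1" using K_eq[OF P(1,2)] by simp
    then have "norm (X P) ^ n = 1" by (simp flip: norm_power)
    moreover have "(1 / 2 :: real) ^ n < 1" using n by (simp add: power_less_one_iff)
    ultimately show False using h by simp
  qed
qed

text \<open>At the zeros \<open>|x| = 1/2\<close>, so \<open>y\<^sup>2 = x\<^sup>n - 1\<close> is not zero and \<open>v\<close> is a local coordinate there.\<close>
lemma simple_zero:
  assumes c: "c \<in> charts surf" and P: "P \<in> zeros" "P \<in> fst c"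
  shows "\<exists>A. open A \<and> snd c P \<in> A \<and> (f \<circ> chart_inv c) holomorphic_on A \<and> deriv (f \<circ> chart_inv c) (snd c P) \<noteq> 0"
proof (intro exI[of _ "G c"] conjI)
  have Pp: "P \<notin> poles" using P zeros_sub(2) by blast
  show "snd c P \<in> G c" by (rule coord_in_G[OF c P(2) Pp])
  have "P \<noteq> 0" using P by (simp add: zeros_def)
  then show "deriv (f \<circ> chart_inv c) (snd c P) \<noteq> 0"
    unfolding f_deriv[OF c P(2) Pp] using v_deriv_nonzero[OF c P(2)] XY_zeros[OF P(1)] d by (simp add: v_def)
qed (rule G_open[OF c] f_holo[OF c])+

text \<open>The critical points are the points with \<open>y = 0\<close>, where \<open>|v| = 1\<close>, and the point at infinity, where
\<open>v = 0\<close>.\<close>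
lemma critical_values:
  assumes c: "c \<in> charts surf" and P: "P \<in> fst c" "P \<notin> zeros \<union> poles" and D: "deriv (f \<circ> chart_inv c) (snd c P) = 0"
  shows "2 \<le> norm (f P)" "norm (f P) \<le> 2 * (2 ^ d + 1)"
proof -
  have PK: "P \<in> K" using c P(1) by (auto simp: U_def W_def V_def)
  have two: "(2::real) \<le> 2 ^ d" using d power_increasing[of 1 d "2::real"] by simp
  have "2 \<le> norm (f P) \<and> norm (f P) \<le> 2 * (2 ^ d + 1)"
  proof (cases "P = 0")
    case True
    then show ?thesis using two by (simp add: norm_mult norm_power)
  next
    case False
    then have X0: "X P \<noteq> 0" using P(2) PK by (auto simp: poles_def)
    have "Y P = 0"
      using D v_deriv_nonzero[OF c P(1) False X0] X0 d P(2) unfolding f_deriv[OF c P(1)] by (auto simp: v_def f_deriv[OF c P(1)])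
    then have "X P ^ n = 1" using K_eq[OF PK False] by simp
    then have "norm (X P) ^ n = 1" by (simp flip: norm_power)
    then have "norm (X P) ^ n = 1 ^ n" by simp
    then have "norm (X P) = 1" by (rule power_eq_imp_eq_base) (use n in auto)
    then have "norm (v P ^ d) = 1" by (simp add: v_def norm_power norm_inverse)
    then have "norm (v P ^ d - 2 ^ d) \<le> 2 ^ d + 1" "2 ^ d - 1 \<le> norm (v P ^ d - 2 ^ d)"
      using norm_triangle_ineq4[of "v P ^ d" "2 ^ d"] norm_triangle_ineq2[of "2 ^ d" "v P ^ d"]
      by (simp_all add: norm_power norm_minus_commute)
    then show ?thesis using two unfolding norm_f by (intro conjI) simp_all
  qed
  then show "2 \<le> norm (f P)" "norm (f P) \<le> 2 * (2 ^ d + 1)" by auto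
qed

lemma open_in_K: "open O' \<Longrightarrow> openin (top_of_set K) {P \<in> K. P \<noteq> 0 \<and> inversion P \<in> O'}"
proof -
  assume "open O'"
  then have "open (- {0} \<inter> inversion -` O')"
    by (intro continuous_open_preimage[OF continuous_on_inversion]) auto
  moreover have "{P \<in> K. P \<noteq> 0 \<and> inversion P \<in> O'} = K \<inter> (- {0} \<inter> inversion -` O')" by auto
  ultimately show ?thesis by (simp add: openin_open_Int)
qed

lemma near_pole:
  "\<exists>T. openin (top_of_set K) T \<and> poles \<subseteq> T \<and> (\<forall>q\<in>T - (zeros \<union> poles). R < norm (f q) + inverse (norm (f q)))"
proof -
  define M where "M = 2 ^ d + \<bar>R\<bar> + 1"
  have M: "M \<ge> 1" by (simp add: M_def)
  let ?T = "{P \<in> K. P \<noteq> 0 \<and> inversion P \<in> {z. norm (fst z) < inverse M}}"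
  have "open {z :: complex \<times> complex. norm (fst z) < inverse M}"
    by (intro open_Collect_less continuous_intros)
  then have "openin (top_of_set K) ?T" by (rule open_in_K)
  moreover have "poles \<subseteq> ?T" using M by (auto simp: poles_def)
  moreover have "R < norm (f q) + inverse (norm (f q))" if q: "q \<in> ?T - (zeros \<union> poles)" for q
  proof -
    have X0: "X q \<noteq> 0" and Xs: "norm (X q) < inverse M" using q by (auto simp: poles_def)
    have "M < norm (v q)"
      using Xs X0 M by (simp add: v_def norm_inverse) (metis inverse_inverse_eq inverse_less_iff_less zero_less_norm_iff less_le_trans zero_less_one positive_imp_inverse_positive)
    moreover have "norm (v q) \<le> norm (v q) ^ d"
      using \<open>M < norm (v q)\<close> M d power_increasing[of 1 d "norm (v q)"] by simp
    moreover have "norm (v q ^ d) - 2 ^ d \<le> norm (v q ^ d - 2 ^ d)"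
      using norm_triangle_ineq2[of "v q ^ d" "2 ^ d"] by (simp add: norm_power)
    ultimately have "\<bar>R\<bar> < norm (f q)" unfolding norm_f norm_power M_def by linarith
    then show ?thesis using inverse_nonnegative_iff_nonnegative[of "norm (f q)"] norm_ge_zero[of "f q"] by linarith
  qed
  ultimately show ?thesis by blast
qed

lemma near_zero:
  "\<exists>T. openin (top_of_set K) T \<and> zeros \<subseteq> T \<and> (\<forall>q\<in>T - (zeros \<union> poles). R < norm (f q) + inverse (norm (f q)))"
proof -
  define e where "e = inverse (\<bar>R\<bar> + 1)"
  have e: "e > 0" by (simp add: e_def)
  define O' where "O' = {z :: complex \<times> complex. fst z \<noteq> 0} \<inter> (\<lambda>z. 2 * (inverse (fst z) ^ d - 2 ^ d)) -` ball 0 e"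
  have c: "continuous_on {z :: complex \<times> complex. fst z \<noteq> 0} (\<lambda>z. 2 * (inverse (fst z) ^ d - 2 ^ d))"
    by (intro continuous_intros) auto
  have "open {z :: complex \<times> complex. fst z \<noteq> 0}"
    by (intro open_Collect_neq continuous_intros)
  then have "open O'" unfolding O'_def by (rule continuous_open_preimage[OF c]) simp
  let ?T = "{P \<in> K. P \<noteq> 0 \<and> inversion P \<in> O'}"
  have mem: "inversion P \<in> O' \<longleftrightarrow> X P \<noteq> 0 \<and> norm (f P) < e" for P by (simp add: O'_def f_def v_def)
  have "openin (top_of_set K) ?T" by (rule open_in_K[OF \<open>open O'\<close>])
  moreover have "zeros \<subseteq> ?T"
  proof
    fix P assume P: "P \<in> zeros"
    then have "f P = 0" by (simp add: f_eq_0 zeros_def)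
    then show "P \<in> ?T" using P e XY_zeros(1)[OF P] unfolding mem by (simp add: zeros_def)
  qed
  moreover have "R < norm (f q) + inverse (norm (f q))" if q: "q \<in> ?T - (zeros \<union> poles)" for q
  proof -
    have "f q \<noteq> 0" using q by (intro f_nonzero) auto
    moreover have "norm (f q) < e" using q mem by blast
    ultimately have "inverse e < inverse (norm (f q))" by (simp add: less_imp_inverse_less)
    then have "\<bar>R\<bar> + 1 < inverse (norm (f q))" by (simp add: e_def)
    then show ?thesis using norm_ge_zero[of "f q"] by linarith
  qed
  ultimately show ?thesis by blast
qed

sublocale catenoid_pullback surf "zeros \<union> poles" f
proof unfold_locales
  show "riemann_surface surf" by (rule surf_riemann)
  show "compact_space (surf_top surf)" by (rule surf_compact)
  show "finite (zeros \<union> poles)" using zeros_poles_card by simp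
  show "zeros \<union> poles \<subseteq> points surf" using zeros_sub by simp
  show "(f \<circ> chart_inv c) holomorphic_on snd c ` (fst c - (zeros \<union> poles))" if "c \<in> charts surf" for c
    by (rule holomorphic_on_subset[OF f_holo[OF that]]) (use coord_in_G[OF that] in blast)
  show "f q \<noteq> 0" if "q \<in> points surf - (zeros \<union> poles)" for q
    using that by (intro f_nonzero) simp
  show "\<exists>T. openin (surf_top surf) T \<and> q \<in> T \<and> (\<forall>q\<in>T - (zeros \<union> poles). R < norm (f q) + inverse (norm (f q)))"
    if "q \<in> zeros \<union> poles" for q R
    using that near_pole[of R] near_zero[of R] unfolding surf_simps by blast
  show "\<exists>R. \<forall>c\<in>charts surf. \<forall>q\<in>fst c - (zeros \<union> poles). deriv (f \<circ> chart_inv c) (snd c q) = 0 \<longrightarrow> norm (f q) + inverse (norm (f q)) \<le> R"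
  proof (intro exI[of _ "2 * (2 ^ d + 1) + 1"] ballI impI)
    fix c q assume "c \<in> charts surf" "q \<in> fst c - (zeros \<union> poles)" "deriv (f \<circ> chart_inv c) (snd c q) = 0"
    then have b: "2 \<le> norm (f q)" "norm (f q) \<le> 2 * (2 ^ d + 1)" using critical_values by auto
    have "inverse (norm (f q)) \<le> 1" using b(1) by (intro inverse_le_1_iff[THEN iffD2]) auto
    then show "norm (f q) + inverse (norm (f q)) \<le> 2 * (2 ^ d + 1) + 1" using b(2) by linarith
  qed
  show "\<exists>q\<in>points surf - (zeros \<union> poles). norm (f q) \<noteq> 1"
  proof
    have "(1::real) \<le> 2 ^ d" by simp
    moreover have "norm (f 0) = 2 * 2 ^ d" by (simp add: norm_mult norm_power)
    ultimately have "norm (f 0) \<noteq> 1" by linarith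
    then show "norm (f 0) \<noteq> 1" .
    show "0 \<in> points surf - (zeros \<union> poles)" by (simp add: K_def zeros_def poles_def)
  qed
qed

definition rtd :: "complex \<Rightarrow> complex" where "rtd z = exp (Ln z / of_nat d)"

lemma rtd: "z \<noteq> 0 \<Longrightarrow> rtd z ^ d = z" "rtd z \<noteq> 0"
  using d by (auto simp: rtd_def simp flip: exp_of_nat_mult)

text \<open>The first component is the root of unity by which \<open>v\<close> differs from the principal root of \<open>v\<^sup>d\<close>; the
second one is the sign by which \<open>y\<close> differs from the root \<open>\<i> * csqrt (1 - x\<^sup>n)\<close> of \<open>x\<^sup>n - 1\<close>, which is continuous for \<open>|x| < 1\<close>.\<close>
definition label :: "complex \<times> complex \<Rightarrow> complex \<times> complex" where
  "label P = (v P / rtd (v P ^ d), Y P / (\<i> * csqrt (1 - X P ^ n)))"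

definition circle where "circle = {q \<in> K - (zeros \<union> poles). norm (f q) = 1}"

text \<open>On the circle \<open>v\<^sup>d\<close> lies within \<open>1/2\<close> of \<open>2\<^sup>d \<ge> 2\<close>.\<close>
lemma circleD:
  assumes "P \<in> circle"
  shows "P \<in> K - {0}" "X P \<noteq> 0" "v P ^ d \<notin> \<real>\<^sub>\<le>\<^sub>0" "norm (X P) < 1"
proof -
  have P: "P \<in> K" "P \<notin> poles" "norm (f P) = 1" using assms by (auto simp: circle_def)
  have two: "(2::real) \<le> 2 ^ d" using d power_increasing[of 1 d "2::real"] by simp
  have "P \<noteq> 0" using P(3) two by (auto simp: norm_mult norm_power)
  then show "P \<in> K - {0}" "X P \<noteq> 0" using P by (auto simp: poles_def)
  have n2: "norm (v P ^ d - 2 ^ d) = 1 / 2" using P(3) by (simp add: norm_f)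
  have "\<bar>Re (v P ^ d - 2 ^ d)\<bar> \<le> 1 / 2" using abs_Re_le_cmod[of "v P ^ d - 2 ^ d"] n2 by simp
  moreover have "Re (2 ^ d) = 2 ^ d" by (metis Re_complex_of_real of_real_numeral of_real_power)
  ultimately have "Re (v P ^ d) > 1" using two unfolding minus_complex.sel by linarith
  then show "v P ^ d \<notin> \<real>\<^sub>\<le>\<^sub>0" by (auto simp: complex_nonpos_Reals_iff)
  have "1 < norm (v P) ^ d" using \<open>Re (v P ^ d) > 1\<close> complex_Re_le_cmod[of "v P ^ d"] by (simp add: norm_power)
  then have "1 < norm (v P)" using one_less_power[of _ d] d by (metis linorder_not_less norm_ge_zero power_le_one)
  then show "norm (X P) < 1" using \<open>X P \<noteq> 0\<close> by (simp add: v_def norm_inverse one_less_inverse_iff)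
qed

lemma cont_label: "continuous_on circle label"
proof -
  have sub: "circle \<subseteq> K - {0}" using circleD(1) by blast
  have c: "continuous_on circle X" "continuous_on circle Y"
    by (rule continuous_on_subset[OF cont_XY(1) sub] continuous_on_subset[OF cont_XY(2) sub])+
  have cv: "continuous_on circle v"
    unfolding v_def by (rule continuous_on_inverse[OF c(1)]) (use circleD(2) in blast)
  have r: "continuous_on circle (\<lambda>P. rtd (v P ^ d))"
    unfolding rtd_def
    by (rule continuous_on_exp, rule continuous_on_divide, rule continuous_on_Ln', rule continuous_on_power[OF cv])
       (use circleD(3) d in auto)
  have om: "1 - X P ^ n \<notin> \<real>\<^sub>\<le>\<^sub>0" if "P \<in> circle" for P
    using circleD(4)[OF that] n by (intro one_minus_power)
  have s: "continuous_on circle (\<lambda>P. csqrt (1 - X P ^ n))"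
    by (rule csqrt_cont[OF continuous_on_diff[OF continuous_on_const continuous_on_power[OF c(1)]] om])
  have s0: "\<i> * csqrt (1 - X P ^ n) \<noteq> 0" if "P \<in> circle" for P using om[OF that] by auto
  show ?thesis
    unfolding label_def
    by (intro continuous_on_Pair continuous_on_divide cv r c(2) continuous_on_mult continuous_on_const s ballI rtd(2) s0)
qed

text \<open>All labels occur already over the single point \<open>f = 1\<close>, that is \<open>v\<^sup>d = 2\<^sup>d + 1/2\<close>.\<close>
lemma label_image: "label ` circle = {z. z ^ d = 1} \<times> {1, -1}"
proof (intro equalityI subsetI)
  fix z assume "z \<in> label ` circle"
  then obtain P where P: "P \<in> circle" "z = label P" by blast
  note D = circleD[OF P(1)]
  have vd: "v P ^ d \<noteq> 0" using D(2) by (simp add: v_def)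
  have "(v P / rtd (v P ^ d)) ^ d = 1" using vd by (simp add: power_divide rtd)
  moreover have "(Y P / (\<i> * csqrt (1 - X P ^ n)))\<^sup>2 = 1"
  proof -
    have "(Y P)\<^sup>2 = - (1 - X P ^ n)" using K_eq[of P] D(1) by simp
    moreover have "1 - X P ^ n \<noteq> 0" using one_minus_power[OF D(4) n(3)] by auto
    moreover have "(\<i> * csqrt (1 - X P ^ n))\<^sup>2 = - (1 - X P ^ n)" by (simp only: power_mult_distrib power2_csqrt) simp
    ultimately show ?thesis by (simp add: power_divide)
  qed
  ultimately show "z \<in> {z. z ^ d = 1} \<times> {1, -1}" unfolding P(2) label_def by (simp add: power2_eq_1_iff)
next
  fix z :: "complex \<times> complex" assume "z \<in> {z. z ^ d = 1} \<times> {1, -1}"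
  then obtain \<zeta> \<epsilon> where z: "z = (\<zeta>, \<epsilon>)" "\<zeta> ^ d = 1" "\<epsilon> = 1 \<or> \<epsilon> = -1" by auto
  define w :: complex where "w = 2 ^ d + 1 / 2"
  have "w = of_real (2 ^ d + 1 / 2)" by (simp add: w_def)
  moreover have "(2 ^ d + 1 / 2 :: real) > 0" by (simp add: add_pos_pos)
  ultimately have w0: "w \<noteq> 0" by (metis of_real_eq_0_iff less_irrefl)
  define u where "u = \<zeta> * rtd w"
  have ud: "u ^ d = w" using rtd(1)[OF w0] z(2) by (simp add: u_def power_mult_distrib)
  have u0: "u \<noteq> 0" using ud w0 d by (metis power_0_left not_one_le_zero)
  define x where "x = inverse u"
  define y where "y = \<epsilon> * (\<i> * csqrt (1 - x ^ n))"
  have "\<epsilon>\<^sup>2 = 1" using z(3) by auto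
  have "y\<^sup>2 = \<epsilon>\<^sup>2 * (\<i>\<^sup>2 * (csqrt (1 - x ^ n))\<^sup>2)" by (simp only: y_def power_mult_distrib)
  also have "\<dots> = x ^ n - 1" unfolding \<open>\<epsilon>\<^sup>2 = 1\<close> power2_csqrt by simp
  finally have "x ^ n = y\<^sup>2 + 1" by simp
  note pt = point[OF this]
  let ?P = "point x y"
  have vP: "v ?P = u" using pt u0 by (simp add: v_def x_def)
  have fP: "f ?P = 1" unfolding f_def vP ud by (simp add: w_def)
  have "?P \<notin> zeros"
  proof
    assume "?P \<in> zeros"
    then have "f ?P = 0" by (simp add: f_eq_0 zeros_def)
    then show False using fP by simp
  qed
  moreover have "?P \<notin> poles" using pt u0 by (simp add: poles_def x_def)
  ultimately have mem: "?P \<in> circle" using pt fP by (simp add: circle_def)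
  have "csqrt (1 - x ^ n) \<noteq> 0"
    using one_minus_power[OF circleD(4)[OF mem] n(3)] pt by auto
  then have "label ?P = z"
    unfolding label_def vP ud using pt z(1) rtd(2)[of w] by (simp add: u_def y_def)
  then show "z \<in> label ` circle" using mem by (metis imageI)
qed

lemma many_components:
  "infinite (singular_components (puncture surf (zeros \<union> poles)) f) \<or>
   2 * d \<le> card (singular_components (puncture surf (zeros \<union> poles)) f)"
proof -
  have "{q \<in> points (puncture surf (zeros \<union> poles)). norm (f q) = 1} = circle"
    unfolding points_puncture circle_def by simp
  moreover have "subtopology (surf_top (puncture surf (zeros \<union> poles))) circle = top_of_set circle"
  proof -
    have "K \<inter> ((K - (zeros \<union> poles)) \<inter> circle) = circle" by (auto simp: circle_def)
    then show ?thesis by (simp add: puncture_def subtopology_subtopology Int_assoc)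
  qed
  ultimately have sc: "singular_components (puncture surf (zeros \<union> poles)) f = connected_components_of (top_of_set circle)"
    by (simp add: singular_components_def)
  have "finite {z::complex. z ^ d = 1}" "card {z::complex. z ^ d = 1} = d"
    using card_complex_roots_unity[of d] finite_nth_roots[of d 1] d by auto
  then have "finite ({z::complex. z ^ d = 1} \<times> {1, -1::complex})" "card ({z::complex. z ^ d = 1} \<times> {1, -1::complex}) = 2 * d"
    by (simp_all add: card_cartesian_product)
  then show ?thesis
    unfolding sc using card_components_ge[of "top_of_set circle" label "{z. z ^ d = 1} \<times> {1, -1}"] cont_label label_image by simp
qed

end

section \<open>Existence\<close>

theorem theorem3p3:
  fixes p m N :: int
  assumes "p \<ge> 1" and "m \<ge> 1" and "N - \<lceil>real_of_int m / 2\<rceil> > p + 2"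
  shows "\<exists>(S :: surface_point surface) E F G \<Omega> z0 X.
           riemann_surface S \<and> compact_space (surf_top S) \<and> has_genus S (nat p) \<and>
           E \<subseteq> points S \<and> F \<subseteq> points S \<and> E \<inter> F = {} \<and> finite E \<and> finite F \<and>
           int (card E) = 2 * N \<and> int (card F) = 2 * m \<and>
           weierstrass_data (puncture S (E \<union> F)) G \<Omega> \<and>
           maximal_map (puncture S (E \<union> F)) G \<Omega> z0 X \<and>
           complete_maximal (puncture S (E \<union> F)) G \<Omega> \<and>
           (\<forall>x\<in>E. complete_end S (E \<union> F) G \<Omega> x) \<and>
           (\<forall>x\<in>F. simple_end S (E \<union> F) G \<Omega> x) \<and>
           (infinite (singular_components (puncture S (E \<union> F)) G) \<or>
            2 * N \<le> int (card (singular_components (puncture S (E \<union> F)) G)))"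
proof -
  have "\<lceil>real_of_int m / 2\<rceil> \<ge> 0" using assms(2) by simp
  then have N: "N \<ge> 1" using assms by linarith
  define d where "d = nat (N + m - 1)"
  have dN: "int d = N + m - 1" using N assms(2) by (simp add: d_def)
  interpret superelliptic_map "nat p" d
    by unfold_locales (use assms(1,2) N dN in auto)
  have "nat (2 * m) \<le> 2 * d" using dN N by linarith
  then have "nat (2 * m) \<le> card zeros" by (simp only: zeros_poles_card)
  then obtain F where F: "F \<subseteq> zeros" "card F = nat (2 * m)" by (meson obtain_subset_with_card_n)
  define E where "E = (zeros \<union> poles) - F"
  have EF: "E \<union> F = zeros \<union> poles" "E \<inter> F = {}" using F by (auto simp: E_def)
  have "E \<union> F \<subseteq> points surf" using zeros_sub(1) by (simp add: EF(1))
  then have sub: "E \<subseteq> points surf" "F \<subseteq> points surf" by (simp_all only: Un_subset_iff)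
  have fin: "finite E" "finite F" using zeros_poles_card F by (auto simp: E_def intro: finite_subset)
  have cF: "int (card F) = 2 * m" using F assms(2) by simp
  have "card (zeros \<union> poles) = 2 * d + 2"
    using zeros_poles_card zeros_sub(2) by (simp add: card_Un_disjoint)
  then have "card E + card F = 2 * d + 2"
    using card_Un_disjoint[OF fin EF(2)] EF(1) by simp
  then have cE: "int (card E) = 2 * N" using cF dN by linarith
  have "0 \<in> points M" by (simp add: K_def zeros_def poles_def)
  then obtain X where X: "maximal_map M f dlog 0 X" using maximal by blast
  have sc: "infinite (singular_components M f) \<or> 2 * N \<le> int (card (singular_components M f))"
    using many_components dN assms(2) by auto
  have simple: "simple_end surf (zeros \<union> poles) f dlog x" if "x \<in> F" for x
  proof (rule simple_end_at)
    show "x \<in> zeros \<union> poles" "f x = 0" using that F(1) by (auto simp: zeros_def f_eq_0)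
  qed (use that F(1) simple_zero in blast)
  show ?thesis
  proof (intro exI conjI ballI)
    show "riemann_surface surf" by (rule surf_riemann)
    show "compact_space (surf_top surf)" by (rule surf_compact)
    show "has_genus surf (nat p)" by (rule genus)
    show "E \<subseteq> points surf" by (rule sub)
    show "F \<subseteq> points surf" by (rule sub)
    show "E \<inter> F = {}" by (rule EF)
    show "finite E" by (rule fin)
    show "finite F" by (rule fin)
    show "int (card E) = 2 * N" by (rule cE)
    show "int (card F) = 2 * m" by (rule cF)
    show "weierstrass_data (puncture surf (E \<union> F)) f dlog"
      unfolding EF(1) by (rule weierstrass)
    show "maximal_map (puncture surf (E \<union> F)) f dlog 0 X"
      unfolding EF(1) by (rule X)
    show "complete_maximal (puncture surf (E \<union> F)) f dlog"
      unfolding EF(1) by (rule complete)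
    show "complete_end surf (E \<union> F) f dlog x" if "x \<in> E" for x
      unfolding EF(1) by (rule complete_end_at) (use that EF(1) in blast)
    show "simple_end surf (E \<union> F) f dlog x" if "x \<in> F" for x
      unfolding EF(1) by (rule simple[OF that])
    show "infinite (singular_components (puncture surf (E \<union> F)) f) \<or>
        2 * N \<le> int (card (singular_components (puncture surf (E \<union> F)) f))"
      unfolding EF(1) by (rule sc)
  qed
qed

end
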